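(* Let $d\ge1$, $\delta>1$ and $0<\gamma<1$, and let $\mathscr{N}_\beta$ be the cardinality of the component of the origin in the soft Boolean model. (i) If $1/\gamma-1>1$, then there exists $\beta'>0$ such that, for all $0<\beta<\beta'$, there exist constants $c,C\in(0,\infty)$ such that, for all $m>1$, $$c\,m^{1-1/\gamma}\le\mathbb{P}_o(\mathscr{N}_\beta>m)\le C\,m^{1-1/\gamma}.$$ (ii) If $1/\gamma-1<1$, then $\mathbb{E}_o[\mathscr{N}_\beta]=\infty$ for all $\beta>0$.
   Context: Soft Boolean model with parameters $\beta>0$, $\gamma\in(0,1)$, $\delta>1$ in $\mathbb{R}^d$: the vertex set $X$ is a homogeneous Poisson point process on $\mathbb{R}^d$ of intensity one. Each vertex $x\in X$ carries an independent radius $R_x$ with $\mathbb{P}(R_x>r)=1\wedge r^{-d/\gamma}$ for $r>0$. Given $X$, each unordered pair $\{x,y\}$ of distinct vertices carries an independent edge weight $W(x,y)$ with $\mathbb{P}(W(x,y)>w)=1\wedge w^{-d\delta}$ for $w>0$ (edge weights are independent of the radii). Two distinct vertices $x,y$ are joined by an edge if and only if $$|x-y|\le \beta^{1/d}\,W(x,y)\,(R_x\vee R_y),$$ with $|\cdot|$ the Euclidean norm. $\mathbb{P}_o$ (with expectation $\mathbb{E}_o$) denotes the law of the model after adding to $X$ a vertex at the origin $o$, with its own independent radius $R_o$ and independent edge weights to all other vertices (same distributions), connected by the same rule. Write $o\leftrightarrow x$ if $o$ and $x$ are connected by a finite path in the graph, and let $\mathscr{C}_\beta=\{x: o\leftrightarrow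 x\}$ be the component of the origin (containing $o$) and $\mathscr{N}_\beta=\sharp\mathscr{C}_\beta$ its cardinality. *)

theory Defs
  imports "HOL-Probability.Probability"
begin

text \<open>
  A homogeneous Poisson point process of intensity one, presented through a measurable enumeration
  of its points. Its total mass is almost surely infinite, so indexing the points by all natural
  numbers is no restriction. The number of points in \<open>A\<close> is the number of indices \<open>i\<close> with
  \<open>X i \<omega> \<in> A\<close>; this set is almost surely finite for bounded \<open>A\<close>, so that \<open>card\<close> is a genuine count.
  The Poisson weights are written out because they are also needed for sets of measure zero, which
  \<open>poisson_pmf\<close> excludes.
\<close>

locale poisson_process = prob_space M
  for M :: "'w measure" and X :: "nat \<Rightarrow> 'w \<Rightarrow> real ^ 'n" +
  assumes points_measurable: "\<And>i. random_variable borel (X i)"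
    and locally_finite: "\<And>A. A \<in> sets borel \<Longrightarrow> bounded A \<Longrightarrow> (AE \<omega> in M. finite {i. X i \<omega> \<in> A})"
    and poisson_counts: "\<And>A k. A \<in> sets borel \<Longrightarrow> bounded A \<Longrightarrow>
      prob {\<omega> \<in> space M. card {i. X i \<omega> \<in> A} = k}
        = measure lborel A ^ k / fact k * exp (- measure lborel A)"
    and independent_counts: "\<And>(J :: nat set) A. finite J \<Longrightarrow>
      (\<And>j. j \<in> J \<Longrightarrow> A j \<in> sets borel \<and> bounded (A j)) \<Longrightarrow> disjoint_family_on A J \<Longrightarrow>
      indep_vars (\<lambda>_. count_space UNIV) (\<lambda>j \<omega>. card {i. X i \<omega> \<in> A j}) J"

definition pairs :: "nat set set" where
  "pairs = {e. card e = 2}"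

text \<open>
  The soft Boolean model with an additional vertex at the origin. Vertices are labelled by
  natural numbers: label \<open>0\<close> is the origin and label \<open>Suc i\<close> is the \<open>i\<close>-th point of the Poisson
  process. \<open>R v\<close> is the radius of vertex \<open>v\<close>, and \<open>W {u, v}\<close> is the weight of the unordered pair of
  distinct vertices \<open>u\<close>, \<open>v\<close>. All radii and weights are jointly independent, and independent of the
  point locations.
\<close>

locale soft_boolean_model = poisson_process M X
  for \<gamma> \<delta> :: real and M :: "'w measure" and X :: "nat \<Rightarrow> 'w \<Rightarrow> real ^ 'n"
    and R :: "nat \<Rightarrow> 'w \<Rightarrow> real" and W :: "nat set \<Rightarrow> 'w \<Rightarrow> real" +
  assumes marks_independent: "indep_vars (\<lambda>_. borel) (case_sum R W) (UNIV <+> pairs)"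
    and points_marks_independent: "indep_set
      (sigma_sets (space M) (\<Union>i. {X i -` B \<inter> space M | B. B \<in> sets borel}))
      (sigma_sets (space M)
        (\<Union>k\<in>UNIV <+> pairs. {case_sum R W k -` B \<inter> space M | B. B \<in> sets borel}))"
    and radius_tail: "\<And>v r. 0 < r \<Longrightarrow>
      prob {\<omega> \<in> space M. r < R v \<omega>} = min 1 (r powr - (real CARD('n) / \<gamma>))"
    and weight_tail: "\<And>e w. e \<in> pairs \<Longrightarrow> 0 < w \<Longrightarrow>
      prob {\<omega> \<in> space M. w < W e \<omega>} = min 1 (w powr - (real CARD('n) * \<delta>))"

fun location :: "(nat \<Rightarrow> 'w \<Rightarrow> real ^ 'n) \<Rightarrow> 'w \<Rightarrow> nat \<Rightarrow> real ^ 'n" where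
  "location X \<omega> 0 = 0"
| "location X \<omega> (Suc i) = X i \<omega>"

definition edge :: "real \<Rightarrow> (nat \<Rightarrow> 'w \<Rightarrow> real ^ 'n) \<Rightarrow> (nat \<Rightarrow> 'w \<Rightarrow> real) \<Rightarrow> (nat set \<Rightarrow> 'w \<Rightarrow> real)
    \<Rightarrow> 'w \<Rightarrow> nat \<Rightarrow> nat \<Rightarrow> bool" where
  "edge \<beta> X R W \<omega> u v \<longleftrightarrow> u \<noteq> v \<and>
     norm (location X \<omega> u - location X \<omega> v)
       \<le> \<beta> powr (1 / real CARD('n)) * W {u, v} \<omega> * max (R u \<omega>) (R v \<omega>)"

definition origin_component :: "real \<Rightarrow> (nat \<Rightarrow> 'w \<Rightarrow> real ^ 'n) \<Rightarrow> (nat \<Rightarrow> 'w \<Rightarrow> real)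
    \<Rightarrow> (nat set \<Rightarrow> 'w \<Rightarrow> real) \<Rightarrow> 'w \<Rightarrow> nat set" where
  "origin_component \<beta> X R W \<omega> = {v. (edge \<beta> X R W \<omega>)\<^sup>*\<^sup>* 0 v}"

text \<open>
  The possibly infinite cardinality of the component. Counting labels instead of locations makes no
  difference, since the locations of distinct vertices almost surely differ.
\<close>

definition origin_component_size :: "real \<Rightarrow> (nat \<Rightarrow> 'w \<Rightarrow> real ^ 'n) \<Rightarrow> (nat \<Rightarrow> 'w \<Rightarrow> real)
    \<Rightarrow> (nat set \<Rightarrow> 'w \<Rightarrow> real) \<Rightarrow> 'w \<Rightarrow> ennreal" where
  "origin_component_size \<beta> X R W \<omega> =
     emeasure (count_space UNIV) (origin_component \<beta> X R W \<omega>)"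

end

theory Submission
  imports Defs
begin

text \<open>
  All radii and weights exceed 1 almost surely, and \<open>R v\<close> and \<open>W e\<close> are Pareto with exponents \<open>d / \<gamma>\<close>
  and \<open>d * \<delta>\<close>.

  Lower bound: a cube of volume \<open>6 * m\<close> at the origin contains at least \<open>m\<close> points with probability
  at least \<open>1 / 2\<close>, and with conditional probability of order \<open>m * m powr (- 1 / \<gamma>)\<close> one of them has
  a radius so large that it is joined to everything in the cube. With Markov's inequality this also
  gives the infinite expectation for \<open>\<gamma> > 1 / 2\<close>.

  Upper bound: since \<open>max r s \<le> r * s\<close> for \<open>r, s \<ge> 1\<close>, the expected number of embeddings of a tree with
  \<open>L\<close> edges is at most \<open>(K * \<beta>) ^ L\<close> times the product over its vertices of \<open>E (R ^ (d * degree))\<close>.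
  Let \<open>u ^ d = m\<close>. Summing over paths bounds the probability that the component contains a radius above
  \<open>u\<close> by the tail moment \<open>E (R ^ d; R > u)\<close>, which is of order \<open>m powr (1 - 1 / \<gamma>)\<close>. If all radii in
  the component are at most \<open>u\<close>, the \<open>p\<close>-th moment of its size is bounded by summing over the trees that
  span the origin and \<open>p\<close> vertices. In such a tree the excesses \<open>degree - 2\<close> add up to at most \<open>p - 1\<close>,
  and for \<open>p + 1 > 1 / \<gamma>\<close> the dominant contribution is the star with truncated moment
  \<open>E (R ^ (d * (p + 1)); R \<le> u)\<close>, of order \<open>m ^ p * m powr (1 - 1 / \<gamma>)\<close>. Both sums over trees
  converge because \<open>\<beta>\<close> is small.
\<close>

text \<open>The process is known only through its counts in bounded Borel sets, under an arbitrary
  enumeration of its points, so a sum over vertices is not directly an integral over positions.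
  Space is therefore cut into cells of side \<open>\<beta> powr (1 / d)\<close>, and factorial
  moments of the cell counts replace the Mecke formula: the expected number of tuples of
  \<open>L\<close> distinct points in \<open>L\<close> prescribed cells is at most
  \<open>\<beta> ^ L\<close>. What remains is a number of cell lists that depends on the marks
  alone, and the independence of marks and locations separates the two factors. The condition
  \<open>1 / \<gamma> > 2\<close> is the finiteness of \<open>E (R ^ (2 * d))\<close>, the moment
  that an inner vertex of a path requires. A branching vertex requires higher moments, which can be
  infinite; this forces the truncation at \<open>u\<close> and the control of the degrees. The order
  \<open>p\<close> is taken so large that the truncated moment of order \<open>p + 1\<close> is
  governed by radii close to \<open>u\<close>; its excess over the target rate is then the factor
  \<open>m ^ p\<close> that Markov's inequality removes.\<close>

section \<open>Embedded trees in a connected component\<close>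

text \<open>Loop erasure: the path is cut at its last exit from \<open>S\<close>, and a return to a
  vertex of \<open>q\<close> discards the loop in between. An embedded tree can then be extended by
  \<open>q\<close> without repeating a vertex.\<close>

lemma path_avoiding:
  assumes "E\<^sup>*\<^sup>* x y" and "x \<in> S"
  shows "y \<in> S \<or> (\<exists>z\<in>S. \<exists>q. q \<noteq> [] \<and> last q = y \<and> distinct q \<and> set q \<inter> S = {} \<and> successively E (z # q))"
  using assms(1)
proof (induction rule: rtranclp_induct)
  case base
  then show ?case using assms(2) by simp
next
  case (step y y')
  show ?case
  proof (cases "y' \<in> S")
    case False
    consider "y \<in> S" | z q where "z \<in> S" "q \<noteq> []" "last q = y" "distinct q" "set q \<inter> S = {}"
        "successively E (z # q)"
      using step.IH by blast
    then show ?thesis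
    proof cases
      case 1
      then have "[y'] \<noteq> [] \<and> last [y'] = y' \<and> distinct [y'] \<and> set [y'] \<inter> S = {} \<and> successively E (y # [y'])"
        using False step.hyps by simp
      then show ?thesis using 1 by blast
    next
      case 2
      show ?thesis
      proof (cases "y' \<in> set q")
        case True
        then obtain q1 q2 where q: "q = q1 @ y' # q2"
          by (meson split_list)
        have "successively E ((z # q1 @ [y']) @ q2)"
          using 2 q by simp
        then have "successively E (z # q1 @ [y'])"
          by (simp only: successively_append_iff)
        then have "q1 @ [y'] \<noteq> [] \<and> last (q1 @ [y']) = y' \<and> distinct (q1 @ [y'])
            \<and> set (q1 @ [y']) \<inter> S = {} \<and> successively E (z # q1 @ [y'])"
          using 2 q by auto
        then show ?thesis using 2(1) by blast
      next
        case False': False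
        have "successively E ((z # q) @ [y'])"
          using 2 step.hyps by (simp only: successively_append_iff) simp
        then have "q @ [y'] \<noteq> [] \<and> last (q @ [y']) = y' \<and> distinct (q @ [y'])
            \<and> set (q @ [y']) \<inter> S = {} \<and> successively E (z # q @ [y'])"
          using 2 False False' by auto
        then show ?thesis using 2(1) by blast
      qed
    qed
  qed simp
qed

text \<open>
  A list \<open>ps\<close> encodes a tree with vertices \<open>0, \<dots>, length ps\<close> in which \<open>ps ! i\<close> is the parent of
  vertex \<open>Suc i\<close>; \<open>xs ! j\<close> is the image of vertex \<open>j\<close>.
\<close>

definition tree_embedding :: "('a \<Rightarrow> 'a \<Rightarrow> bool) \<Rightarrow> nat list \<Rightarrow> 'a list \<Rightarrow> bool" where
  "tree_embedding E ps xs \<longleftrightarrow> length xs = Suc (length ps) \<and> distinct xs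
     \<and> (\<forall>i<length ps. E (xs ! (ps ! i)) (xs ! Suc i))"

definition tree_degree :: "nat list \<Rightarrow> nat \<Rightarrow> nat" where
  "tree_degree ps j = count_list ps j + (if j = 0 then 0 else 1)"

text \<open>A tree obtained from its root by attaching at most \<open>p\<close> paths, one after the other.\<close>

inductive path_tree :: "nat \<Rightarrow> nat list \<Rightarrow> bool" where
  path_tree_root: "path_tree 0 []"
| path_tree_keep: "path_tree p ps \<Longrightarrow> path_tree (Suc p) ps"
| path_tree_attach: "path_tree p ps \<Longrightarrow> a \<le> length ps \<Longrightarrow>
    path_tree (Suc p) (ps @ a # [Suc (length ps)..<Suc (length ps) + l])"

text \<open>Parents precede their children in the numbering: an attached path hangs off an old
  vertex, and each of its later vertices off the one just before. This ordering is the only property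
  of the trees that the estimate for a fixed tree uses.\<close>

lemma path_tree_parent: "path_tree p ps \<Longrightarrow> i < length ps \<Longrightarrow> ps ! i \<le> i"
proof (induction arbitrary: i rule: path_tree.induct)
  case (path_tree_attach p ps a l)
  show ?case
  proof (cases "i < length ps")
    case False
    then obtain k where k: "i = length ps + k"
      using le_Suc_ex not_less by blast
    have "k < Suc l" using path_tree_attach.prems k by (simp del: upt_Suc)
    then show ?thesis using k path_tree_attach.hyps
      by (cases k) (auto simp: nth_append nth_Cons simp del: upt_Suc)
  qed (use path_tree_attach in \<open>simp add: nth_append\<close>)
qed auto

lemma count_list_upt: "count_list [a..<b] j = (if a \<le> j \<and> j < b then 1 else 0)"
  by (induction b) auto

lemma path_tree_0: "path_tree 0 ps \<longleftrightarrow> ps = []"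
  by (auto intro: path_tree_root elim: path_tree.cases)

lemma count_list_beyond_tree:
  assumes "path_tree p ps" and "length ps < j"
  shows "count_list ps j = 0"
proof -
  have "j \<notin> set ps"
    using path_tree_parent[OF assms(1)] assms(2) by (fastforce simp: in_set_conv_nth)
  then show ?thesis by (simp add: count_list_0_iff)
qed

text \<open>Attaching a path raises the degree of one old vertex by one, and its new vertices have
  degree at most 2. So each path adds at most 1 to the total excess over 2, and the first one adds
  nothing because the bare root has degree 0.\<close>

lemma path_tree_degree_excess: "path_tree p ps \<Longrightarrow> (\<Sum>j\<le>length ps. tree_degree ps j - 2) \<le> p - 1"
proof (induction rule: path_tree.induct)
  case (path_tree_attach p ps a l)
  define L where "L = length ps"
  define ps' where "ps' = ps @ a # [Suc L..<Suc L + l]"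
  have len: "length ps' = Suc L + l" by (simp add: ps'_def L_def del: upt_Suc)
  have beyond: "tree_degree ps' j - 2 = 0" if "L < j" for j
    using that path_tree_attach.hyps count_list_beyond_tree[OF path_tree_attach.hyps(1), of j]
    by (auto simp: tree_degree_def ps'_def L_def count_list_upt simp del: upt_Suc)
  have old: "tree_degree ps' j = tree_degree ps j + (if j = a then 1 else 0)" if "j \<le> L" for j
    using that by (auto simp: tree_degree_def ps'_def count_list_upt simp del: upt_Suc)
  have "(\<Sum>j\<le>length ps'. tree_degree ps' j - 2) = (\<Sum>j\<le>L. tree_degree ps' j - 2)"
    unfolding len using beyond by (intro sum.mono_neutral_right) auto
  also have "\<dots> \<le> p"
  proof (cases p)
    case 0
    then have "ps = []" using path_tree_attach.hyps path_tree_0 by simp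
    then show ?thesis using old[of 0] path_tree_attach.hyps by (simp add: L_def tree_degree_def)
  next
    case (Suc p')
    have "(\<Sum>j\<le>L. tree_degree ps' j - 2) \<le> (\<Sum>j\<le>L. (tree_degree ps j - 2) + (if j = a then 1 else 0))"
      by (intro sum_mono) (auto simp: old)
    also have "\<dots> = (\<Sum>j\<le>L. tree_degree ps j - 2) + 1"
      using path_tree_attach.hyps by (simp add: sum.distrib L_def)
    finally show ?thesis using path_tree_attach.IH Suc by (simp add: L_def)
  qed
  finally show ?case by (simp add: ps'_def L_def del: upt_Suc)
qed (auto simp: tree_degree_def)

text \<open>The last step either keeps the tree or attaches a path with \<open>l < L\<close> at some
  \<open>a \<le> L\<close>, which leaves \<open>1 + L * (L + 1) \<le> (L + 1) ^ 2\<close> choices.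
  For fixed \<open>p\<close> the number of shapes is thus polynomial in \<open>L\<close>, and a
  geometric factor beats it.\<close>

lemma card_path_tree:
  "finite {ps. path_tree p ps \<and> length ps = L} \<and>
   card {ps. path_tree p ps \<and> length ps = L} \<le> (Suc L) ^ (2 * p)"
proof (induction p arbitrary: L)
  case 0
  have "{ps. path_tree 0 ps \<and> length ps = L} = (if L = 0 then {[]} else {})"
    by (auto simp: path_tree_0)
  then show ?case by simp
next
  case (Suc p)
  let ?S = "\<lambda>p L. {ps. path_tree p ps \<and> length ps = L}"
  \<comment> \<open>\<open>None\<close> stands for \<open>path_tree_keep\<close>, and
    \<open>Some (l, a)\<close> for a path with \<open>l + 1\<close> new vertices attached at
    \<open>a\<close>.\<close>
  let ?I = "insert None (Some ` (SIGMA l:{..<L}. {..L}))"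
  let ?T = "\<lambda>x. case x of None \<Rightarrow> ?S p L
    | Some (l, a) \<Rightarrow> (\<lambda>ps. ps @ a # [Suc (length ps)..<Suc (length ps) + l]) ` ?S p (L - Suc l)"
  have sub: "?S (Suc p) L \<subseteq> (\<Union>x\<in>?I. ?T x)"
  proof
    fix ps assume "ps \<in> ?S (Suc p) L"
    then have "path_tree (Suc p) ps" and L: "length ps = L" by auto
    then show "ps \<in> (\<Union>x\<in>?I. ?T x)"
    proof (cases rule: path_tree.cases)
      case path_tree_keep
      then show ?thesis using L by auto
    next
      case (path_tree_attach ps' a l)
      have "(l, a) \<in> (SIGMA l:{..<L}. {..L})" "length ps' = L - Suc l"
        using L path_tree_attach by auto
      then have "Some (l, a) \<in> ?I" "ps \<in> ?T (Some (l, a))"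
        using path_tree_attach by (auto simp del: upt_Suc)
      then show ?thesis by (rule UN_I)
    qed
  qed
  have card_le: "finite (?T x) \<and> card (?T x) \<le> Suc L ^ (2 * p)" if "x \<in> ?I" for x
  proof (cases x)
    case (Some la)
    obtain l a where la: "la = (l, a)" by force
    have "card (?S p (L - Suc l)) \<le> Suc (L - Suc l) ^ (2 * p)" using Suc.IH by blast
    also have "\<dots> \<le> Suc L ^ (2 * p)" by (intro power_mono) auto
    finally show ?thesis using Suc.IH[of "L - Suc l"] Some la
      by (auto intro: order.trans[OF card_image_le])
  qed (use Suc.IH in auto)
  have fin: "finite ?I" by auto
  have cI: "card ?I \<le> (Suc L) ^ 2"
  proof -
    have "card ?I = Suc (card (Some ` (SIGMA l:{..<L}. {..L})))"
      by (subst card_insert_disjoint) auto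
    also have "\<dots> = Suc (L * Suc L)"
      by (subst card_image) auto
    finally show ?thesis by (simp add: power2_eq_square)
  qed
  have "card (?S (Suc p) L) \<le> card (\<Union>x\<in>?I. ?T x)"
    using card_le fin by (intro card_mono sub) blast
  also have "\<dots> \<le> (\<Sum>x\<in>?I. card (?T x))" by (rule card_UN_le[OF fin])
  also have "\<dots> \<le> card ?I * Suc L ^ (2 * p)"
    using card_le by (intro sum_bounded_above[of _ _ "Suc L ^ (2 * p)", simplified]) auto
  also have "\<dots> \<le> (Suc L) ^ 2 * Suc L ^ (2 * p)" using cI by (rule mult_le_mono1)
  also have "\<dots> = Suc L ^ (2 * Suc p)" by (simp flip: power_add)
  finally have "card (?S (Suc p) L) \<le> Suc L ^ (2 * Suc p)" .
  moreover have "finite (?S (Suc p) L)"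
    using card_le fin by (intro finite_subset[OF sub]) blast
  ultimately show ?case by blast
qed

text \<open>A vertex outside the tree is reached by a path that leaves the tree once. Its vertices
  are numbered after the old ones, so the old part of the embedding stays as it is.\<close>

lemma path_tree_extend:
  assumes "path_tree p ps" and emb: "tree_embedding E ps xs" and "E\<^sup>*\<^sup>* x y" and "x \<in> set xs"
  obtains ps' xs' where "path_tree (Suc p) ps'" "tree_embedding E ps' xs'"
    "set xs \<subseteq> set xs'" "y \<in> set xs'" "xs' ! 0 = xs ! 0"
proof (cases "y \<in> set xs")
  case True
  then show ?thesis using that[of ps xs] assms path_tree_keep by blast
next
  case False
  then obtain z q where z: "z \<in> set xs" and q: "q \<noteq> []" "last q = y" "distinct q"
    "set q \<inter> set xs = {}" "successively E (z # q)"
    using path_avoiding[OF assms(3,4)] by blast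
  obtain a where a: "a < length xs" "xs ! a = z"
    using z by (auto simp: in_set_conv_nth)
  define L where "L = length ps"
  have len: "length xs = Suc L" using emb by (simp add: tree_embedding_def L_def)
  obtain l where l: "length q = Suc l" using q(1) by (cases q) auto
  define ps' where "ps' = ps @ a # [Suc L..<Suc L + l]"
  have "path_tree (Suc p) ps'"
    unfolding ps'_def L_def using assms(1) a len by (intro path_tree_attach) (auto simp: L_def)
  moreover have "tree_embedding E ps' (xs @ q)"
    unfolding tree_embedding_def
  proof (intro conjI allI impI)
    show "length (xs @ q) = Suc (length ps')" by (simp add: ps'_def len l L_def del: upt_Suc)
    show "distinct (xs @ q)" using q emb by (auto simp: tree_embedding_def)
    fix i assume i: "i < length ps'"
    have eL: "E ((xs @ q) ! (ps' ! i)) ((xs @ q) ! Suc i)" if "i < L"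
    proof -
      have "E (xs ! (ps ! i)) (xs ! Suc i)" using emb that by (simp add: tree_embedding_def L_def)
      moreover have "ps ! i \<le> i" using path_tree_parent[OF assms(1)] that by (simp add: L_def)
      ultimately show ?thesis using that len by (simp add: ps'_def nth_append L_def)
    qed
    have eR: "E ((xs @ q) ! (ps' ! i)) ((xs @ q) ! Suc i)" if "L \<le> i"
    proof -
      \<comment> \<open>Edge \<open>k\<close> of the new path: for \<open>k = 0\<close> it starts at
        \<open>z\<close>, found at position \<open>a\<close>; otherwise it starts at the preceding
        vertex of \<open>q\<close>.\<close>
      obtain k where k: "i = L + k" using \<open>L \<le> i\<close> le_Suc_ex by blast
      have "k < Suc l" using i k by (simp add: ps'_def L_def del: upt_Suc)
      have E: "E ((z # q) ! k) (q ! k)"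
        using q(5) \<open>k < Suc l\<close> l by (auto simp: successively_conv_nth)
      show ?thesis
      proof (cases k)
        case 0
        then show ?thesis using E a k len by (simp add: ps'_def nth_append L_def)
      next
        case (Suc k')
        have "ps' ! i = Suc L + k'"
          using Suc k \<open>k < Suc l\<close> by (simp add: ps'_def nth_append L_def del: upt_Suc)
        then show ?thesis using E k Suc len by (simp add: nth_append)
      qed
    qed
    show "E ((xs @ q) ! (ps' ! i)) ((xs @ q) ! Suc i)" using eL eR by linarith
  qed
  moreover have "y \<in> set (xs @ q)" using q last_in_set by fastforce
  moreover have "(xs @ q) ! 0 = xs ! 0" using len by (simp add: nth_append)
  ultimately show ?thesis using that by auto
qed

lemma path_tree_covers:
  assumes "\<And>y. y \<in> set ys \<Longrightarrow> E\<^sup>*\<^sup>* x y"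
  shows "\<exists>ps xs. path_tree (length ys) ps \<and> tree_embedding E ps xs \<and> xs ! 0 = x \<and> set ys \<subseteq> set xs"
  using assms
proof (induction ys)
  case Nil
  have "path_tree 0 []" "tree_embedding E [] [x]" "[x] ! 0 = x"
    by (auto simp: tree_embedding_def intro: path_tree_root)
  then show ?case by (metis list.size(3) empty_set empty_subsetI)
next
  case (Cons y ys)
  then obtain ps xs where *: "path_tree (length ys) ps" "tree_embedding E ps xs" "xs ! 0 = x"
    "set ys \<subseteq> set xs" by auto
  have x: "x \<in> set xs" using * by (metis nth_mem tree_embedding_def zero_less_Suc)
  obtain ps' xs' where "path_tree (Suc (length ys)) ps'" "tree_embedding E ps' xs'"
    "set xs \<subseteq> set xs'" "y \<in> set xs'" "xs' ! 0 = xs ! 0"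
    using path_tree_extend[OF *(1,2) Cons.prems[of y] x] by auto
  then show ?case using * by (intro exI[of _ ps'] exI[of _ xs']) auto
qed

lemma tree_embedding_reach:
  assumes "tree_embedding E ps xs" and "\<And>i. i < length ps \<Longrightarrow> ps ! i \<le> i" and "j \<le> length ps"
  shows "E\<^sup>*\<^sup>* (xs ! 0) (xs ! j)"
  using assms(3)
proof (induction j rule: less_induct)
  case (less j)
  show ?case
  proof (cases j)
    case (Suc i)
    then have "E\<^sup>*\<^sup>* (xs ! 0) (xs ! (ps ! i))" "E (xs ! (ps ! i)) (xs ! Suc i)"
      using less assms(1) assms(2)[of i] by (auto simp: tree_embedding_def)
    then show ?thesis using Suc by simp
  qed simp
qed

text \<open>\<open>[0..<l]\<close> encodes the path with \<open>l\<close> edges: the parent of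
  \<open>Suc i\<close> is \<open>i\<close>.\<close>

lemma path_embedding:
  assumes "E\<^sup>*\<^sup>* x y"
  shows "\<exists>l xs. tree_embedding E [0..<l] xs \<and> xs ! 0 = x \<and> xs ! l = y"
proof (cases "y = x")
  case True
  then show ?thesis
    by (intro exI[of _ 0] exI[of _ "[x]"]) (auto simp: tree_embedding_def)
next
  case False
  then obtain q where q: "q \<noteq> []" "last q = y" "distinct q" "set q \<inter> {x} = {}" "successively E (x # q)"
    using path_avoiding[OF assms, of "{x}"] by blast
  have "tree_embedding E [0..<length q] (x # q)"
    using q by (auto simp: tree_embedding_def successively_conv_nth)
  moreover have "(x # q) ! length q = y" using q by (simp add: last_conv_nth)
  ultimately show ?thesis by (metis nth_Cons_0)
qed

section \<open>Pareto distributions\<close>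

definition pareto :: "real \<Rightarrow> real measure" where
  "pareto a = density lborel (\<lambda>x. ennreal (a * x powr (- a - 1)) * indicator {1..} x)"

lemma sets_pareto [simp, measurable_cong]: "sets (pareto a) = sets borel"
  by (simp add: pareto_def)

lemma space_pareto [simp]: "space (pareto a) = UNIV"
  by (simp add: pareto_def)

lemma DERIV_powr_antiderivative:
  fixes x c b :: real
  assumes "0 < x" "c \<noteq> 0"
  shows "((\<lambda>x. b / c * x powr c) has_real_derivative b * x powr (c - 1)) (at x)"
  using assms by (auto intro!: derivative_eq_intros simp: field_simps)

lemma nn_integral_powr_atLeast:
  fixes u c b :: real
  assumes "0 < u" "c < 0" "0 \<le> b"
  shows "(\<integral>\<^sup>+x. ennreal (b * x powr (c - 1)) * indicator {u..} x \<partial>lborel) = ennreal (b / - c * u powr c)"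
proof -
  have "(\<integral>\<^sup>+x. ennreal (b * x powr (c - 1)) * indicator {u..} x \<partial>lborel) = ennreal (0 - b / c * u powr c)"
  proof (rule nn_integral_FTC_atLeast)
    fix x assume "u \<le> x"
    then have "0 < x" using assms by simp
    then show "((\<lambda>x. b / c * x powr c) has_real_derivative b * x powr (c - 1)) (at x)"
      using assms by (intro DERIV_powr_antiderivative) auto
    show "0 \<le> b * x powr (c - 1)" using assms by simp
  next
    have "((\<lambda>x. x powr c) \<longlongrightarrow> 0) at_top"
      using assms by (intro tendsto_neg_powr) (auto intro: filterlim_ident)
    then show "((\<lambda>x. b / c * x powr c) \<longlongrightarrow> 0) at_top"
      by (rule tendsto_mult_right_zero)
  qed simp
  then show ?thesis by simp
qed

lemma nn_integral_pareto:
  assumes [measurable]: "f \<in> borel_measurable borel"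
  shows "nn_integral (pareto a) f
    = (\<integral>\<^sup>+x. ennreal (a * x powr (- a - 1)) * indicator {1..} x * f x \<partial>lborel)"
  unfolding pareto_def by (subst nn_integral_density) auto

lemma pareto_upper_moment:
  assumes "1 \<le> u" "s < a" "0 < a"
  shows "(\<integral>\<^sup>+x. ennreal (x powr s) * indicator {u<..} x \<partial>pareto a) = ennreal (a / (a - s) * u powr (s - a))"
proof -
  have "(\<integral>\<^sup>+x. ennreal (x powr s) * indicator {u<..} x \<partial>pareto a)
      = (\<integral>\<^sup>+x. ennreal (a * x powr (- a - 1)) * indicator {1..} x * (ennreal (x powr s) * indicator {u<..} x) \<partial>lborel)"
    by (rule nn_integral_pareto) simp
  also have "\<dots> = (\<integral>\<^sup>+x. ennreal (a * x powr ((s - a) - 1)) * indicator {u..} x \<partial>lborel)"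
  proof (rule nn_integral_cong_AE)
    show "AE x in lborel. ennreal (a * x powr (- a - 1)) * indicator {1..} x * (ennreal (x powr s) * indicator {u<..} x)
      = ennreal (a * x powr ((s - a) - 1)) * indicator {u..} x"
      using AE_lborel_singleton[of u]
    proof (rule AE_mp, intro AE_I2 impI)
      fix x assume "x \<noteq> u"
      then show "ennreal (a * x powr (- a - 1)) * indicator {1..} x * (ennreal (x powr s) * indicator {u<..} x)
        = ennreal (a * x powr ((s - a) - 1)) * indicator {u..} x"
        using assms by (auto simp: indicator_def ennreal_mult[symmetric] powr_add[symmetric] algebra_simps)
    qed
  qed
  also have "\<dots> = ennreal (a / - (s - a) * u powr (s - a))"
    using assms by (intro nn_integral_powr_atLeast) auto
  finally show ?thesis by simp
qed

lemma pareto_lower_moment: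
  assumes "1 \<le> u" "a < s" "0 < a"
  shows "(\<integral>\<^sup>+x. ennreal (x powr s) * indicator {..u} x \<partial>pareto a) \<le> ennreal (a / (s - a) * u powr (s - a))"
proof -
  have "(\<integral>\<^sup>+x. ennreal (x powr s) * indicator {..u} x \<partial>pareto a)
      = (\<integral>\<^sup>+x. ennreal (a * x powr (- a - 1)) * indicator {1..} x * (ennreal (x powr s) * indicator {..u} x) \<partial>lborel)"
    by (rule nn_integral_pareto) simp
  also have "\<dots> = (\<integral>\<^sup>+x. ennreal (a * x powr ((s - a) - 1)) * indicator {1..u} x \<partial>lborel)"
    using assms by (intro nn_integral_cong)
      (auto simp: indicator_def ennreal_mult[symmetric] powr_add[symmetric] algebra_simps)
  also have "\<dots> = ennreal (a / (s - a) * u powr (s - a) - a / (s - a) * 1 powr (s - a))"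
  proof (rule nn_integral_FTC_Icc)
    fix x assume "x \<in> {1..u}"
    then have x: "0 < x" by simp
    have "((\<lambda>x. a / (s - a) * x powr (s - a)) has_real_derivative a * x powr (s - a - 1)) (at x)"
      using assms x by (intro DERIV_powr_antiderivative) auto
    then show "DERIV (\<lambda>x. a / (s - a) * x powr (s - a)) x :> a * x powr (s - a - 1)" .
    show "0 \<le> a * x powr (s - a - 1)" using assms by simp
  qed (use assms in auto)
  also have "\<dots> \<le> ennreal (a / (s - a) * u powr (s - a))"
    using assms by (intro ennreal_leI) auto
  finally show ?thesis .
qed

lemma emeasure_pareto:
  assumes "0 < a"
  shows "emeasure (pareto a) {x<..} = ennreal (if x \<le> 1 then 1 else x powr - a)"
proof -
  have *: "emeasure (pareto a) {u<..} = ennreal (u powr - a)" if "1 \<le> u" for u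
  proof -
    have "emeasure (pareto a) {u<..} = (\<integral>\<^sup>+x. indicator {u<..} x \<partial>pareto a)" by simp
    also have "\<dots> = (\<integral>\<^sup>+x. ennreal (x powr 0) * indicator {u<..} x \<partial>pareto a)"
      using that by (intro nn_integral_cong) (auto simp: indicator_def)
    finally show ?thesis using pareto_upper_moment[OF that, of 0 a] assms by simp
  qed
  show ?thesis
  proof (cases "x \<le> 1")
    case True
    have "emeasure (pareto a) {x<..} \<le> 1"
    proof -
      have "emeasure (pareto a) {x<..} \<le> emeasure (pareto a) UNIV" by (intro emeasure_mono) auto
      also have "\<dots> = (\<integral>\<^sup>+x. ennreal (a * x powr (- a - 1)) * indicator {1..} x \<partial>lborel)"
        using nn_integral_pareto[of "\<lambda>_. 1" a] by simp
      also have "\<dots> = 1" using nn_integral_powr_atLeast[of 1 "-a" a] assms by simp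
      finally show ?thesis .
    qed
    moreover have "emeasure (pareto a) {1<..} \<le> emeasure (pareto a) {x<..}"
      using True by (intro emeasure_mono) auto
    ultimately show ?thesis using *[of 1] True by simp
  qed (use * in simp)
qed

lemma prob_space_pareto:
  assumes "0 < a"
  shows "prob_space (pareto a)"
proof
  show "emeasure (pareto a) (space (pareto a)) = 1"
    using nn_integral_pareto[of "\<lambda>_. 1" a] nn_integral_powr_atLeast[of 1 "-a" a] assms by simp
qed

lemma (in prob_space) distr_pareto:
  fixes Z :: "'a \<Rightarrow> real"
  assumes [measurable]: "random_variable borel Z" and "0 < a"
    and tail: "\<And>r. 0 < r \<Longrightarrow> prob {\<omega> \<in> space M. r < Z \<omega>} = min 1 (r powr - a)"
  shows "distr M borel Z = pareto a"
proof (rule measure_eqI_lessThan)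
  interpret D: prob_space "distr M borel Z" by (rule prob_space_distr) simp
  fix x :: real
  show "emeasure (distr M borel Z) {x<..} < \<infinity>"
    by (simp add: D.emeasure_finite less_top[symmetric])
  have "prob {\<omega> \<in> space M. x < Z \<omega>} = (if x \<le> 1 then 1 else x powr - a)"
  proof (cases "x \<le> 1")
    case True
    \<comment> \<open>\<open>tail\<close> covers positive \<open>r\<close> only; its value 1 at
      \<open>r = 1\<close> settles every \<open>x \<le> 1\<close> by monotonicity.\<close>
    have "prob {\<omega> \<in> space M. 1 < Z \<omega>} \<le> prob {\<omega> \<in> space M. x < Z \<omega>}"
      using True by (intro finite_measure_mono) auto
    then show ?thesis using True tail[of 1] by (simp add: measure_ge_1_iff)
  next
    case False
    then have "x powr - a \<le> 1" using assms(2) powr_mono[of "- a" 0 x] by simp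
    then show ?thesis using False tail[of x] by simp
  qed
  moreover have "emeasure (distr M borel Z) {x<..} = emeasure M {\<omega> \<in> space M. x < Z \<omega>}"
    by (subst emeasure_distr) (auto intro!: arg_cong[where f = "emeasure M"])
  ultimately show "emeasure (distr M borel Z) {x<..} = emeasure (pareto a) {x<..}"
    using assms(2) by (simp add: emeasure_pareto emeasure_eq_measure)
qed auto

section \<open>Grid cells\<close>

text \<open>Rounding down gives half-open cells: every point lies in exactly one of them, and
  distinct cells are disjoint, as the independence of counts requires.\<close>

definition grid :: "real \<Rightarrow> real ^ 'n \<Rightarrow> int ^ 'n" where
  "grid h x = (\<chi> i. \<lfloor>x $ i / h\<rfloor>)"

lemma grid_eq_iff:
  assumes "0 < h"
  shows "grid h x = k \<longleftrightarrow> (\<forall>i. of_int (k $ i) * h \<le> x $ i \<and> x $ i < (of_int (k $ i) + 1) * h)"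
proof -
  have "\<lfloor>x $ i / h\<rfloor> = k $ i \<longleftrightarrow> of_int (k $ i) * h \<le> x $ i \<and> x $ i < (of_int (k $ i) + 1) * h" for i
    unfolding floor_eq_iff pos_le_divide_eq[OF assms] pos_divide_less_eq[OF assms] ..
  then show ?thesis by (simp only: grid_def vec_eq_iff vec_lambda_beta)
qed

lemma grid_0 [simp]: "grid h 0 = 0"
  by (simp add: grid_def vec_eq_iff)

lemma measurable_grid [measurable]: "(grid h :: real ^ 'n \<Rightarrow> int ^ 'n) \<in> borel \<rightarrow>\<^sub>M count_space UNIV"
proof (subst measurable_count_space_eq_countable)
  show "countable (UNIV :: (int ^ 'n) set)" by simp
  have [measurable]: "(\<lambda>x :: real ^ 'n. x $ i) \<in> borel_measurable borel" for i
    by (intro borel_measurable_continuous_onI continuous_intros)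
  have eq: "grid h -` {k} \<inter> space borel = (\<Inter>i. {x \<in> space borel. \<lfloor>x $ i / h\<rfloor> = k $ i})" for k :: "int ^ 'n"
    by (auto simp: grid_def vec_eq_iff)
  have "grid h -` {k} \<inter> space borel \<in> sets borel" for k :: "int ^ 'n"
    unfolding eq by (intro sets.finite_INT) auto
  then show "grid h \<in> space borel \<rightarrow> UNIV \<and> (\<forall>a\<in>(UNIV :: (int ^ 'n) set). grid h -` {a} \<inter> space borel \<in> sets borel)"
    by simp
qed

lemma borel_grid_cell [measurable]: "{x. grid h x = k} \<in> sets borel"
  using measurable_sets[OF measurable_grid[of h], of "{k}"] by (simp add: vimage_def)

lemma grid_cell_box:
  fixes k :: "int ^ 'n"
  assumes "0 < h"
  shows "box (\<chi> i. of_int (k $ i) * h) (\<chi> i. (of_int (k $ i) + 1) * h) \<subseteq> {x. grid h x = k}"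
    and "{x. grid h x = k} \<subseteq> cbox (\<chi> i. of_int (k $ i) * h) (\<chi> i. (of_int (k $ i) + 1) * h)"
  unfolding grid_eq_iff[OF assms] by (auto simp only: subset_eq mem_box_cart vec_lambda_beta mem_Collect_eq intro: less_imp_le)

lemma bounded_grid_cell: "0 < h \<Longrightarrow> bounded {x. grid h x = k}"
  by (rule bounded_subset[OF bounded_cbox grid_cell_box(2)])

lemma emeasure_grid_cell:
  fixes k :: "int ^ 'n"
  assumes "0 < h"
  shows "emeasure lborel {x. grid h x = k} = ennreal (h ^ CARD('n))"
proof (rule antisym)
  let ?l = "\<chi> i. of_int (k $ i) * h" and ?u = "\<chi> i. (of_int (k $ i) + 1) * h"
  have b: "?l \<bullet> b \<le> ?u \<bullet> b" "(?u - ?l) \<bullet> b = h" if bB: "b \<in> Basis" for b :: "real ^ 'n"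
  proof -
    obtain i where i: "b = axis i 1" using bB by (auto simp: Basis_vec_def)
    show "?l \<bullet> b \<le> ?u \<bullet> b" "(?u - ?l) \<bullet> b = h"
      using assms by (simp_all add: i inner_axis distrib_right)
  qed
  have p: "(\<Prod>b\<in>Basis. (?u - ?l) \<bullet> (b :: real ^ 'n)) = h ^ CARD('n)"
    using b(2) by simp
  have "emeasure lborel (cbox ?l ?u) = ennreal (h ^ CARD('n))"
    using b(1) p by (subst emeasure_lborel_cbox) auto
  moreover have "emeasure lborel {x. grid h x = k} \<le> emeasure lborel (cbox ?l ?u)"
    using grid_cell_box(2)[OF assms] by (intro emeasure_mono) auto
  ultimately show "emeasure lborel {x. grid h x = k} \<le> ennreal (h ^ CARD('n))" by simp
  have "emeasure lborel (box ?l ?u) = ennreal (h ^ CARD('n))"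
    using b(1) p by (subst emeasure_lborel_box) auto
  moreover have "emeasure lborel (box ?l ?u) \<le> emeasure lborel {x. grid h x = k}"
    using grid_cell_box(1)[OF assms] by (intro emeasure_mono) auto
  ultimately show "ennreal (h ^ CARD('n)) \<le> emeasure lborel {x. grid h x = k}" by simp
qed

lemma measure_grid_cell:
  fixes k :: "int ^ 'n"
  assumes "0 < h"
  shows "measure lborel {x. grid h x = k} = h ^ CARD('n)"
  using emeasure_grid_cell[OF assms, of k] assms by (simp add: measure_def)

text \<open>The 1 absorbs the rounding: floors differ by at most 1 more than the numbers do. In this
  way a bound on a distance becomes a condition on cells alone.\<close>

definition near :: "real \<Rightarrow> int ^ 'n \<Rightarrow> int ^ 'n \<Rightarrow> bool" where
  "near \<rho> k k' \<longleftrightarrow> (\<forall>i. \<bar>real_of_int (k $ i - k' $ i)\<bar> \<le> \<rho> + 1)"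

lemma near_grid:
  assumes "0 < h" "norm (x - y) \<le> h * \<rho>"
  shows "near \<rho> (grid h x) (grid h y)"
  unfolding near_def
proof
  fix i
  have "\<bar>x $ i - y $ i\<bar> \<le> h * \<rho>"
    using component_le_norm_cart[of "x - y" i] assms by simp
  then have "\<bar>x $ i / h - y $ i / h\<bar> \<le> \<rho>"
    using assms(1) by (simp add: diff_divide_distrib[symmetric] pos_divide_le_eq mult.commute)
  then show "\<bar>real_of_int (grid h x $ i - grid h y $ i)\<bar> \<le> \<rho> + 1"
    unfolding grid_def by simp linarith
qed

lemma card_near:
  fixes k :: "int ^ 'n"
  assumes "1 \<le> \<rho>"
  shows "finite {k'. near \<rho> k k'}" "real (card {k'. near \<rho> k k'}) \<le> (5 * \<rho>) ^ CARD('n)"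
proof -
  let ?A = "\<lambda>i. {k $ i - \<lfloor>\<rho> + 1\<rfloor> .. k $ i + \<lfloor>\<rho> + 1\<rfloor>}"
  have sub: "{k'. near \<rho> k k'} \<subseteq> vec_lambda ` (\<Pi>\<^sub>E i\<in>UNIV. ?A i)"
  proof
    fix k' assume "k' \<in> {k'. near \<rho> k k'}"
    then have "\<bar>real_of_int (k $ i - k' $ i)\<bar> \<le> \<rho> + 1" for i by (simp add: near_def)
    then have "real_of_int (k $ i - k' $ i) \<le> \<rho> + 1" "real_of_int (k' $ i - k $ i) \<le> \<rho> + 1" for i
      by (simp_all add: abs_le_iff)
    then have "k $ i - k' $ i \<le> \<lfloor>\<rho> + 1\<rfloor>" "k' $ i - k $ i \<le> \<lfloor>\<rho> + 1\<rfloor>" for i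
      by (simp_all only: le_floor_iff)
    then have "k' $ i \<in> ?A i" for i
      by (smt (verit) atLeastAtMost_iff)
    then have "vec_nth k' \<in> (\<Pi>\<^sub>E i\<in>UNIV. ?A i)" by auto
    then show "k' \<in> vec_lambda ` (\<Pi>\<^sub>E i\<in>UNIV. ?A i)"
      by (intro image_eqI[of _ _ "vec_nth k'"]) (simp add: vec_nth_inverse)
  qed
  have fin: "finite (\<Pi>\<^sub>E i\<in>UNIV. ?A i)" by (intro finite_PiE) auto
  show "finite {k'. near \<rho> k k'}" using fin by (intro finite_subset[OF sub]) auto
  \<comment> \<open>Each coordinate takes at most \<open>2 * \<rho> + 3\<close> integer values, and
    \<open>1 \<le> \<rho>\<close> turns this into \<open>5 * \<rho>\<close>; all later powers of 5
    come from here.\<close>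
  have c: "real (card (?A i)) \<le> 5 * \<rho>" for i
  proof -
    have "0 \<le> \<lfloor>\<rho> + 1\<rfloor>" using assms by simp
    then have "real (card (?A i)) = 2 * \<lfloor>\<rho> + 1\<rfloor> + 1" by simp
    then show ?thesis using assms by linarith
  qed
  have "card {k'. near \<rho> k k'} \<le> card (\<Pi>\<^sub>E i\<in>UNIV. ?A i)"
    using fin sub by (meson card_image_le card_mono finite_imageI order.trans)
  also have "\<dots> = (\<Prod>i\<in>UNIV. card (?A i))" by (rule card_PiE) simp
  finally have "real (card {k'. near \<rho> k k'}) \<le> (\<Prod>i\<in>UNIV. real (card (?A i)))"
    by (simp only: of_nat_prod[symmetric] of_nat_le_iff)
  also have "\<dots> \<le> (\<Prod>i\<in>(UNIV :: 'n set). 5 * \<rho>)" by (intro prod_mono conjI c) auto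
  finally show "real (card {k'. near \<rho> k k'}) \<le> (5 * \<rho>) ^ CARD('n)" by simp
qed

text \<open>The cells are chosen in the order of the numbering, each near the cell of its parent,
  which is already fixed; the root is the origin, in cell \<open>0\<close>. The bound for one choice
  does not depend on the earlier cells, so the bounds multiply.\<close>

lemma card_near_lists:
  fixes \<rho> :: "nat \<Rightarrow> real"
  assumes ps: "\<And>i. i < length ps \<Longrightarrow> ps ! i \<le> i" and \<rho>: "\<And>i. i < length ps \<Longrightarrow> 1 \<le> \<rho> i"
    and "L \<le> length ps"
  defines "S \<equiv> \<lambda>L. {ks :: (int ^ 'n) list. length ks = L \<and> (\<forall>i<L. near (\<rho> i) ((0 # ks) ! (ps ! i)) (ks ! i))}"
  shows "finite (S L) \<and> real (card (S L)) \<le> (\<Prod>i<L. (5 * \<rho> i) ^ CARD('n))"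
  using assms(3)
proof (induction L)
  case 0
  have "S 0 = {[]}" by (auto simp: S_def)
  then show ?case by simp
next
  case (Suc L)
  let ?N = "\<lambda>ks. {k. near (\<rho> L) ((0 # ks) ! (ps ! L)) k}"
  have sub: "S (Suc L) \<subseteq> (\<lambda>(ks, k). ks @ [k]) ` (SIGMA ks:S L. ?N ks)"
  proof
    fix ks' assume ks': "ks' \<in> S (Suc L)"
    then obtain ks k where k: "ks' = ks @ [k]" "length ks = L"
      by (auto simp: S_def length_Suc_conv_rev)
    have old: "(0 # ks') ! j = (0 # ks) ! j" if "j \<le> L" for j
      using that k by (cases j) (auto simp: nth_append)
    have "near (\<rho> i) ((0 # ks) ! (ps ! i)) (ks ! i)" if "i < L" for i
    proof -
      have "near (\<rho> i) ((0 # ks') ! (ps ! i)) (ks' ! i)" using ks' that by (simp add: S_def)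
      then show ?thesis using old[of "ps ! i"] ps[of i] that k Suc.prems by (simp add: nth_append)
    qed
    moreover have "near (\<rho> L) ((0 # ks) ! (ps ! L)) k"
    proof -
      have "near (\<rho> L) ((0 # ks') ! (ps ! L)) (ks' ! L)" using ks' by (simp add: S_def)
      then show ?thesis using old[of "ps ! L"] ps[of L] k Suc.prems by (simp add: nth_append)
    qed
    ultimately have "ks \<in> S L" "k \<in> ?N ks" using k by (auto simp: S_def)
    then show "ks' \<in> (\<lambda>(ks, k). ks @ [k]) ` (SIGMA ks:S L. ?N ks)" using k by force
  qed
  have IH: "finite (S L)" "real (card (S L)) \<le> (\<Prod>i<L. (5 * \<rho> i) ^ CARD('n))"
    using Suc by auto
  have \<rho>L: "1 \<le> \<rho> L" using \<rho> Suc.prems by simp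
  have fin: "finite (SIGMA ks:S L. ?N ks)" using IH card_near(1)[OF \<rho>L] by auto
  have "card (S (Suc L)) \<le> card (SIGMA ks:S L. ?N ks)"
    using fin sub by (meson card_image_le card_mono finite_imageI order.trans)
  also have "\<dots> = (\<Sum>ks\<in>S L. card (?N ks))"
    using IH(1) card_near(1)[OF \<rho>L] by (intro card_SigmaI) auto
  finally have "real (card (S (Suc L))) \<le> (\<Sum>ks\<in>S L. real (card (?N ks)))"
    by (simp only: of_nat_sum[symmetric] of_nat_le_iff)
  also have "\<dots> \<le> (\<Sum>ks\<in>S L. (5 * \<rho> L) ^ CARD('n))"
    by (intro sum_mono card_near(2)[OF \<rho>L])
  also have "\<dots> = real (card (S L)) * (5 * \<rho> L) ^ CARD('n)" by simp
  also have "\<dots> \<le> (\<Prod>i<L. (5 * \<rho> i) ^ CARD('n)) * (5 * \<rho> L) ^ CARD('n)"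
    using IH(2) \<rho>L by (intro mult_right_mono) auto
  finally show ?case using finite_subset[OF sub] fin by simp
qed

section \<open>Factorial moments of Poisson counts\<close>

text \<open>The falling factorial, that is, the number of \<open>m\<close>-tuples of distinct
  elements of an \<open>n\<close>-set. Truncated subtraction makes it vanish for
  \<open>n < m\<close>.\<close>

definition falling :: "nat \<Rightarrow> nat \<Rightarrow> nat" where
  "falling n m = (\<Prod>i<m. n - i)"

lemma falling_0 [simp]: "falling n 0 = 1"
  by (simp add: falling_def)

lemma falling_Suc: "falling n (Suc m) = falling n m * (n - m)"
  by (simp add: falling_def)

lemma falling_fact: "falling (n + m) m * fact n = fact (n + m)"
proof (induction m)
  case (Suc m)
  have "falling (n + Suc m) (Suc m) = (n + Suc m) * falling (n + m) m"
    unfolding falling_def by (subst prod.lessThan_Suc_shift) simp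
  then show ?case using Suc by (simp add: algebra_simps)
qed simp

lemma falling_eq_0: "n < m \<Longrightarrow> falling n m = 0"
  by (auto simp: falling_def prod_zero_iff)

text \<open>The falling factorial cancels the leading factors of \<open>fact k\<close>; what is left
  is the exponential series shifted by \<open>m\<close>, and the terms with \<open>k < m\<close>
  vanish.\<close>

lemma poisson_factorial_moment:
  fixes l :: real
  shows "(\<lambda>k. real (falling k m) * (l ^ k / fact k * exp (- l))) sums l ^ m"
proof -
  let ?f = "\<lambda>k. real (falling k m) * (l ^ k / fact k * exp (- l))"
  have "(\<lambda>k. l ^ m * exp (- l) * (l ^ k /\<^sub>R fact k)) sums (l ^ m * exp (- l) * exp l)"
    by (intro sums_mult exp_converges)
  also have "(\<lambda>k. l ^ m * exp (- l) * (l ^ k /\<^sub>R fact k)) = (\<lambda>k. ?f (k + m))"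
  proof
    fix k
    have "real (falling (k + m) m) * fact k = (fact (k + m) :: real)"
      by (metis falling_fact of_nat_fact of_nat_mult)
    then have "real (falling (k + m) m) = fact (k + m) / (fact k :: real)"
      by (simp add: field_simps)
    then show "l ^ m * exp (- l) * (l ^ k /\<^sub>R fact k) = ?f (k + m)"
      by (simp add: field_simps power_add)
  qed
  finally have "(\<lambda>k. ?f (k + m)) sums (l ^ m)" by (simp add: mult.assoc flip: exp_add)
  moreover have "(\<Sum>k<m. ?f k) = 0" by (intro sum.neutral) (auto simp: falling_eq_0)
  ultimately show ?thesis using sums_iff_shift[of ?f m "l ^ m"] by simp
qed

text \<open>The indices are chosen entry by entry: at a new entry \<open>c\<close>, exactly
  \<open>count_list ks c\<close> of the indices in cell \<open>c\<close> are taken. The fixed set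
  \<open>A\<close> keeps the range of the product constant during the induction.\<close>

lemma card_distinct_preimages:
  fixes f :: "nat \<Rightarrow> 'a"
  assumes "finite A" "set ks \<subseteq> A" and fin: "\<And>c. c \<in> A \<Longrightarrow> finite {i. f i = c}"
  shows "finite {js. distinct js \<and> map f js = ks} \<and>
    card {js. distinct js \<and> map f js = ks} \<le> (\<Prod>c\<in>A. falling (card {i. f i = c}) (count_list ks c))"
  using assms(2)
proof (induction ks)
  case Nil
  have "{js. distinct js \<and> map f js = []} = {[]}" by auto
  then show ?case by simp
next
  case (Cons c ks)
  let ?T = "\<lambda>ks. {js. distinct js \<and> map f js = ks}"
  have IH: "finite (?T ks)" "card (?T ks) \<le> (\<Prod>c\<in>A. falling (card {i. f i = c}) (count_list ks c))"
    and c: "c \<in> A" using Cons by auto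
  let ?B = "SIGMA js:?T ks. {i. f i = c} - set js"
  have sub: "?T (c # ks) \<subseteq> (\<lambda>(js, i). i # js) ` ?B"
  proof
    fix js' assume "js' \<in> ?T (c # ks)"
    then obtain i js where "js' = i # js" "distinct (i # js)" "f i = c" "map f js = ks"
      by (cases js') auto
    then show "js' \<in> (\<lambda>(js, i). i # js) ` ?B" by force
  qed
  have cardB: "card ({i. f i = c} - set js) = card {i. f i = c} - count_list ks c" if "js \<in> ?T ks" for js
  proof -
    have "{i. f i = c} \<inter> set js = set (filter (\<lambda>i. f i = c) js)" by auto
    moreover have "distinct (filter (\<lambda>i. f i = c) js)" using that by simp
    ultimately have "card ({i. f i = c} \<inter> set js) = length (filter (\<lambda>i. f i = c) js)"
      by (simp only: distinct_card)
    also have "\<dots> = count_list (map f js) c" by (induction js) auto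
    finally show ?thesis using that by (subst card_Diff_subset_Int) auto
  qed
  have fB: "finite ?B" using IH fin[OF c] by auto
  have "card (?T (c # ks)) \<le> card ?B"
    using fB sub by (meson card_image_le card_mono finite_imageI order.trans)
  also have "\<dots> = (\<Sum>js\<in>?T ks. card {i. f i = c} - count_list ks c)"
    using IH fin[OF c] cardB by (subst card_SigmaI) auto
  also have "\<dots> = card (?T ks) * (card {i. f i = c} - count_list ks c)" by simp
  also have "\<dots> \<le> (\<Prod>c\<in>A. falling (card {i. f i = c}) (count_list ks c)) * (card {i. f i = c} - count_list ks c)"
    using IH by (intro mult_right_mono) auto
  also have "\<dots> = (\<Prod>c'\<in>A. falling (card {i. f i = c'}) (count_list (c # ks) c'))"
  proof -
    have "(\<Prod>c'\<in>A - {c}. falling (card {i. f i = c'}) (count_list (c # ks) c'))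
      = (\<Prod>c'\<in>A - {c}. falling (card {i. f i = c'}) (count_list ks c'))"
      by (intro prod.cong) auto
    then show ?thesis
      using assms(1) c by (simp add: prod.remove[of A c] falling_Suc)
  qed
  finally show ?case using finite_subset[OF sub] fB by simp
qed

context poisson_process
begin

text \<open>Independence of a family with one member contains the measurability of that
  member.\<close>

lemma measurable_count [measurable]:
  assumes "A \<in> sets borel" "bounded A"
  shows "(\<lambda>\<omega>. card {i. X i \<omega> \<in> A}) \<in> M \<rightarrow>\<^sub>M count_space UNIV"
  using independent_counts[of "{0}" "\<lambda>_. A"] assms
  by (auto simp: indep_vars_def disjoint_family_on_def)

lemma nn_integral_count:
  fixes f :: "nat \<Rightarrow> ennreal"
  assumes A: "A \<in> sets borel" "bounded A"
  shows "(\<integral>\<^sup>+\<omega>. f (card {i. X i \<omega> \<in> A}) \<partial>M)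
    = (\<Sum>k. f k * ennreal (measure lborel A ^ k / fact k * exp (- measure lborel A)))"
proof -
  note [measurable] = measurable_count[OF A]
  let ?N = "\<lambda>\<omega>. card {i. X i \<omega> \<in> A}"
  have "(\<integral>\<^sup>+\<omega>. f (?N \<omega>) \<partial>M)
    = (\<integral>\<^sup>+\<omega>. (\<integral>\<^sup>+k. f k * indicator {\<omega> \<in> space M. ?N \<omega> = k} \<omega> \<partial>count_space UNIV) \<partial>M)"
  proof (rule nn_integral_cong)
    fix \<omega> assume "\<omega> \<in> space M"
    then show "f (?N \<omega>) = (\<integral>\<^sup>+k. f k * indicator {\<omega> \<in> space M. ?N \<omega> = k} \<omega> \<partial>count_space UNIV)"
      by (subst nn_integral_count_space'[where A = "{?N \<omega>}"]) auto
  qed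
  also have "\<dots> = (\<integral>\<^sup>+k. (\<integral>\<^sup>+\<omega>. f k * indicator {\<omega> \<in> space M. ?N \<omega> = k} \<omega> \<partial>M) \<partial>count_space UNIV)"
    by (intro nn_integral_count_space_nn_integral) auto
  also have "\<dots> = (\<integral>\<^sup>+k. f k * ennreal (measure lborel A ^ k / fact k * exp (- measure lborel A)) \<partial>count_space UNIV)"
    by (intro nn_integral_cong)
      (simp add: nn_integral_cmult_indicator emeasure_eq_measure poisson_counts[OF A])
  finally show ?thesis by (simp add: nn_integral_count_space_nat)
qed

lemma nn_integral_falling_count:
  assumes "A \<in> sets borel" "bounded A"
  shows "(\<integral>\<^sup>+\<omega>. ennreal (real (falling (card {i. X i \<omega> \<in> A}) m)) \<partial>M) = ennreal (measure lborel A ^ m)"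
proof -
  have "(\<Sum>k. ennreal (real (falling k m)) * ennreal (measure lborel A ^ k / fact k * exp (- measure lborel A)))
     = (\<Sum>k. ennreal (real (falling k m) * (measure lborel A ^ k / fact k * exp (- measure lborel A))))"
    by (intro suminf_cong) (simp add: ennreal_mult' del: times_divide_eq_right)
  also have "\<dots> = ennreal (measure lborel A ^ m)"
    by (intro suminf_ennreal_eq poisson_factorial_moment) auto
  finally show ?thesis by (subst nn_integral_count[OF assms])
qed

lemma nn_integral_prod_falling_count:
  fixes A :: "(int ^ 'n) set"
  assumes "finite A" and h: "0 < h"
  shows "(\<integral>\<^sup>+\<omega>. (\<Prod>c\<in>A. ennreal (real (falling (card {i. grid h (X i \<omega>) = c}) (m c)))) \<partial>M)
    = ennreal (\<Prod>c\<in>A. (h ^ CARD('n)) ^ m c)"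
proof -
  \<comment> \<open>Independence of counts is assumed for families indexed by natural numbers, hence
    the passage to positions in \<open>cs\<close>.\<close>
  obtain cs where cs: "set cs = A" "distinct cs" using finite_distinct_list[OF assms(1)] by blast
  let ?J = "{..<length cs}"
  let ?C = "\<lambda>c. {x. grid h x = c}"
  have bij: "bij_betw ((!) cs) ?J A" using cs by (auto intro: bij_betw_nth)
  have "indep_vars (\<lambda>_. count_space UNIV) (\<lambda>j \<omega>. card {i. X i \<omega> \<in> ?C (cs ! j)}) ?J"
    using bounded_grid_cell[OF h] cs(2)
    by (intro independent_counts) (auto simp: disjoint_family_on_def nth_eq_iff_index_eq)
  then have ind: "indep_vars (\<lambda>_. borel)
      (\<lambda>j \<omega>. ennreal (real (falling (card {i. X i \<omega> \<in> ?C (cs ! j)}) (m (cs ! j))))) ?J"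
    by (rule indep_vars_compose2) simp
  have "(\<integral>\<^sup>+\<omega>. (\<Prod>c\<in>A. ennreal (real (falling (card {i. grid h (X i \<omega>) = c}) (m c)))) \<partial>M)
    = (\<integral>\<^sup>+\<omega>. (\<Prod>j\<in>?J. ennreal (real (falling (card {i. X i \<omega> \<in> ?C (cs ! j)}) (m (cs ! j))))) \<partial>M)"
    by (subst prod.reindex_bij_betw[OF bij, symmetric]) simp
  also have "\<dots> = (\<Prod>j\<in>?J. \<integral>\<^sup>+\<omega>. ennreal (real (falling (card {i. X i \<omega> \<in> ?C (cs ! j)}) (m (cs ! j)))) \<partial>M)"
    by (intro indep_vars_nn_integral ind) auto
  also have "\<dots> = (\<Prod>j\<in>?J. ennreal ((h ^ CARD('n)) ^ m (cs ! j)))"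
    by (intro prod.cong refl)
      (subst nn_integral_falling_count, simp_all add: bounded_grid_cell[OF h] measure_grid_cell[OF h])
  also have "\<dots> = (\<Prod>c\<in>A. ennreal ((h ^ CARD('n)) ^ m c))"
    by (rule prod.reindex_bij_betw[OF bij])
  finally show ?thesis using h by (simp add: prod_ennreal)
qed

lemma AE_finite_grid_cells:
  assumes "0 < h"
  shows "AE \<omega> in M. \<forall>c. finite {i. grid h (X i \<omega>) = c}"
proof (subst AE_all_countable, rule allI)
  fix c
  show "AE \<omega> in M. finite {i. grid h (X i \<omega>) = c}"
    using locally_finite[of "{x. grid h x = c}"] bounded_grid_cell[OF assms, of c] by simp
qed

text \<open>An upper bound in place of the multivariate Mecke formula. Almost surely the number of
  tuples of distinct indices in the cells \<open>ks\<close> is at most a product of falling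
  factorials of independent Poisson counts, whose expectation is the product of the cell
  volumes.\<close>

lemma expected_tuples_in_cells:
  fixes ks :: "(int ^ 'n) list"
  assumes h: "0 < h"
  shows "(\<integral>\<^sup>+js. emeasure M {\<omega> \<in> space M. map (\<lambda>i. grid h (X i \<omega>)) js = ks} \<partial>count_space {js. distinct js})
    \<le> ennreal ((h ^ CARD('n)) ^ length ks)"
proof -
  note points_measurable [measurable]
  have [measurable]: "{\<omega> \<in> space M. map (\<lambda>i. grid h (X i \<omega>)) js = ks} \<in> sets M" for js
  proof -
    have "{\<omega> \<in> space M. map (\<lambda>i. grid h (X i \<omega>)) js = ks}
      = (if length js = length ks then {\<omega> \<in> space M. \<forall>j<length ks. grid h (X (js ! j) \<omega>) = ks ! j} else {})"
      by (auto simp: list_eq_iff_nth_eq)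
    then show ?thesis by simp
  qed
  have "(\<integral>\<^sup>+js. emeasure M {\<omega> \<in> space M. map (\<lambda>i. grid h (X i \<omega>)) js = ks} \<partial>count_space {js. distinct js})
    = (\<integral>\<^sup>+js. (\<integral>\<^sup>+\<omega>. indicator {\<omega> \<in> space M. map (\<lambda>i. grid h (X i \<omega>)) js = ks} \<omega> \<partial>M) \<partial>count_space {js. distinct js})"
    by simp
  also have "\<dots> = (\<integral>\<^sup>+\<omega>. (\<integral>\<^sup>+js. indicator {\<omega> \<in> space M. map (\<lambda>i. grid h (X i \<omega>)) js = ks} \<omega> \<partial>count_space {js. distinct js}) \<partial>M)"
    by (intro nn_integral_count_space_nn_integral[symmetric]) auto
  also have "\<dots> \<le> (\<integral>\<^sup>+\<omega>. (\<Prod>c\<in>set ks. ennreal (real (falling (card {i. grid h (X i \<omega>) = c}) (count_list ks c)))) \<partial>M)"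
  proof (rule nn_integral_mono_AE)
    \<comment> \<open>Finiteness of the cells matters here: \<open>card\<close> is 0 on an infinite
      set and would then bound nothing.\<close>
    show "AE \<omega> in M. (\<integral>\<^sup>+js. indicator {\<omega> \<in> space M. map (\<lambda>i. grid h (X i \<omega>)) js = ks} \<omega> \<partial>count_space {js. distinct js})
      \<le> (\<Prod>c\<in>set ks. ennreal (real (falling (card {i. grid h (X i \<omega>) = c}) (count_list ks c))))"
      using AE_finite_grid_cells[OF h]
    proof (rule AE_mp, intro AE_I2 impI)
      fix \<omega> assume "\<omega> \<in> space M" and fin: "\<forall>c. finite {i. grid h (X i \<omega>) = c}"
      let ?f = "\<lambda>i. grid h (X i \<omega>)"
      let ?T = "{js. distinct js \<and> map ?f js = ks}"
      have T: "finite ?T" "card ?T \<le> (\<Prod>c\<in>set ks. falling (card {i. ?f i = c}) (count_list ks c))"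
        using card_distinct_preimages[of "set ks" ks ?f] fin by auto
      have "(\<integral>\<^sup>+js. indicator {\<omega> \<in> space M. map (\<lambda>i. grid h (X i \<omega>)) js = ks} \<omega> \<partial>count_space {js. distinct js})
        = (\<integral>\<^sup>+js. indicator ?T js \<partial>count_space {js. distinct js})"
        using \<open>\<omega> \<in> space M\<close> by (intro nn_integral_cong) (auto simp: indicator_def)
      also have "\<dots> = of_nat (card ?T)"
        using T(1) by (subst nn_integral_indicator) (auto intro!: emeasure_count_space_finite)
      also have "\<dots> = ennreal (real (card ?T))" by (simp add: ennreal_of_nat_eq_real_of_nat)
      also have "\<dots> \<le> ennreal (real (\<Prod>c\<in>set ks. falling (card {i. ?f i = c}) (count_list ks c)))"
        using T(2) by (intro ennreal_leI) (simp only: of_nat_le_iff)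
      also have "\<dots> = (\<Prod>c\<in>set ks. ennreal (real (falling (card {i. ?f i = c}) (count_list ks c))))"
        by (simp add: prod_ennreal)
      finally show "(\<integral>\<^sup>+js. indicator {\<omega> \<in> space M. map (\<lambda>i. grid h (X i \<omega>)) js = ks} \<omega> \<partial>count_space {js. distinct js})
        \<le> (\<Prod>c\<in>set ks. ennreal (real (falling (card {i. grid h (X i \<omega>) = c}) (count_list ks c))))" .
    qed
  qed
  also have "\<dots> = ennreal (\<Prod>c\<in>set ks. (h ^ CARD('n)) ^ count_list ks c)"
    by (rule nn_integral_prod_falling_count[OF _ h]) simp
  also have "(\<Prod>c\<in>set ks. (h ^ CARD('n)) ^ count_list ks c) = (h ^ CARD('n)) ^ length ks"
    by (simp flip: power_sum add: sum_count_set)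
  finally show ?thesis .
qed

end

section \<open>Marks\<close>

lemma AE_pareto:
  assumes "0 < a"
  shows "AE x in pareto a. 1 < x"
proof -
  interpret prob_space "pareto a" by (rule prob_space_pareto[OF assms])
  have "prob {1<..} = 1" using emeasure_pareto[OF assms, of 1] by (simp add: emeasure_eq_measure)
  then show ?thesis using AE_in_set_eq_1[of "{1<..}"] by simp
qed

lemma pareto_upper_moment_power:
  assumes "1 \<le> u" "real k < a"
  shows "(\<integral>\<^sup>+x. ennreal (x ^ k) * indicator {u<..} x \<partial>pareto a) = ennreal (a / (a - real k) * u powr (real k - a))"
proof -
  have "(\<integral>\<^sup>+x. ennreal (x ^ k) * indicator {u<..} x \<partial>pareto a)
      = (\<integral>\<^sup>+x. ennreal (x powr real k) * indicator {u<..} x \<partial>pareto a)"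
    using assms by (intro nn_integral_cong) (auto simp: indicator_def powr_realpow)
  then show ?thesis using pareto_upper_moment[of u "real k" a] assms by simp
qed

lemma pareto_moment_power:
  assumes "real k < a"
  shows "(\<integral>\<^sup>+x. ennreal (x ^ k) \<partial>pareto a) = ennreal (a / (a - real k))"
proof -
  have a: "0 < a" using assms by linarith
  have "(\<integral>\<^sup>+x. ennreal (x ^ k) \<partial>pareto a) = (\<integral>\<^sup>+x. ennreal (x ^ k) * indicator {1<..} x \<partial>pareto a)"
    using AE_pareto[OF a] by (intro nn_integral_cong_AE) (auto elim!: AE_mp)
  then show ?thesis using pareto_upper_moment_power[of 1 k a] assms by simp
qed

lemma pareto_lower_moment_power:
  assumes "1 \<le> u" "0 < a" "a < real k"
  shows "(\<integral>\<^sup>+x. ennreal (x ^ k) * indicator {..u} x \<partial>pareto a) \<le> ennreal (a / (real k - a) * u powr (real k - a))"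
proof -
  have "(\<integral>\<^sup>+x. ennreal (x ^ k) * indicator {..u} x \<partial>pareto a)
      = (\<integral>\<^sup>+x. ennreal (x powr real k) * indicator {..u} x \<partial>pareto a)"
    using AE_pareto[OF assms(2)] by (intro nn_integral_cong_AE) (auto elim!: AE_mp simp: powr_realpow)
  then show ?thesis using pareto_lower_moment[of u a "real k"] assms by simp
qed

text \<open>A countable union bound. A non-measurable \<open>A\<close> has \<open>emeasure\<close>
  0, so it is covered as well.\<close>

lemma emeasure_le_nn_integral_cover:
  fixes B :: "'i :: countable \<Rightarrow> 'a set"
  assumes [measurable]: "\<And>i. B i \<in> sets M" and cover: "AE x in M. x \<in> A \<longrightarrow> (\<exists>i. x \<in> B i)"
  shows "emeasure M A \<le> (\<integral>\<^sup>+i. emeasure M (B i) \<partial>count_space UNIV)"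
proof (cases "A \<in> sets M")
  case True
  have "emeasure M A = (\<integral>\<^sup>+x. indicator A x \<partial>M)" using True by simp
  also have "\<dots> \<le> (\<integral>\<^sup>+x. (\<integral>\<^sup>+i. indicator (B i) x \<partial>count_space UNIV) \<partial>M)"
  proof (rule nn_integral_mono_AE, use cover in \<open>rule AE_mp\<close>, intro AE_I2 impI)
    fix x assume *: "x \<in> A \<longrightarrow> (\<exists>i. x \<in> B i)"
    show "indicator A x \<le> (\<integral>\<^sup>+i. indicator (B i) x \<partial>count_space UNIV :: ennreal)"
    proof (cases "x \<in> A")
      case True
      then obtain i where "x \<in> B i" using * by blast
      then have "(1 :: ennreal) = (\<integral>\<^sup>+j. indicator {i} j \<partial>count_space UNIV)" by simp
      also have "\<dots> \<le> (\<integral>\<^sup>+i. indicator (B i) x \<partial>count_space UNIV)"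
        using \<open>x \<in> B i\<close> by (intro nn_integral_mono) (auto simp: indicator_def)
      finally show ?thesis using True by simp
    qed simp
  qed
  also have "\<dots> = (\<integral>\<^sup>+i. (\<integral>\<^sup>+x. indicator (B i) x \<partial>M) \<partial>count_space UNIV)"
    by (intro nn_integral_count_space_nn_integral) auto
  finally show ?thesis by simp
qed (simp add: emeasure_notin_sets)

lemma sets_generator:
  "sets (sigma \<Omega> (\<Union>k\<in>I. {Z k -` B \<inter> \<Omega> | B. B \<in> sets borel}))
    = sigma_sets \<Omega> (\<Union>k\<in>I. {Z k -` B \<inter> \<Omega> | B. B \<in> sets borel})"
  for Z :: "'k \<Rightarrow> 'a \<Rightarrow> 'c :: topological_space"
  by (intro sets_measure_of) auto

text \<open>Independence of points and marks is stated for generated sigma-algebras. Viewed as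
  measurable spaces, they allow membership of an event to be shown by measurability of the variables
  that define it.\<close>

lemma measurable_generator:
  fixes Z :: "'k \<Rightarrow> 'a \<Rightarrow> 'c :: topological_space"
  assumes "k \<in> I"
  shows "Z k \<in> sigma \<Omega> (\<Union>k\<in>I. {Z k -` B \<inter> \<Omega> | B. B \<in> sets borel}) \<rightarrow>\<^sub>M borel"
proof (rule measurableI)
  fix B :: "'c set" assume "B \<in> sets borel"
  then have "Z k -` B \<inter> \<Omega> \<in> (\<Union>k\<in>I. {Z k -` B \<inter> \<Omega> | B. B \<in> sets borel})"
    using assms by blast
  then show "Z k -` B \<inter> space (sigma \<Omega> (\<Union>k\<in>I. {Z k -` B \<inter> \<Omega> | B. B \<in> sets borel}))
      \<in> sets (sigma \<Omega> (\<Union>k\<in>I. {Z k -` B \<inter> \<Omega> | B. B \<in> sets borel}))"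
    unfolding sets_generator space_measure_of_conv by (rule sigma_sets.Basic)
qed simp

lemma measurable_near [measurable]:
  fixes k k' :: "int ^ 'n"
  assumes [measurable]: "f \<in> borel_measurable M"
  shows "Measurable.pred M (\<lambda>x. near (f x) k k')"
proof -
  have "near \<rho> k k' \<longleftrightarrow> (\<forall>i\<in>UNIV. \<bar>real_of_int (k $ i - k' $ i)\<bar> \<le> \<rho> + 1)" for \<rho>
    by (simp add: near_def)
  then show ?thesis by simp
qed

lemma doubleton_in_pairs: "u \<noteq> v \<Longrightarrow> {u, v} \<in> pairs"
  by (simp add: pairs_def)

lemma countable_pairs: "countable pairs"
proof (rule countable_subset)
  show "pairs \<subseteq> {A. finite A}" by (auto simp: pairs_def intro: card_ge_0_finite)
qed (rule countable_Collect_finite)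

lemma prod_nth_count_list:
  fixes r :: "'b \<Rightarrow> 'a :: comm_monoid_mult"
  assumes "finite A" "set ps \<subseteq> A"
  shows "(\<Prod>i<length ps. r (ps ! i)) = (\<Prod>j\<in>A. r j ^ count_list ps j)"
  using assms(2)
proof (induction ps rule: rev_induct)
  case (snoc p ps)
  have "(\<Prod>i<length (ps @ [p]). r ((ps @ [p]) ! i)) = (\<Prod>i<length ps. r (ps ! i)) * r p"
    by (simp add: nth_append)
  also have "\<dots> = (\<Prod>j\<in>A. r j ^ count_list ps j) * (\<Prod>j\<in>A. if j = p then r j else 1)"
    using snoc assms(1) by simp
  also have "\<dots> = (\<Prod>j\<in>A. r j ^ count_list (ps @ [p]) j)"
    by (subst prod.distrib[symmetric]) (intro prod.cong, auto simp: mult.commute)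
  finally show ?case .
qed simp

text \<open>Handshake argument: every edge gives one factor to each of its ends, so a vertex
  collects as many factors as its degree.\<close>

lemma prod_tree_degree:
  fixes r :: "nat \<Rightarrow> 'a :: comm_monoid_mult"
  assumes "\<And>i. i < length ps \<Longrightarrow> ps ! i \<le> i"
  shows "(\<Prod>i<length ps. r (ps ! i) * r (Suc i)) = (\<Prod>j\<le>length ps. r j ^ tree_degree ps j)"
proof -
  have "set ps \<subseteq> {..length ps}"
    using assms by (fastforce simp: in_set_conv_nth)
  then have 1: "(\<Prod>i<length ps. r (ps ! i)) = (\<Prod>j\<le>length ps. r j ^ count_list ps j)"
    by (intro prod_nth_count_list) auto
  have 2: "(\<Prod>i<length ps. r (Suc i)) = (\<Prod>j\<le>length ps. r j ^ (if j = 0 then 0 else 1))"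
    by (subst prod.atMost_shift) simp
  show ?thesis
    unfolding tree_degree_def power_add prod.distrib 1 2 ..
qed

section \<open>Measurability and marginal laws of the radii and weights\<close>

context soft_boolean_model
begin

lemma measurable_mark: "k \<in> UNIV <+> pairs \<Longrightarrow> random_variable borel (case_sum R W k)"
  using marks_independent by (auto simp: indep_vars_def)

lemma measurable_radius [measurable]: "random_variable borel (R v)"
  using measurable_mark[of "Inl v"] by auto

lemma measurable_weight: "e \<in> pairs \<Longrightarrow> random_variable borel (W e)"
  using measurable_mark[of "Inr e"] by auto

lemma measurable_location [measurable]: "random_variable borel (\<lambda>\<omega>. location X \<omega> v)"
  using points_measurable by (cases v) auto

lemma measurable_edge [measurable]: "Measurable.pred M (\<lambda>\<omega>. edge \<beta> X R W \<omega> u v)"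
\<comment> \<open>A singleton \<open>{u, u}\<close> is not in \<open>pairs\<close>, so nothing is
  known about its weight; but there is no loop at \<open>u\<close> either.\<close>
proof (cases "u = v")
  case False
  have "(\<lambda>\<omega>. norm (location X \<omega> u - location X \<omega> v)) \<in> borel_measurable M"
    by (intro measurable_compose[OF _ borel_measurable_norm] borel_measurable_diff measurable_location)
  moreover have "(\<lambda>\<omega>. \<beta> powr (1 / real CARD('n)) * W {u, v} \<omega> * max (R u \<omega>) (R v \<omega>)) \<in> borel_measurable M"
    by (intro borel_measurable_times borel_measurable_max borel_measurable_const measurable_radius
      measurable_weight[OF doubleton_in_pairs[OF False]])
  ultimately have "{\<omega> \<in> space M. norm (location X \<omega> u - location X \<omega> v)
      \<le> \<beta> powr (1 / real CARD('n)) * W {u, v} \<omega> * max (R u \<omega>) (R v \<omega>)} \<in> sets M"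
    by (rule borel_measurable_le)
  then show ?thesis by (simp only: edge_def pred_def False not_False_eq_True simp_thms)
qed (simp add: edge_def)

lemma distr_radius: "0 < \<gamma> \<Longrightarrow> distr M borel (R v) = pareto (real CARD('n) / \<gamma>)"
  by (intro distr_pareto radius_tail) auto

lemma distr_weight: "1 < \<delta> \<Longrightarrow> e \<in> pairs \<Longrightarrow> distr M borel (W e) = pareto (real CARD('n) * \<delta>)"
  by (intro distr_pareto weight_tail measurable_weight) auto

lemma AE_radius_gt_1: "AE \<omega> in M. \<forall>v. 1 < R v \<omega>"
proof (subst AE_all_countable, rule allI)
  fix v
  have "prob {\<omega> \<in> space M. 1 < R v \<omega>} = 1" using radius_tail[of 1 v] by simp
  then show "AE \<omega> in M. 1 < R v \<omega>" by (subst (asm) prob_Collect_eq_1) auto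
qed

lemma AE_weight_gt_1: "AE \<omega> in M. \<forall>e\<in>pairs. 1 < W e \<omega>"
proof (subst AE_ball_countable[OF countable_pairs], rule ballI)
  fix e assume e: "e \<in> pairs"
  note [measurable] = measurable_weight[OF e]
  have "prob {\<omega> \<in> space M. 1 < W e \<omega>} = 1" using weight_tail[OF e, of 1] by simp
  then show "AE \<omega> in M. 1 < W e \<omega>" by (subst (asm) prob_Collect_eq_1) auto
qed

end

lemma (in prob_space) indep_vars_reindex:
  assumes inj: "inj_on f I" and ind: "indep_vars M' X (f ` I)"
  shows "indep_vars (\<lambda>i. M' (f i)) (\<lambda>i. X (f i)) I"
  unfolding indep_vars_def2 indep_sets_def
proof (intro conjI ballI allI impI)
  fix i assume "i \<in> I"
  then show *: "random_variable (M' (f i)) (X (f i))" using ind by (auto simp: indep_vars_def2)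
  show "{X (f i) -` A \<inter> space M | A. A \<in> sets (M' (f i))} \<subseteq> events"
    using measurable_sets[OF *] by auto
next
  fix J A assume J: "J \<subseteq> I" "J \<noteq> {}" "finite J"
    and A: "A \<in> (\<Pi> i\<in>J. {X (f i) -` A \<inter> space M | A. A \<in> sets (M' (f i))})"
  have injJ: "inj_on f J" using inj J(1) by (rule inj_on_subset)
  define A' where "A' = (\<lambda>x. A (the_inv_into J f x))"
  have A': "A' (f j) = A j" if "j \<in> J" for j
    using the_inv_into_f_f[OF injJ that] by (simp add: A'_def)
  have "A' \<in> (\<Pi> x\<in>f ` J. {X x -` A \<inter> space M | A. A \<in> sets (M' x)})"
    using A A' by (auto simp: Pi_iff)
  then have "prob (\<Inter>x\<in>f ` J. A' x) = (\<Prod>x\<in>f ` J. prob (A' x))"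
    using ind J unfolding indep_vars_def2 by (intro indep_setsD) auto
  then show "prob (\<Inter> (A ` J)) = (\<Prod>j\<in>J. prob (A j))"
    using A' by (simp add: prod.reindex[OF injJ])
qed

text \<open>
  The vertices \<open>0 # map Suc js\<close> of an embedded tree are the origin and the Poisson points with
  indices \<open>js\<close>. Its marks are indexed by \<open>Inl j\<close> for the radius of vertex \<open>j\<close> and by \<open>Inr i\<close> for
  the weight of the edge between \<open>Suc i\<close> and its parent.
\<close>

definition mark_labels :: "nat list \<Rightarrow> nat list \<Rightarrow> nat + nat \<Rightarrow> nat + nat set" where
  "mark_labels ps js = map_sum (\<lambda>j. (0 # map Suc js) ! j)
     (\<lambda>i. {(0 # map Suc js) ! (ps ! i), (0 # map Suc js) ! Suc i})"

definition mark_index :: "nat list \<Rightarrow> (nat + nat) set" where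
  "mark_index ps = {..length ps} <+> {..<length ps}"

lemma finite_mark_index [simp]: "finite (mark_index ps)"
  by (simp add: mark_index_def)

lemma mark_index_simps [simp]:
  "Inl j \<in> mark_index ps \<longleftrightarrow> j \<le> length ps"
  "Inr i \<in> mark_index ps \<longleftrightarrow> i < length ps"
  by (auto simp: mark_index_def)

lemma
  assumes ps: "\<And>i. i < length ps \<Longrightarrow> ps ! i \<le> i" and js: "distinct js" "length js = length ps"
  shows mark_labels_in: "k \<in> mark_index ps \<Longrightarrow> mark_labels ps js k \<in> UNIV <+> pairs"
    and inj_on_mark_labels: "inj_on (mark_labels ps js) (mark_index ps)"
proof -
  let ?t = "0 # map Suc js"
  have dist: "distinct ?t" using js by (simp add: distinct_map)
  have len: "length ?t = Suc (length ps)" using js by simp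
  have eq: "?t ! i = ?t ! j \<longleftrightarrow> i = j" if "i \<le> length ps" "j \<le> length ps" for i j
    using nth_eq_iff_index_eq[OF dist, of i j] that len by simp
  have le: "ps ! i \<le> length ps" if "i < length ps" for i using ps[OF that] that by simp
  show "mark_labels ps js k \<in> UNIV <+> pairs" if "k \<in> mark_index ps" for k
  proof (cases k)
    case (Inr i)
    then have i: "i < length ps" using that by simp
    then have "?t ! (ps ! i) \<noteq> ?t ! Suc i" using eq[OF le[OF i], of "Suc i"] ps[OF i] by simp
    then show ?thesis using Inr doubleton_in_pairs by (auto simp: mark_labels_def simp del: nth_Cons_Suc)
  qed (auto simp: mark_labels_def)
  show "inj_on (mark_labels ps js) (mark_index ps)"
  proof (rule inj_onI)
    fix k k' assume k: "k \<in> mark_index ps" "k' \<in> mark_index ps"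
      and e: "mark_labels ps js k = mark_labels ps js k'"
    show "k = k'"
    proof (cases k)
      case (Inl j)
      then obtain j' where "k' = Inl j'" using e by (cases k') (auto simp: mark_labels_def)
      then show ?thesis using Inl k e eq by (simp add: mark_labels_def)
    next
      case (Inr i)
      then obtain i' where k': "k' = Inr i'" using e by (cases k') (auto simp: mark_labels_def)
      have i: "i < length ps" "i' < length ps" using Inr k' k by auto
      have "{?t ! (ps ! i), ?t ! Suc i} = {?t ! (ps ! i'), ?t ! Suc i'}"
        using e Inr k' by (simp add: mark_labels_def del: nth_Cons_Suc)
      then consider "?t ! Suc i = ?t ! Suc i'" | "?t ! Suc i = ?t ! (ps ! i')" "?t ! (ps ! i) = ?t ! Suc i'"
        by (auto simp only: doubleton_eq_iff)
      then show ?thesis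
      proof cases
        case 1
        then show ?thesis using eq[of "Suc i" "Suc i'"] i Inr k' by simp
      next
        \<comment> \<open>With crossed ends, \<open>Suc i = ps ! i' \<le> i'\<close> and
          \<open>Suc i' = ps ! i \<le> i\<close> contradict each other.\<close>
        case 2
        then have "Suc i = ps ! i'" "ps ! i = Suc i'"
          using eq[OF _ le, of "Suc i" i'] eq[OF le, of i "Suc i'"] i by simp_all
        then show ?thesis using ps[of i] ps[of i'] i by simp
      qed
    qed
  qed
qed

text \<open>What an embedding with cells \<open>ks\<close> demands of the marks alone.
  \<open>ks\<close> lists the cells of the Poisson vertices only, and the cell \<open>0\<close> of
  the origin is put in front. The product of the two radii stands for their maximum, so that the
  later count factorises over the vertices.\<close>

definition mark_event :: "nat list \<Rightarrow> (nat \<Rightarrow> real set) \<Rightarrow> (int ^ 'n) list \<Rightarrow> (nat + nat \<Rightarrow> real) set" where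
  "mark_event ps G ks = {z \<in> space (Pi\<^sub>M (mark_index ps) (\<lambda>_. borel)). length ks = length ps
     \<and> (\<forall>k\<in>mark_index ps. 1 < z k)
     \<and> (\<forall>i\<in>{..<length ps}. near (z (Inr i) * (z (Inl (ps ! i)) * z (Inl (Suc i)))) ((0 # ks) ! (ps ! i)) (ks ! i))
     \<and> (\<forall>j\<in>{..length ps}. z (Inl j) \<in> G j)}"

definition mark_law :: "real \<Rightarrow> real \<Rightarrow> nat + nat \<Rightarrow> real measure" where
  "mark_law a b = case_sum (\<lambda>_. pareto a) (\<lambda>_. pareto b)"

lemma sets_mark_event:
  assumes ps: "\<And>i. i < length ps \<Longrightarrow> ps ! i \<le> i" and G: "\<And>j. G j \<in> sets borel"
  shows "mark_event ps G ks \<in> sets (Pi\<^sub>M (mark_index ps) (\<lambda>_. borel))"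
proof -
  have c: "(\<lambda>z. z k) \<in> borel_measurable (Pi\<^sub>M (mark_index ps) (\<lambda>_. borel))" if "k \<in> mark_index ps" for k
    using that by (rule measurable_component_singleton)
  have le: "ps ! i \<le> length ps" if "i < length ps" for i using ps[OF that] that by simp
  have "Measurable.pred (Pi\<^sub>M (mark_index ps) (\<lambda>_. borel)) (\<lambda>z. z (Inl j) \<in> G j)" if "j \<le> length ps" for j
    using G by (intro pred_sets2[of _ borel] c) (auto simp: that)
  moreover have "Measurable.pred (Pi\<^sub>M (mark_index ps) (\<lambda>_. borel))
      (\<lambda>z. near (z (Inr i) * (z (Inl (ps ! i)) * z (Inl (Suc i)))) ((0 # ks) ! (ps ! i)) (ks ! i))"
    if "i < length ps" for i
    using that le[OF that] by (intro measurable_near borel_measurable_times c) auto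
  moreover have "Measurable.pred (Pi\<^sub>M (mark_index ps) (\<lambda>_. borel)) (\<lambda>z. 1 < (z k :: real))" if "k \<in> mark_index ps" for k
    unfolding pred_def by (intro borel_measurable_less borel_measurable_const c[OF that])
  ultimately have "Measurable.pred (Pi\<^sub>M (mark_index ps) (\<lambda>_. borel)) (\<lambda>z. length ks = length ps
     \<and> (\<forall>k\<in>mark_index ps. 1 < z k)
     \<and> (\<forall>i\<in>{..<length ps}. near (z (Inr i) * (z (Inl (ps ! i)) * z (Inl (Suc i)))) ((0 # ks) ! (ps ! i)) (ks ! i))
     \<and> (\<forall>j\<in>{..length ps}. z (Inl j) \<in> G j))"
    by (intro pred_intros_logic pred_intros_finite) auto
  then show ?thesis by (simp only: mark_event_def pred_def)
qed

text \<open>For fixed marks the left side counts the admissible cell lists. Each edge allows at most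
  \<open>(5 * \<rho>) ^ d\<close> cells, where \<open>\<rho>\<close> is its weight times both radii;
  regrouping by vertices raises each radius to \<open>d\<close> times its degree.\<close>

lemma nn_integral_count_mark_event:
  fixes z :: "nat + nat \<Rightarrow> real"
  assumes ps: "\<And>i. i < length ps \<Longrightarrow> ps ! i \<le> i"
  shows "(\<integral>\<^sup>+ks. indicator (mark_event ps G ks :: (nat + nat \<Rightarrow> real) set) z \<partial>count_space (UNIV :: (int ^ 'n) list set))
    \<le> (\<Prod>k\<in>mark_index ps. (case k of
        Inl j \<Rightarrow> ennreal (z k ^ (CARD('n) * tree_degree ps j)) * indicator (G j) (z k)
      | Inr i \<Rightarrow> ennreal (5 ^ CARD('n)) * ennreal (z k ^ CARD('n))))"
    (is "?lhs \<le> ?rhs")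
proof (cases "z \<in> space (Pi\<^sub>M (mark_index ps) (\<lambda>_. borel)) \<and> (\<forall>k\<in>mark_index ps. 1 < z k) \<and> (\<forall>j\<le>length ps. z (Inl j) \<in> G j)")
  case False
  then have "indicator (mark_event ps G ks) z = (0 :: ennreal)" for ks :: "(int ^ 'n) list"
    by (auto simp: mark_event_def indicator_def)
  then show ?thesis by simp
next
  case True
  define d where "d = CARD('n)"
  define \<rho> where "\<rho> i = z (Inr i) * (z (Inl (ps ! i)) * z (Inl (Suc i)))" for i
  define S where "S = {ks :: (int ^ 'n) list. length ks = length ps \<and>
    (\<forall>i<length ps. near (\<rho> i) ((0 # ks) ! (ps ! i)) (ks ! i))}"
  have zl: "1 < z (Inl j)" if "j \<le> length ps" for j using that True by simp
  have zr: "1 < z (Inr i)" if "i < length ps" for i using that True by simp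
  have zl0: "0 \<le> z (Inl j)" if "j \<le> length ps" for j using zl[OF that] by simp
  have zr0: "0 \<le> z (Inr i)" if "i < length ps" for i using zr[OF that] by simp
  have le: "ps ! i \<le> length ps" if "i < length ps" for i using ps[OF that] that by simp
  have \<rho>: "1 \<le> \<rho> i" if "i < length ps" for i
  proof -
    have "1 \<le> z (Inl (ps ! i)) * z (Inl (Suc i))"
      using zl[OF le[OF that]] zl[of "Suc i"] that mult_mono[of 1 "z (Inl (ps ! i))" 1 "z (Inl (Suc i))"] by simp
    then show ?thesis
      unfolding \<rho>_def using zr[OF that] mult_mono[of 1 "z (Inr i)" 1 "z (Inl (ps ! i)) * z (Inl (Suc i))"] by simp
  qed
  have S: "finite S" "real (card S) \<le> (\<Prod>i<length ps. (5 * \<rho> i) ^ d)"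
    using card_near_lists[of ps \<rho> "length ps", OF ps \<rho>] unfolding S_def d_def by auto
  have "?lhs = (\<integral>\<^sup>+ks. indicator S ks \<partial>count_space UNIV)"
    using True by (intro nn_integral_cong) (auto simp: mark_event_def indicator_def S_def \<rho>_def)
  also have "\<dots> = ennreal (real (card S))"
    using S(1) by (simp add: ennreal_of_nat_eq_real_of_nat)
  also have "\<dots> \<le> ennreal (\<Prod>i<length ps. (5 * \<rho> i) ^ d)"
    using S(2) by (rule ennreal_leI)
  also have "(\<Prod>i<length ps. (5 * \<rho> i) ^ d)
      = (\<Prod>j\<le>length ps. z (Inl j) ^ (d * tree_degree ps j)) * (\<Prod>i<length ps. 5 ^ d * z (Inr i) ^ d)"
  proof -
    have "(\<Prod>i<length ps. (5 * \<rho> i) ^ d)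
        = (\<Prod>i<length ps. z (Inl (ps ! i)) ^ d * z (Inl (Suc i)) ^ d) * (\<Prod>i<length ps. 5 ^ d * z (Inr i) ^ d)"
      unfolding prod.distrib[symmetric] \<rho>_def by (intro prod.cong) (auto simp: power_mult_distrib)
    then show ?thesis
      using prod_tree_degree[OF ps, of "\<lambda>j. z (Inl j) ^ d"] by (simp add: power_mult)
  qed
  also have "ennreal \<dots> = ennreal (\<Prod>j\<le>length ps. z (Inl j) ^ (d * tree_degree ps j))
      * ennreal (\<Prod>i<length ps. 5 ^ d * z (Inr i) ^ d)"
  proof (rule ennreal_mult)
    show "0 \<le> (\<Prod>j\<le>length ps. z (Inl j) ^ (d * tree_degree ps j))"
      using zl0 by (intro prod_nonneg) auto
    show "0 \<le> (\<Prod>i<length ps. 5 ^ d * z (Inr i) ^ d)"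
      using zr0 by (intro prod_nonneg) auto
  qed
  also have "ennreal (\<Prod>j\<le>length ps. z (Inl j) ^ (d * tree_degree ps j))
      = (\<Prod>j\<le>length ps. ennreal (z (Inl j) ^ (d * tree_degree ps j)) * indicator (G j) (z (Inl j)))"
    using zl0 True by (subst prod_ennreal[symmetric]) (auto intro!: prod.cong)
  also have "ennreal (\<Prod>i<length ps. 5 ^ d * z (Inr i) ^ d)
      = (\<Prod>i<length ps. ennreal (5 ^ d) * ennreal (z (Inr i) ^ d))"
    using zr0 by (subst prod_ennreal[symmetric]) (auto intro!: prod.cong ennreal_mult)
  finally show ?thesis
    by (simp add: mark_index_def prod.Plus d_def o_def)
qed

section \<open>Expected number of embeddings of a fixed tree\<close>

context soft_boolean_model
begin

definition valid_embedding :: "real \<Rightarrow> nat list \<Rightarrow> (nat \<Rightarrow> real set) \<Rightarrow> nat list \<Rightarrow> 'w set" where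
  "valid_embedding \<beta> ps G js = {\<omega> \<in> space M.
     tree_embedding (edge \<beta> X R W \<omega>) ps (0 # map Suc js) \<and>
     (\<forall>j\<in>{..length ps}. R ((0 # map Suc js) ! j) \<omega> \<in> G j)}"

lemma sets_valid_embedding [measurable]:
  assumes "\<And>j. G j \<in> sets borel"
  shows "valid_embedding \<beta> ps G js \<in> sets M"
proof -
  have "Measurable.pred M (\<lambda>\<omega>. R v \<omega> \<in> G j)" for v j
    using assms by (intro pred_sets2[of _ borel] measurable_radius) auto
  then have "Measurable.pred M (\<lambda>\<omega>. (length (0 # map Suc js) = Suc (length ps) \<and> distinct (0 # map Suc js) \<and>
     (\<forall>i\<in>{..<length ps}. edge \<beta> X R W \<omega> ((0 # map Suc js) ! (ps ! i)) ((0 # map Suc js) ! Suc i))) \<and>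
     (\<forall>j\<in>{..length ps}. R ((0 # map Suc js) ! j) \<omega> \<in> G j))"
    by (intro pred_intros_logic pred_intros_finite measurable_edge) auto
  then show ?thesis
    by (simp only: valid_embedding_def pred_def tree_embedding_def lessThan_iff Ball_def conj_assoc)
qed

definition tree_marks :: "nat list \<Rightarrow> nat list \<Rightarrow> 'w \<Rightarrow> nat + nat \<Rightarrow> real" where
  "tree_marks ps js \<omega> = (\<lambda>k\<in>mark_index ps. case_sum R W (mark_labels ps js k) \<omega>)"

text \<open>As distinct positions of the tree carry distinct labels, joint independence of the marks
  becomes a product law, the same for every choice of points.\<close>

lemma distr_tree_marks:
  assumes ps: "\<And>i. i < length ps \<Longrightarrow> ps ! i \<le> i" and js: "distinct js" "length js = length ps"
    and "0 < \<gamma>" "1 < \<delta>"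
  shows "distr M (Pi\<^sub>M (mark_index ps) (\<lambda>_. borel)) (tree_marks ps js) = Pi\<^sub>M (mark_index ps) (mark_law (real CARD('n) / \<gamma>) (real CARD('n) * \<delta>))"
proof -
  let ?Y = "\<lambda>k. case_sum R W (mark_labels ps js k)"
  have "indep_vars (\<lambda>_. borel) (case_sum R W) (mark_labels ps js ` mark_index ps)"
    using mark_labels_in[OF ps js] by (intro indep_vars_subset[OF marks_independent]) auto
  then have ind: "indep_vars (\<lambda>_. borel) ?Y (mark_index ps)"
    using indep_vars_reindex[OF inj_on_mark_labels[OF ps js]] by (simp add: o_def)
  have "Inl 0 \<in> mark_index ps" by simp
  then have ne: "mark_index ps \<noteq> {}" by blast
  have "distr M (Pi\<^sub>M (mark_index ps) (\<lambda>_. borel)) (tree_marks ps js)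
      = Pi\<^sub>M (mark_index ps) (\<lambda>k. distr M borel (?Y k))"
    unfolding tree_marks_def
    using indep_vars_iff_distr_eq_PiM'[of "mark_index ps" ?Y "\<lambda>_. borel"] ind ne
      measurable_mark[OF mark_labels_in[OF ps js]] by simp
  also have "\<dots> = Pi\<^sub>M (mark_index ps) (mark_law (real CARD('n) / \<gamma>) (real CARD('n) * \<delta>))"
  proof (rule PiM_cong[OF refl])
    fix k assume k: "k \<in> mark_index ps"
    show "distr M borel (?Y k) = mark_law (real CARD('n) / \<gamma>) (real CARD('n) * \<delta>) k"
    proof (cases k)
      case (Inr i)
      then have "mark_labels ps js (Inr i) \<in> UNIV <+> pairs" using mark_labels_in[OF ps js k] by simp
      then show ?thesis using Inr assms by (auto simp: mark_labels_def mark_law_def distr_weight)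
    qed (use assms in \<open>simp add: mark_labels_def mark_law_def distr_radius\<close>)
  qed
  finally show ?thesis .
qed

text \<open>\<open>A\<close> lies in the sigma-algebra of the locations and \<open>B\<close> in that
  of the marks, and these are independent.\<close>

lemma prob_cells_marks:
  fixes h :: real and ks :: "(int ^ 'n) list"
  assumes ps: "\<And>i. i < length ps \<Longrightarrow> ps ! i \<le> i" and js: "distinct js" "length js = length ps"
    and \<gamma>\<delta>: "0 < \<gamma>" "1 < \<delta>" and Q: "Q \<in> sets (Pi\<^sub>M (mark_index ps) (\<lambda>_. borel))"
  defines "A \<equiv> {\<omega> \<in> space M. map (\<lambda>i. grid h (X i \<omega>)) js = ks}"
    and "B \<equiv> {\<omega> \<in> space M. tree_marks ps js \<omega> \<in> Q}"
  shows "emeasure M (A \<inter> B) = emeasure M A * emeasure (Pi\<^sub>M (mark_index ps) (mark_law (real CARD('n) / \<gamma>) (real CARD('n) * \<delta>))) Q"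
    and "A \<inter> B \<in> sets M"
proof -
  have A: "A \<in> sigma_sets (space M) (\<Union>i. {X i -` B \<inter> space M | B. B \<in> sets borel})"
  proof -
    let ?N = "sigma (space M) (\<Union>i. {X i -` B \<inter> space M | B. B \<in> sets borel})"
    have X [measurable]: "X i \<in> ?N \<rightarrow>\<^sub>M borel" for i by (rule measurable_generator) simp
    have "{\<omega> \<in> space ?N. grid h (X i \<omega>) = k} \<in> sets ?N" for i k by measurable
    then have "Measurable.pred ?N (\<lambda>\<omega>. length js = length ks \<and> (\<forall>j\<in>{..<length ks}. grid h (X (js ! j) \<omega>) = ks ! j))"
      by (intro pred_intros_logic pred_intros_finite) (auto simp: pred_def)
    moreover have "A = {\<omega> \<in> space ?N. length js = length ks \<and> (\<forall>j\<in>{..<length ks}. grid h (X (js ! j) \<omega>) = ks ! j)}"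
      unfolding A_def space_measure_of_conv by (auto simp: list_eq_iff_nth_eq)
    ultimately have "A \<in> sets ?N" by (simp only: pred_def)
    then show ?thesis by (simp only: sets_generator)
  qed
  have B: "B \<in> sigma_sets (space M) (\<Union>k\<in>UNIV <+> pairs. {case_sum R W k -` B \<inter> space M | B. B \<in> sets borel})"
  proof -
    let ?N = "sigma (space M) (\<Union>k\<in>UNIV <+> pairs. {case_sum R W k -` B \<inter> space M | B. B \<in> sets borel})"
    have "tree_marks ps js \<in> ?N \<rightarrow>\<^sub>M Pi\<^sub>M (mark_index ps) (\<lambda>_. borel)"
      unfolding tree_marks_def
      by (intro measurable_restrict measurable_generator mark_labels_in[OF ps js]) auto
    then have "tree_marks ps js -` Q \<inter> space ?N \<in> sets ?N" using Q by (rule measurable_sets)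
    moreover have "B = tree_marks ps js -` Q \<inter> space ?N"
      unfolding B_def space_measure_of_conv by auto
    ultimately have "B \<in> sets ?N" by simp
    then show ?thesis by (simp only: sets_generator)
  qed
  have "A \<in> sets M" "B \<in> sets M"
    using A B indep_setD_ev1[OF points_marks_independent] indep_setD_ev2[OF points_marks_independent] by auto
  then show "A \<inter> B \<in> sets M" by simp
  have m: "tree_marks ps js \<in> M \<rightarrow>\<^sub>M Pi\<^sub>M (mark_index ps) (\<lambda>_. borel)"
    unfolding tree_marks_def
    by (intro measurable_restrict measurable_mark mark_labels_in[OF ps js]) auto
  have "emeasure (distr M (Pi\<^sub>M (mark_index ps) (\<lambda>_. borel)) (tree_marks ps js)) Q
      = emeasure M (tree_marks ps js -` Q \<inter> space M)"
    by (rule emeasure_distr[OF m Q])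
  also have "tree_marks ps js -` Q \<inter> space M = B" by (auto simp: B_def)
  also have "distr M (Pi\<^sub>M (mark_index ps) (\<lambda>_. borel)) (tree_marks ps js)
      = Pi\<^sub>M (mark_index ps) (mark_law (real CARD('n) / \<gamma>) (real CARD('n) * \<delta>))"
    by (rule distr_tree_marks[OF ps js \<gamma>\<delta>])
  finally have "emeasure M B = emeasure (Pi\<^sub>M (mark_index ps) (mark_law (real CARD('n) / \<gamma>) (real CARD('n) * \<delta>))) Q" ..
  moreover have "prob (A \<inter> B) = prob A * prob B"
    by (rule indep_setD[OF points_marks_independent A B])
  ultimately show "emeasure M (A \<inter> B) = emeasure M A * emeasure (Pi\<^sub>M (mark_index ps) (mark_law (real CARD('n) / \<gamma>) (real CARD('n) * \<delta>))) Q"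
    by (simp add: emeasure_eq_measure ennreal_mult')
qed

end

lemma prob_space_mark_law: "0 < a \<Longrightarrow> 0 < b \<Longrightarrow> prob_space (mark_law a b k)"
  by (auto simp: mark_law_def prob_space_pareto split: sum.splits)

lemma sets_mark_law [simp]: "sets (mark_law a b k) = sets borel"
  by (auto simp: mark_law_def split: sum.splits)

context soft_boolean_model
begin

text \<open>The side \<open>h\<close> equals the factor \<open>\<beta> powr (1 / d)\<close> of the
  edge rule, so the condition on cells is free of \<open>\<beta>\<close>, which survives only in the
  cell volume \<open>h ^ d = \<beta>\<close>.\<close>

lemma tree_marks_in_mark_event:
  assumes ps: "\<And>i. i < length ps \<Longrightarrow> ps ! i \<le> i" and js: "distinct js" "length js = length ps"
    and h: "0 < h" "h = \<beta> powr (1 / real CARD('n))"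
    and \<omega>: "\<omega> \<in> valid_embedding \<beta> ps G js" and R1: "\<And>v. 1 < R v \<omega>" and W1: "\<And>e. e \<in> pairs \<Longrightarrow> 1 < W e \<omega>"
  shows "tree_marks ps js \<omega> \<in> mark_event ps G (map (\<lambda>i. grid h (X i \<omega>)) js)"
proof -
  let ?t = "0 # map Suc js" and ?ks = "map (\<lambda>i. grid h (X i \<omega>)) js" and ?z = "tree_marks ps js \<omega>"
  have le: "ps ! i \<le> length ps" if "i < length ps" for i using ps[OF that] that by simp
  have z: "?z (Inl j) = R (?t ! j) \<omega>" if "j \<le> length ps" for j
    using that by (simp add: tree_marks_def mark_labels_def)
  have z': "?z (Inr i) = W {?t ! (ps ! i), ?t ! Suc i} \<omega>" if "i < length ps" for i
    using that by (simp add: tree_marks_def mark_labels_def del: nth_Cons_Suc)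
  have loc: "grid h (location X \<omega> (?t ! j)) = (0 # ?ks) ! j" if "j \<le> length ps" for j
    using that js by (cases j) auto
  have gt1: "1 < ?z k" if k: "k \<in> mark_index ps" for k
  proof (cases k)
    case (Inl j)
    then show ?thesis using k R1 z by simp
  next
    case (Inr i)
    have "mark_labels ps js (Inr i) \<in> UNIV <+> pairs" using mark_labels_in[OF ps js k] Inr by simp
    then have "{?t ! (ps ! i), ?t ! Suc i} \<in> pairs" by (auto simp: mark_labels_def simp del: nth_Cons_Suc)
    then show ?thesis using k Inr W1 z' by (simp del: nth_Cons_Suc)
  qed
  have "near (?z (Inr i) * (?z (Inl (ps ! i)) * ?z (Inl (Suc i)))) ((0 # ?ks) ! (ps ! i)) (?ks ! i)"
    if i: "i < length ps" for i
  proof -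
    let ?u = "?t ! (ps ! i)" and ?v = "?t ! Suc i"
    have Sle: "Suc i \<le> length ps" using i by simp
    have "edge \<beta> X R W \<omega> ?u ?v" using \<omega> i by (auto simp: valid_embedding_def tree_embedding_def)
    then have "norm (location X \<omega> ?u - location X \<omega> ?v) \<le> h * W {?u, ?v} \<omega> * max (R ?u \<omega>) (R ?v \<omega>)"
      by (simp only: edge_def h)
    also have "\<dots> \<le> h * W {?u, ?v} \<omega> * (R ?u \<omega> * R ?v \<omega>)"
    proof (rule mult_left_mono)
      show "max (R ?u \<omega>) (R ?v \<omega>) \<le> R ?u \<omega> * R ?v \<omega>"
        using R1[of ?u] R1[of ?v] mult_left_mono[of 1 "R ?v \<omega>" "R ?u \<omega>"] mult_right_mono[of 1 "R ?u \<omega>" "R ?v \<omega>"]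
        by (simp del: nth_Cons_Suc)
      have "0 \<le> W {?u, ?v} \<omega>" using gt1[of "Inr i"] z'[OF i] i by (simp del: nth_Cons_Suc)
      then show "0 \<le> h * W {?u, ?v} \<omega>" using h(1) by (intro mult_nonneg_nonneg) auto
    qed
    also have "\<dots> = h * (?z (Inr i) * (?z (Inl (ps ! i)) * ?z (Inl (Suc i))))"
      unfolding z[OF le[OF i]] z[OF Sle] z'[OF i] by (simp only: mult.assoc)
    finally have "near (?z (Inr i) * (?z (Inl (ps ! i)) * ?z (Inl (Suc i))))
        (grid h (location X \<omega> ?u)) (grid h (location X \<omega> ?v))"
      by (rule near_grid[OF h(1)])
    then show ?thesis unfolding loc[OF le[OF i]] loc[OF Sle] by simp
  qed
  moreover have "?z (Inl j) \<in> G j" if "j \<le> length ps" for j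
    using \<omega> z that by (auto simp: valid_embedding_def)
  moreover have "?z \<in> space (Pi\<^sub>M (mark_index ps) (\<lambda>_. borel))"
    by (simp add: tree_marks_def space_PiM)
  ultimately show ?thesis
    using gt1 js(2) by (auto simp: mark_event_def)
qed

text \<open>First moment bound behind both parts of the upper estimate. Each edge costs
  \<open>\<beta>\<close> for the volume of a cell, \<open>5 ^ d\<close> for the choice of the cell
  and \<open>\<delta> / (\<delta> - 1)\<close>, the \<open>d\<close>-th moment of a weight; each
  vertex costs a moment of its radius, restricted to \<open>G j\<close>.\<close>

lemma expected_embeddings:
  assumes ps: "\<And>i. i < length ps \<Longrightarrow> ps ! i \<le> i" and \<beta>: "0 < \<beta>" and \<gamma>\<delta>: "0 < \<gamma>" "1 < \<delta>"
    and G: "\<And>j. G j \<in> sets borel"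
  shows "(\<integral>\<^sup>+js. emeasure M (valid_embedding \<beta> ps G js) \<partial>count_space UNIV)
    \<le> ennreal ((5 ^ CARD('n) * (\<delta> / (\<delta> - 1)) * \<beta>) ^ length ps) *
      (\<Prod>j\<le>length ps. \<integral>\<^sup>+r. ennreal (r ^ (CARD('n) * tree_degree ps j)) * indicator (G j) r
         \<partial>pareto (real CARD('n) / \<gamma>))"
proof -
  define d where "d = CARD('n)"
  define h where "h = \<beta> powr (1 / real CARD('n))"
  define P where "P = Pi\<^sub>M (mark_index ps) (mark_law (real CARD('n) / \<gamma>) (real CARD('n) * \<delta>))"
  define A where "A js ks = {\<omega> \<in> space M. map (\<lambda>i. grid h (X i \<omega>)) js = ks}" for js and ks :: "(int ^ 'n) list"
  define JS where "JS = {js :: nat list. distinct js \<and> length js = length ps}"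
  have h: "0 < h" using \<beta> by (simp add: h_def)
  have hd: "h ^ CARD('n) = \<beta>"
    using \<beta> by (simp add: h_def powr_powr flip: powr_realpow)
  have setsP: "sets P = sets (Pi\<^sub>M (mark_index ps) (\<lambda>_. borel))"
    unfolding P_def by (intro sets_PiM_cong) auto
  have Q: "mark_event ps G ks \<in> sets P" for ks :: "(int ^ 'n) list"
    unfolding setsP by (rule sets_mark_event[OF ps G])
  have pos: "0 < real CARD('n) / \<gamma>" "0 < real CARD('n) * \<delta>" using \<gamma>\<delta> by auto
  have "(\<integral>\<^sup>+js. emeasure M (valid_embedding \<beta> ps G js) \<partial>count_space UNIV)
      = (\<integral>\<^sup>+js. emeasure M (valid_embedding \<beta> ps G js) \<partial>count_space JS)"
  proof (rule nn_integral_count_space_eq)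
    fix js assume "js \<in> UNIV - JS"
    then have "valid_embedding \<beta> ps G js = {}"
      by (auto simp: valid_embedding_def tree_embedding_def JS_def distinct_map)
    then show "emeasure M (valid_embedding \<beta> ps G js) = 0" by simp
  qed auto
  also have "\<dots> \<le> (\<integral>\<^sup>+js. (\<integral>\<^sup>+ks. emeasure M (A js ks) * emeasure P (mark_event ps G ks) \<partial>count_space UNIV) \<partial>count_space JS)"
  proof (rule nn_integral_mono)
    fix js assume "js \<in> space (count_space JS)"
    then have js: "distinct js" "length js = length ps" by (auto simp: JS_def)
    let ?B = "\<lambda>ks :: (int ^ 'n) list. {\<omega> \<in> space M. tree_marks ps js \<omega> \<in> mark_event ps G ks}"
    have Qks: "mark_event ps G ks \<in> sets (Pi\<^sub>M (mark_index ps) (\<lambda>_. borel))" for ks :: "(int ^ 'n) list"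
      by (rule sets_mark_event[OF ps G])
    have *: "emeasure M (A js ks \<inter> ?B ks) = emeasure M (A js ks) * emeasure P (mark_event ps G ks)"
      "A js ks \<inter> ?B ks \<in> sets M" for ks
      unfolding A_def P_def by (rule prob_cells_marks[OF ps js \<gamma>\<delta> Qks]; assumption)+
    have "emeasure M (valid_embedding \<beta> ps G js) \<le> (\<integral>\<^sup>+ks. emeasure M (A js ks \<inter> ?B ks) \<partial>count_space UNIV)"
    proof (rule emeasure_le_nn_integral_cover)
      show "A js ks \<inter> ?B ks \<in> sets M" for ks
        by (rule *(2))
      show "AE \<omega> in M. \<omega> \<in> valid_embedding \<beta> ps G js \<longrightarrow> (\<exists>ks. \<omega> \<in> A js ks \<inter> ?B ks)"
        using AE_radius_gt_1 AE_weight_gt_1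
      proof eventually_elim
        case (elim \<omega>)
        show ?case
        proof
          assume v: "\<omega> \<in> valid_embedding \<beta> ps G js"
          have "tree_marks ps js \<omega> \<in> mark_event ps G (map (\<lambda>i. grid h (X i \<omega>)) js)"
            using elim by (intro tree_marks_in_mark_event[OF ps js h h_def v]) auto
          then have "\<omega> \<in> A js (map (\<lambda>i. grid h (X i \<omega>)) js) \<inter> ?B (map (\<lambda>i. grid h (X i \<omega>)) js)"
            using v by (auto simp: A_def valid_embedding_def)
          then show "\<exists>ks. \<omega> \<in> A js ks \<inter> ?B ks" by blast
        qed
      qed
    qed
    also have "\<dots> = (\<integral>\<^sup>+ks. emeasure M (A js ks) * emeasure P (mark_event ps G ks) \<partial>count_space UNIV)"
      by (intro nn_integral_cong *(1))
    finally show "emeasure M (valid_embedding \<beta> ps G js)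
      \<le> (\<integral>\<^sup>+ks. emeasure M (A js ks) * emeasure P (mark_event ps G ks) \<partial>count_space UNIV)" .
  qed
  also have "\<dots> = (\<integral>\<^sup>+ks. (\<integral>\<^sup>+js. emeasure M (A js ks) * emeasure P (mark_event ps G ks) \<partial>count_space JS) \<partial>count_space UNIV)"
    by (intro nn_integral_count_space_nn_integral) auto
  \<comment> \<open>For fixed cells the mark probability does not depend on \<open>js\<close>, so
    the sum over \<open>js\<close> concerns locations only.\<close>
  also have "\<dots> \<le> (\<integral>\<^sup>+ks. ennreal (\<beta> ^ length ps) * emeasure P (mark_event ps G ks) \<partial>count_space (UNIV :: (int ^ 'n) list set))"
  proof (rule nn_integral_mono)
    fix ks :: "(int ^ 'n) list"
    show "(\<integral>\<^sup>+js. emeasure M (A js ks) * emeasure P (mark_event ps G ks) \<partial>count_space JS)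
      \<le> ennreal (\<beta> ^ length ps) * emeasure P (mark_event ps G ks)"
    proof (cases "length ks = length ps")
      case True
      have "(\<integral>\<^sup>+js. emeasure M (A js ks) \<partial>count_space JS) = (\<integral>\<^sup>+js. emeasure M (A js ks) \<partial>count_space {js. distinct js})"
      proof (rule nn_integral_count_space_eq)
        fix js assume "js \<in> {js. distinct js} - JS"
        then have "A js ks = {}" using True by (auto simp: JS_def A_def)
        then show "emeasure M (A js ks) = 0" by simp
      qed (auto simp: JS_def)
      also have "\<dots> \<le> ennreal (\<beta> ^ length ps)"
        using expected_tuples_in_cells[OF h, of ks] True unfolding A_def hd by simp
      finally show ?thesis by (subst nn_integral_multc) (auto intro: mult_right_mono)
    next
      case False
      then have "mark_event ps G ks = {}" by (auto simp: mark_event_def)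
      then show ?thesis by simp
    qed
  qed
  also have "\<dots> = ennreal (\<beta> ^ length ps) * (\<integral>\<^sup>+ks. emeasure P (mark_event ps G ks) \<partial>count_space (UNIV :: (int ^ 'n) list set))"
    by (rule nn_integral_cmult) simp
  finally have 1: "(\<integral>\<^sup>+js. emeasure M (valid_embedding \<beta> ps G js) \<partial>count_space UNIV)
    \<le> ennreal (\<beta> ^ length ps) * (\<integral>\<^sup>+ks. emeasure P (mark_event ps G ks) \<partial>count_space (UNIV :: (int ^ 'n) list set))" .
  \<comment> \<open>Summed over all cell lists, these probabilities give the expected number of
    lists compatible with the marks, and that count is dominated by a product over independent
    marks.\<close>
  have "(\<integral>\<^sup>+ks. emeasure P (mark_event ps G ks) \<partial>count_space (UNIV :: (int ^ 'n) list set))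
      = (\<integral>\<^sup>+ks. (\<integral>\<^sup>+z. indicator (mark_event ps G ks) z \<partial>P) \<partial>count_space (UNIV :: (int ^ 'n) list set))"
    using Q by simp
  also have "\<dots> = (\<integral>\<^sup>+z. (\<integral>\<^sup>+ks. indicator (mark_event ps G ks) z \<partial>count_space (UNIV :: (int ^ 'n) list set)) \<partial>P)"
    using Q by (intro nn_integral_count_space_nn_integral[symmetric]) auto
  also have "\<dots> \<le> (\<integral>\<^sup>+z. (\<Prod>k\<in>mark_index ps. (case k of
        Inl j \<Rightarrow> ennreal (z k ^ (CARD('n) * tree_degree ps j)) * indicator (G j) (z k)
      | Inr i \<Rightarrow> ennreal (5 ^ CARD('n)) * ennreal (z k ^ CARD('n)))) \<partial>P)"
    by (intro nn_integral_mono nn_integral_count_mark_event ps)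
  also have "\<dots> = (\<Prod>k\<in>mark_index ps. \<integral>\<^sup>+x. (case k of
        Inl j \<Rightarrow> ennreal (x ^ (CARD('n) * tree_degree ps j)) * indicator (G j) x
      | Inr i \<Rightarrow> ennreal (5 ^ CARD('n)) * ennreal (x ^ CARD('n)))
        \<partial>mark_law (real CARD('n) / \<gamma>) (real CARD('n) * \<delta>) k)"
  proof -
    interpret product_sigma_finite "mark_law (real CARD('n) / \<gamma>) (real CARD('n) * \<delta>)"
      by (intro product_sigma_finite.intro prob_space_imp_sigma_finite prob_space_mark_law pos)
    note G [measurable]
    have "(\<lambda>x. case k of
        Inl j \<Rightarrow> ennreal (x ^ (CARD('n) * tree_degree ps j)) * indicator (G j) x
      | Inr i \<Rightarrow> ennreal (5 ^ CARD('n)) * ennreal (x ^ CARD('n))) \<in> borel_measurable borel" for k :: "nat + nat"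
      by (cases k) auto
    then show ?thesis unfolding P_def
      by (intro product_nn_integral_prod) (simp_all add: measurable_cong_sets[OF sets_mark_law refl])
  qed
  also have "\<dots> = (\<Prod>j\<le>length ps. \<integral>\<^sup>+r. ennreal (r ^ (CARD('n) * tree_degree ps j)) * indicator (G j) r
         \<partial>pareto (real CARD('n) / \<gamma>))
      * (\<Prod>i<length ps. \<integral>\<^sup>+w. ennreal (5 ^ CARD('n)) * ennreal (w ^ CARD('n)) \<partial>pareto (real CARD('n) * \<delta>))"
    unfolding mark_index_def by (simp add: prod.Plus mark_law_def)
  also have "(\<integral>\<^sup>+w. ennreal (5 ^ CARD('n)) * ennreal (w ^ CARD('n)) \<partial>pareto (real CARD('n) * \<delta>))
      = ennreal (5 ^ CARD('n) * (\<delta> / (\<delta> - 1)))"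
  proof -
    have "(\<integral>\<^sup>+w. ennreal (5 ^ CARD('n)) * ennreal (w ^ CARD('n)) \<partial>pareto (real CARD('n) * \<delta>))
        = ennreal (5 ^ CARD('n)) * (\<integral>\<^sup>+w. ennreal (w ^ CARD('n)) \<partial>pareto (real CARD('n) * \<delta>))"
      by (rule nn_integral_cmult) simp
    also have "(\<integral>\<^sup>+w. ennreal (w ^ CARD('n)) \<partial>pareto (real CARD('n) * \<delta>)) = ennreal (\<delta> / (\<delta> - 1))"
    proof (subst pareto_moment_power)
      show "real CARD('n) < real CARD('n) * \<delta>" using \<gamma>\<delta> by simp
      have "real CARD('n) * \<delta> - real CARD('n) = real CARD('n) * (\<delta> - 1)" by (simp add: algebra_simps)
      then show "ennreal (real CARD('n) * \<delta> / (real CARD('n) * \<delta> - real CARD('n))) = ennreal (\<delta> / (\<delta> - 1))"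
        by simp
    qed
    also have "ennreal (5 ^ CARD('n)) * ennreal (\<delta> / (\<delta> - 1)) = ennreal (5 ^ CARD('n) * (\<delta> / (\<delta> - 1)))"
      using \<gamma>\<delta> by (intro ennreal_mult[symmetric]) auto
    finally show ?thesis .
  qed
  finally have 2: "(\<integral>\<^sup>+ks. emeasure P (mark_event ps G ks) \<partial>count_space (UNIV :: (int ^ 'n) list set))
    \<le> (\<Prod>j\<le>length ps. \<integral>\<^sup>+r. ennreal (r ^ (CARD('n) * tree_degree ps j)) * indicator (G j) r
         \<partial>pareto (real CARD('n) / \<gamma>)) * (\<Prod>i<length ps. ennreal (5 ^ CARD('n) * (\<delta> / (\<delta> - 1))))" .
  note main = order.trans[OF 1 mult_left_mono[OF 2 zero_le]]
  define c where "c = 5 ^ CARD('n) * (\<delta> / (\<delta> - 1))"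
  have c: "0 \<le> c" using \<gamma>\<delta> by (simp add: c_def)
  have "ennreal ((c * \<beta>) ^ length ps) = ennreal (\<beta> ^ length ps) * (\<Prod>i<length ps. ennreal c)"
    using \<beta> c by (simp add: power_mult_distrib ennreal_mult ennreal_power mult.commute)
  then have "ennreal ((5 ^ CARD('n) * (\<delta> / (\<delta> - 1)) * \<beta>) ^ length ps)
      = ennreal (\<beta> ^ length ps) * (\<Prod>i<length ps. ennreal (5 ^ CARD('n) * (\<delta> / (\<delta> - 1))))"
    unfolding c_def .
  then show ?thesis using main by (simp only: mult_ac)
qed

end

section \<open>Upper bound\<close>

lemma pareto_moment_mono:
  assumes "0 < a" "k \<le> k'"
  shows "(\<integral>\<^sup>+x. ennreal (x ^ k) * indicator S x \<partial>pareto a) \<le> (\<integral>\<^sup>+x. ennreal (x ^ k') * indicator S x \<partial>pareto a)"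
proof (rule nn_integral_mono_AE, use AE_pareto[OF assms(1)] in eventually_elim)
  fix x :: real assume "1 < x"
  then have "x ^ k \<le> x ^ k'" using assms(2) by (intro power_increasing) auto
  then show "ennreal (x ^ k) * indicator S x \<le> ennreal (x ^ k') * indicator S x"
    by (intro mult_right_mono ennreal_leI) auto
qed

lemma pareto_moment_le:
  assumes "real k' < a" "k \<le> k'"
  shows "(\<integral>\<^sup>+x. ennreal (x ^ k) * indicator S x \<partial>pareto a) \<le> ennreal (a / (a - real k'))"
proof -
  have a: "0 < a" using assms by linarith
  have "(\<integral>\<^sup>+x. ennreal (x ^ k) * indicator S x \<partial>pareto a) \<le> (\<integral>\<^sup>+x. ennreal (x ^ k') * indicator S x \<partial>pareto a)"
    by (rule pareto_moment_mono[OF a assms(2)])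
  also have "\<dots> \<le> (\<integral>\<^sup>+x. ennreal (x ^ k') \<partial>pareto a)"
    by (intro nn_integral_mono) (auto simp: indicator_def)
  finally show ?thesis using pareto_moment_power[OF assms(1)] by simp
qed

text \<open>
  Interpolation between the second and the \<open>(p+1)\<close>-st moment of \<open>r ^ d\<close>. The bound is
  multiplicative in the excess \<open>k - 2\<close>, and it is sharp at \<open>k = p + 1\<close>.
\<close>

lemma pareto_truncated_moment:
  fixes d p k :: nat and u a :: real
  assumes u: "1 \<le> u" and d: "0 < d" "real (2 * d) < a" and p: "2 \<le> p" "a < real (d * (p + 1))" and k: "k \<le> p + 1"
  defines "D \<equiv> u powr ((real (d * (p + 1)) - a) / real (p - 1))"
  shows "(\<integral>\<^sup>+x. ennreal (x ^ (d * k)) * indicator {..u} x \<partial>pareto a)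
    \<le> ennreal ((a / (a - real (2 * d)) + a / (real (d * (p + 1)) - a)) * D ^ (k - 2))"
proof -
  define B where "B = a / (a - real (2 * d))"
  define B' where "B' = a / (real (d * (p + 1)) - a)"
  have a: "0 < a" using d by simp
  have B: "0 \<le> B" "0 \<le> B'" using a d p by (auto simp: B_def B'_def)
  have D: "1 \<le> D" unfolding D_def using u p by (intro ge_one_powr_ge_zero) auto
  show ?thesis
  proof (cases "k \<le> 2")
    case True
    have "(\<integral>\<^sup>+x. ennreal (x ^ (d * k)) * indicator {..u} x \<partial>pareto a) \<le> ennreal B"
      unfolding B_def using True d by (intro pareto_moment_le) auto
    also have "\<dots> \<le> ennreal ((B + B') * D ^ (k - 2))" using True B by (intro ennreal_leI) auto
    finally show ?thesis by (simp add: B_def B'_def)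
  next
    case False
    define e where "e = k - 2"
    have e: "k = 2 + e" "e \<le> p - 1" using False k by (auto simp: e_def)
    \<comment> \<open>\<open>D\<close> is defined for this identity: \<open>D ^ (p - 1)\<close> is
      the growth in \<open>u\<close> of the truncated moment of order \<open>p + 1\<close>.\<close>
    have Dp: "D ^ (p - 1) = u powr (real (d * (p + 1)) - a)"
      using u p by (simp add: D_def powr_powr flip: powr_realpow)
    have pt: "x ^ (d * k) \<le> D ^ e * (x ^ (2 * d)) + D ^ e / D ^ (p - 1) * x ^ (d * (p + 1))" if x: "1 < x" for x :: real
    proof -
      \<comment> \<open>After rescaling by \<open>D\<close> the interpolation is just
        \<open>y ^ e \<le> 1 + y ^ (p - 1)\<close>, where one of the two terms suffices according to
        whether \<open>y \<le> 1\<close>.\<close>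
      define y where "y = x ^ d / D"
      have y: "0 \<le> y" using x D by (simp add: y_def)
      have "y ^ e \<le> 1 + y ^ (p - 1)"
      proof (cases "y \<le> 1")
        case True
        then have "y ^ e \<le> 1" using y by (simp add: power_le_one)
        then show ?thesis using y by (simp add: add_increasing2)
      next
        case False
        then have "y ^ e \<le> y ^ (p - 1)" using e by (intro power_increasing) auto
        then show ?thesis by simp
      qed
      then have "x ^ (2 * d) * (D ^ e * y ^ e) \<le> x ^ (2 * d) * (D ^ e * (1 + y ^ (p - 1)))"
        using x D by (intro mult_left_mono) auto
      moreover have "x ^ (2 * d) * (D ^ e * y ^ e) = x ^ (d * k)"
      proof -
        have "D ^ e * y ^ e = x ^ (d * e)" using D by (simp add: y_def power_divide power_mult)
        moreover have "2 * d + d * e = d * k" by (simp add: e algebra_simps)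
        ultimately show ?thesis by (simp flip: power_add)
      qed
      moreover have "x ^ (2 * d) * y ^ (p - 1) = x ^ (d * (p + 1)) / D ^ (p - 1)"
      proof -
        have "2 * d + d * (p - 1) = d * (p + 1)" using p by (cases p) auto
        then have "x ^ (2 * d) * x ^ (d * (p - 1)) = x ^ (d * (p + 1))" by (simp only: power_add[symmetric])
        then show ?thesis by (simp only: y_def power_divide power_mult[symmetric] times_divide_eq_right)
      qed
      then have "x ^ (2 * d) * (D ^ e * (1 + y ^ (p - 1))) = D ^ e * (x ^ (2 * d)) + D ^ e / D ^ (p - 1) * x ^ (d * (p + 1))"
        by (simp add: algebra_simps)
      ultimately show ?thesis by simp
    qed
    have "(\<integral>\<^sup>+x. ennreal (x ^ (d * k)) * indicator {..u} x \<partial>pareto a)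
      \<le> (\<integral>\<^sup>+x. ennreal (D ^ e) * (ennreal (x ^ (2 * d)) * indicator {..u} x)
          + ennreal (D ^ e / D ^ (p - 1)) * (ennreal (x ^ (d * (p + 1))) * indicator {..u} x) \<partial>pareto a)"
    proof (rule nn_integral_mono_AE, use AE_pareto[OF a] in eventually_elim)
      fix x :: real assume x: "1 < x"
      have "ennreal (x ^ (d * k)) \<le> ennreal (D ^ e * (x ^ (2 * d)) + D ^ e / D ^ (p - 1) * x ^ (d * (p + 1)))"
        by (rule ennreal_leI[OF pt[OF x]])
      also have "\<dots> = ennreal (D ^ e * x ^ (2 * d)) + ennreal (D ^ e / D ^ (p - 1) * x ^ (d * (p + 1)))"
        using x D by (intro ennreal_plus mult_nonneg_nonneg divide_nonneg_nonneg zero_le_power) auto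
      also have "ennreal (D ^ e * x ^ (2 * d)) = ennreal (D ^ e) * ennreal (x ^ (2 * d))"
        using x D by (intro ennreal_mult zero_le_power) auto
      also have "ennreal (D ^ e / D ^ (p - 1) * x ^ (d * (p + 1))) = ennreal (D ^ e / D ^ (p - 1)) * ennreal (x ^ (d * (p + 1)))"
        using x D by (intro ennreal_mult divide_nonneg_nonneg zero_le_power) auto
      finally show "ennreal (x ^ (d * k)) * indicator {..u} x \<le> ennreal (D ^ e) * (ennreal (x ^ (2 * d)) * indicator {..u} x)
          + ennreal (D ^ e / D ^ (p - 1)) * (ennreal (x ^ (d * (p + 1))) * indicator {..u} x)"
        by (auto simp: indicator_def)
    qed
    also have "\<dots> = ennreal (D ^ e) * (\<integral>\<^sup>+x. ennreal (x ^ (2 * d)) * indicator {..u} x \<partial>pareto a)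
        + ennreal (D ^ e / D ^ (p - 1)) * (\<integral>\<^sup>+x. ennreal (x ^ (d * (p + 1))) * indicator {..u} x \<partial>pareto a)"
      by (simp add: nn_integral_add nn_integral_cmult)
    also have "\<dots> \<le> ennreal (D ^ e) * ennreal B + ennreal (D ^ e / D ^ (p - 1)) * ennreal (B' * D ^ (p - 1))"
      unfolding B_def B'_def Dp using u a d p
      by (intro add_mono mult_left_mono pareto_moment_le pareto_lower_moment_power) auto
    also have "\<dots> = ennreal (D ^ e * B + D ^ e / D ^ (p - 1) * (B' * D ^ (p - 1)))"
    proof -
      have n: "0 \<le> D ^ e" "0 \<le> D ^ e / D ^ (p - 1)" "0 \<le> B' * D ^ (p - 1)" using B D by auto
      show ?thesis
        unfolding ennreal_plus[OF mult_nonneg_nonneg[OF n(1) B(1)] mult_nonneg_nonneg[OF n(2,3)]]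
          ennreal_mult[OF n(1) B(1)] ennreal_mult[OF n(2,3)] ..
    qed
    also have "D ^ e * B + D ^ e / D ^ (p - 1) * (B' * D ^ (p - 1)) = (B + B') * D ^ (k - 2)"
      using D by (simp add: e algebra_simps)
    finally show ?thesis by (simp add: B_def B'_def)
  qed
qed

text \<open>One index is chosen for each element of \<open>Y\<close>. Only finitely many indices are
  chosen, so the counting takes place in a finite sum, which is enlarged to all indices at the
  end.\<close>

lemma card_le_nn_integral_cover:
  fixes c :: "'i \<Rightarrow> nat"
  assumes "finite Y" and cover: "\<And>y. y \<in> Y \<Longrightarrow> \<exists>i. P i \<and> y \<in> T i"
    and card: "\<And>i. P i \<Longrightarrow> card (Y \<inter> T i) \<le> c i"
  shows "of_nat (card Y) \<le> (\<integral>\<^sup>+i. of_nat (c i) * indicator {i. P i} i \<partial>count_space UNIV)"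
proof -
  obtain f where f: "P (f y)" "y \<in> T (f y)" if "y \<in> Y" for y
    using cover by metis
  have "Y \<subseteq> (\<Union>i\<in>f ` Y. Y \<inter> T i)" using f by auto
  then have "card Y \<le> card (\<Union>i\<in>f ` Y. Y \<inter> T i)"
    using assms(1) by (intro card_mono) auto
  also have "\<dots> \<le> (\<Sum>i\<in>f ` Y. card (Y \<inter> T i))" using assms(1) by (intro card_UN_le) auto
  also have "\<dots> \<le> (\<Sum>i\<in>f ` Y. c i)" using f card by (intro sum_mono) auto
  finally have "of_nat (card Y) \<le> (of_nat (\<Sum>i\<in>f ` Y. c i) :: ennreal)" by (simp only: of_nat_le_iff)
  also have "\<dots> = (\<Sum>i\<in>f ` Y. of_nat (c i) * indicator {i. P i} i)"
    using f by (auto intro!: sum.cong)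
  also have "\<dots> = (\<integral>\<^sup>+i. of_nat (c i) * indicator {i. P i} i \<partial>count_space (f ` Y))"
    using assms(1) by (simp add: nn_integral_count_space_finite)
  also have "\<dots> \<le> (\<integral>\<^sup>+i. of_nat (c i) * indicator {i. P i} i \<partial>count_space UNIV)"
    by (subst nn_integral_count_space_indicator) (auto intro!: nn_integral_mono simp: indicator_def)
  finally show ?thesis .
qed

text \<open>The component may be infinite; a finite part with at least \<open>m\<close> vertices is
  enough for the count of \<open>p\<close>-tuples.\<close>

lemma finite_subset_of_large_set:
  assumes "ennreal m < emeasure (count_space UNIV) C" "0 \<le> m"
  obtains F where "F \<subseteq> C" "finite F" "m \<le> real (card F)"
proof (cases "finite C")
  case True
  then have "ennreal m < ennreal (real (card C))" using assms by (simp add: ennreal_of_nat_eq_real_of_nat)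
  then show ?thesis using that[of C] True assms(2) by (simp add: ennreal_less_iff)
next
  case False
  obtain F where "F \<subseteq> C" "finite F" "card F = nat \<lceil>m\<rceil>"
    using infinite_arbitrarily_large[OF False] by blast
  then show ?thesis using that[of F] by (simp add: real_nat_ceiling_ge)
qed

text \<open>Labels other than that of the origin are successors, hence belong to Poisson
  points.\<close>

lemma distinct_from_0:
  assumes "distinct xs" "xs ! 0 = 0" "xs \<noteq> []"
  obtains js where "xs = 0 # map Suc js"
proof -
  obtain ys where ys: "xs = 0 # ys" using assms by (cases xs) auto
  have "map Suc (map (\<lambda>v. v - 1) ys) = ys"
    using assms(1) unfolding ys by (induction ys) auto
  then show ?thesis using that[of "map (\<lambda>v. v - 1) ys"] ys by simp
qed

lemma nn_integral_path_tree:
  fixes f :: "nat \<Rightarrow> ennreal"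
  shows "(\<integral>\<^sup>+ps. f (length ps) * indicator {ps. path_tree p ps} ps \<partial>count_space UNIV)
    \<le> (\<Sum>L. of_nat (Suc L ^ (2 * p)) * f L)"
proof -
  let ?S = "\<lambda>L. {ps. path_tree p ps \<and> length ps = L}"
  have "(\<integral>\<^sup>+ps. f (length ps) * indicator {ps. path_tree p ps} ps \<partial>count_space UNIV)
      = (\<integral>\<^sup>+ps. (\<integral>\<^sup>+L. f L * indicator (?S L) ps \<partial>count_space UNIV) \<partial>count_space UNIV)"
  proof (rule nn_integral_cong)
    fix ps :: "nat list"
    show "f (length ps) * indicator {ps. path_tree p ps} ps = (\<integral>\<^sup>+L. f L * indicator (?S L) ps \<partial>count_space UNIV)"
      by (subst nn_integral_count_space'[where A = "{length ps}"]) (auto simp: indicator_def)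
  qed
  also have "\<dots> = (\<integral>\<^sup>+L. (\<integral>\<^sup>+ps. f L * indicator (?S L) ps \<partial>count_space UNIV) \<partial>count_space UNIV)"
    by (intro nn_integral_count_space_nn_integral) auto
  also have "\<dots> \<le> (\<integral>\<^sup>+L. of_nat (Suc L ^ (2 * p)) * f L \<partial>count_space UNIV)"
  proof (rule nn_integral_mono)
    fix L :: nat
    have "(\<integral>\<^sup>+ps. f L * indicator (?S L) ps \<partial>count_space UNIV) = f L * of_nat (card (?S L))"
      using card_path_tree[of p L] by (simp add: nn_integral_cmult_indicator)
    also have "\<dots> \<le> f L * of_nat (Suc L ^ (2 * p))"
      using card_path_tree[of p L] by (intro mult_left_mono) (simp_all only: of_nat_le_iff zero_le)
    finally show "(\<integral>\<^sup>+ps. f L * indicator (?S L) ps \<partial>count_space UNIV) \<le> of_nat (Suc L ^ (2 * p)) * f L"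
      by (simp only: mult.commute)
  qed
  finally show ?thesis by (simp only: nn_integral_count_space_nat)
qed

lemma suminf_ennreal_geometric_half: "(\<Sum>l. ennreal (c * (1 / 2) ^ l)) = ennreal (2 * c)" if "0 \<le> c"
proof (rule suminf_ennreal_eq)
  have "(\<lambda>l. c * (1 / 2) ^ l) sums (c * (1 / (1 - 1 / 2)))" by (intro sums_mult geometric_sums) simp
  then show "(\<lambda>l. c * (1 / 2) ^ l) sums (2 * c)" by (simp add: mult.commute)
qed (use that in auto)

lemma prod_mono_ennreal:
  fixes f g :: "'i \<Rightarrow> ennreal"
  shows "(\<And>i. i \<in> I \<Longrightarrow> f i \<le> g i) \<Longrightarrow> (\<Prod>i\<in>I. f i) \<le> (\<Prod>i\<in>I. g i)"
  by (induction I rule: infinite_finite_induct) (auto intro!: mult_mono)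

context soft_boolean_model
begin

lemma measurable_component [measurable]: "Measurable.pred M (\<lambda>\<omega>. v \<in> origin_component \<beta> X R W \<omega>)"
proof -
  have "Measurable.pred M (\<lambda>\<omega>. (edge \<beta> X R W \<omega> ^^ n) 0 v)" for n v
  proof (induction n arbitrary: v)
    case (Suc n)
    have "(\<lambda>\<omega>. (edge \<beta> X R W \<omega> ^^ Suc n) 0 v) = (\<lambda>\<omega>. \<exists>w. (edge \<beta> X R W \<omega> ^^ n) 0 w \<and> edge \<beta> X R W \<omega> w v)"
      by (auto simp: relcompp_apply)
    then show ?case
      using Suc by (simp only:) (intro pred_intros_countable pred_intros_logic measurable_edge)
  qed simp
  then have "Measurable.pred M (\<lambda>\<omega>. \<exists>n. (edge \<beta> X R W \<omega> ^^ n) 0 v)"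
    by (intro pred_intros_countable)
  moreover have "(v \<in> origin_component \<beta> X R W \<omega>) = (\<exists>n. (edge \<beta> X R W \<omega> ^^ n) 0 v)" for \<omega>
    by (simp add: origin_component_def rtranclp_power)
  ultimately show ?thesis by simp
qed

lemma measurable_component_size [measurable]: "origin_component_size \<beta> X R W \<in> borel_measurable M"
proof -
  have "origin_component_size \<beta> X R W \<omega> = (\<Sum>v. if v \<in> origin_component \<beta> X R W \<omega> then 1 else 0)" for \<omega>
  proof -
    have "origin_component_size \<beta> X R W \<omega> = (\<integral>\<^sup>+v. indicator (origin_component \<beta> X R W \<omega>) v \<partial>count_space UNIV)"
      by (simp add: origin_component_size_def)
    also have "\<dots> = (\<Sum>v. indicator (origin_component \<beta> X R W \<omega>) v)"
      by (rule nn_integral_count_space_nat)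
    finally show ?thesis by (simp add: indicator_def of_bool_def)
  qed
  then have "origin_component_size \<beta> X R W = (\<lambda>\<omega>. \<Sum>v. if v \<in> origin_component \<beta> X R W \<omega> then 1 else 0)"
    by (rule ext)
  then show ?thesis by simp
qed

text \<open>Union bound over the paths from the origin to a vertex with radius above
  \<open>u\<close>. Every other vertex of the path has degree at most 2 and costs at most
  \<open>E (R ^ (2 * d)) = 1 / (1 - 2 * \<gamma>)\<close>; the end has degree at most 1 and costs
  the tail moment. By \<open>small\<close>, the sum over lengths is at most a geometric series of
  ratio 1/2.\<close>

lemma prob_large_radius_in_component:
  fixes u :: real
  assumes \<beta>: "0 < \<beta>" and \<gamma>\<delta>: "0 < \<gamma>" "2 * \<gamma> < 1" "1 < \<delta>" and u: "1 \<le> u"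
    and small: "5 ^ CARD('n) * (\<delta> / (\<delta> - 1)) * \<beta> * (1 / (1 - 2 * \<gamma>)) \<le> 1 / 2"
  shows "emeasure M {\<omega> \<in> space M. \<exists>v\<in>origin_component \<beta> X R W \<omega>. u < R v \<omega>}
    \<le> ennreal (2 * (1 / (1 - \<gamma>) * u powr (real CARD('n) - real CARD('n) / \<gamma>)))"
proof -
  define d where "d = CARD('n)"
  define a where "a = real CARD('n) / \<gamma>"
  define K where "K = 5 ^ CARD('n) * (\<delta> / (\<delta> - 1)) * \<beta>"
  define B where "B = 1 / (1 - 2 * \<gamma>)"
  define T where "T = 1 / (1 - \<gamma>) * u powr (real d - a)"
  define G where "G l j = (if j = l then {u<..} else (UNIV :: real set))" for l j :: nat
  have d: "0 < d" by (simp add: d_def)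
  have K: "0 \<le> K" and B: "0 \<le> B" and T: "0 \<le> T" using \<beta> \<gamma>\<delta> by (auto simp: K_def B_def T_def)
  have a: "real (d * 2) < a" "real d < a"
    using \<gamma>\<delta> d by (auto simp: a_def d_def field_simps)
  have aB: "a / (a - real (d * 2)) = B" "a / (a - real d) = 1 / (1 - \<gamma>)"
    using \<gamma>\<delta> d by (auto simp: a_def d_def B_def field_simps)
  have "emeasure M {\<omega> \<in> space M. \<exists>v\<in>origin_component \<beta> X R W \<omega>. u < R v \<omega>}
      \<le> (\<integral>\<^sup>+i. emeasure M (valid_embedding \<beta> [0..<fst i] (G (fst i)) (snd i)) \<partial>count_space UNIV)"
  proof (rule emeasure_le_nn_integral_cover)
    show "valid_embedding \<beta> [0..<fst i] (G (fst i)) (snd i) \<in> sets M" for i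
      by (rule sets_valid_embedding) (simp add: G_def)
    show "AE \<omega> in M. \<omega> \<in> {\<omega> \<in> space M. \<exists>v\<in>origin_component \<beta> X R W \<omega>. u < R v \<omega>} \<longrightarrow>
      (\<exists>i. \<omega> \<in> valid_embedding \<beta> [0..<fst i] (G (fst i)) (snd i))"
    proof (intro AE_I2 impI)
      fix \<omega> assume "\<omega> \<in> {\<omega> \<in> space M. \<exists>v\<in>origin_component \<beta> X R W \<omega>. u < R v \<omega>}"
      then obtain v where v: "\<omega> \<in> space M" "(edge \<beta> X R W \<omega>)\<^sup>*\<^sup>* 0 v" "u < R v \<omega>"
        by (auto simp: origin_component_def)
      obtain l xs where xs: "tree_embedding (edge \<beta> X R W \<omega>) [0..<l] xs" "xs ! 0 = 0" "xs ! l = v"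
        using path_embedding[OF v(2)] by blast
      then have "distinct xs" "xs \<noteq> []" by (auto simp: tree_embedding_def)
      then obtain js where js: "xs = 0 # map Suc js" using distinct_from_0 xs(2) by blast
      have "\<omega> \<in> valid_embedding \<beta> [0..<l] (G l) js"
        using v xs by (auto simp: valid_embedding_def js[symmetric] G_def)
      then show "\<exists>i. \<omega> \<in> valid_embedding \<beta> [0..<fst i] (G (fst i)) (snd i)"
        by (intro exI[of _ "(l, js)"]) simp
    qed
  qed
  also have "\<dots> = (\<integral>\<^sup>+l. (\<integral>\<^sup>+js. emeasure M (valid_embedding \<beta> [0..<l] (G l) js) \<partial>count_space UNIV) \<partial>count_space UNIV)"
    by (subst nn_integral_fst_count_space[symmetric]) simp
  also have "\<dots> \<le> (\<integral>\<^sup>+l. ennreal (T * (1 / 2) ^ l) \<partial>count_space UNIV)"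
  proof (rule nn_integral_mono)
    fix l :: nat
    let ?I = "\<lambda>j. \<integral>\<^sup>+r. ennreal (r ^ (d * tree_degree [0..<l] j)) * indicator (G l j) r \<partial>pareto a"
    have deg: "tree_degree [0..<l] j \<le> 2" "tree_degree [0..<l] l \<le> 1" for j
      by (auto simp: tree_degree_def count_list_upt)
    have "(\<integral>\<^sup>+js. emeasure M (valid_embedding \<beta> [0..<l] (G l) js) \<partial>count_space UNIV)
        \<le> ennreal (K ^ l) * (\<Prod>j\<le>l. ?I j)"
      using expected_embeddings[of "[0..<l]" \<beta> "G l"] \<beta> \<gamma>\<delta> by (simp add: K_def d_def a_def G_def)
    also have "(\<Prod>j\<le>l. ?I j) = (\<Prod>j<l. ?I j) * ?I l"
      by (simp add: lessThan_Suc_atMost[symmetric])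
    also have "\<dots> \<le> (\<Prod>j<l. ennreal B) * ennreal T"
    proof (rule mult_mono)
      show "(\<Prod>j<l. ?I j) \<le> (\<Prod>j<l. ennreal B)"
        using deg d by (intro prod_mono_ennreal pareto_moment_le[OF a(1), unfolded aB]) auto
      \<comment> \<open>For \<open>l = 0\<close> the end is the origin itself, of degree 0; as radii
        exceed 1, the moment of order \<open>d\<close> bounds this case too.\<close>
      have "?I l \<le> (\<integral>\<^sup>+r. ennreal (r ^ d) * indicator {u<..} r \<partial>pareto a)"
        using pareto_moment_mono[of a "d * tree_degree [0..<l] l" d "{u<..}"] deg(2) a d by (simp add: G_def)
      then show "?I l \<le> ennreal T"
        using pareto_upper_moment_power[OF u a(2)] by (simp add: T_def aB)
    qed auto
    also have "ennreal (K ^ l) * ((\<Prod>j<l. ennreal B) * ennreal T) = ennreal (T * (K * B) ^ l)"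
      using K B T by (simp add: ennreal_power ennreal_mult power_mult_distrib mult_ac)
    also have "\<dots> \<le> ennreal (T * (1 / 2) ^ l)"
    proof -
      have "K * B \<le> 1 / 2" using small by (simp only: K_def B_def)
      then show ?thesis using K B T by (intro ennreal_leI mult_left_mono power_mono) auto
    qed
    finally show "(\<integral>\<^sup>+js. emeasure M (valid_embedding \<beta> [0..<l] (G l) js) \<partial>count_space UNIV) \<le> ennreal (T * (1 / 2) ^ l)"
      by (simp add: mult_left_mono)
  qed
  also have "\<dots> = ennreal (2 * T)"
    unfolding nn_integral_count_space_nat by (rule suminf_ennreal_geometric_half[OF T])
  finally show ?thesis by (simp add: T_def d_def a_def)
qed

text \<open>Each \<open>p\<close>-tuple of component vertices is covered by an embedded tree made of
  at most \<open>p\<close> paths, and an embedding with \<open>L\<close> edges covers at most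
  \<open>(L + 1) ^ p\<close> tuples. So the expected number of embeddings, with these
  multiplicities, bounds the \<open>p\<close>-th moment.\<close>

lemma truncated_component_moment:
  fixes u m :: real and p :: nat
  assumes \<beta>: "0 < \<beta>" and \<gamma>\<delta>: "0 < \<gamma>" "2 * \<gamma> < 1" "1 < \<delta>" and u: "1 \<le> u" and m: "0 \<le> m"
    and p: "2 \<le> p" "1 / \<gamma> < real (p + 1)"
  defines "a \<equiv> real CARD('n) / \<gamma>"
  defines "B \<equiv> a / (a - real (2 * CARD('n))) + a / (real (CARD('n) * (p + 1)) - a)"
  assumes small: "8 ^ p * (5 ^ CARD('n) * (\<delta> / (\<delta> - 1)) * \<beta> * B) \<le> 1 / 2"
  shows "ennreal (m ^ p) * emeasure M {\<omega> \<in> space M. ennreal m < origin_component_size \<beta> X R W \<omega>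
      \<and> (\<forall>v\<in>origin_component \<beta> X R W \<omega>. R v \<omega> \<le> u)}
    \<le> ennreal (2 * (B * u powr (real (CARD('n) * (p + 1)) - a)))"
proof -
  define d where "d = CARD('n)"
  define K where "K = 5 ^ CARD('n) * (\<delta> / (\<delta> - 1)) * \<beta>"
  define D where "D = u powr ((real (d * (p + 1)) - a) / real (p - 1))"
  define E where "E = {\<omega> \<in> space M. ennreal m < origin_component_size \<beta> X R W \<omega>
      \<and> (\<forall>v\<in>origin_component \<beta> X R W \<omega>. R v \<omega> \<le> u)}"
  define V where "V = (\<lambda>(ps, js). if path_tree p ps then valid_embedding \<beta> ps (\<lambda>_. {..u}) js else {})"
  have d: "0 < d" by (simp add: d_def)
  have a: "real (2 * d) < a" "a < real (d * (p + 1))"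
  proof -
    show "real (2 * d) < a" using \<gamma>\<delta> d by (auto simp: a_def d_def field_simps)
    have "real d * (1 / \<gamma>) < real d * real (p + 1)" using p d by (intro mult_strict_left_mono) auto
    then show "a < real (d * (p + 1))" by (simp add: a_def d_def distrib_left)
  qed
  have K: "0 \<le> K" using \<beta> \<gamma>\<delta> by (auto simp: K_def)
  have B: "0 \<le> B" using a unfolding B_def d_def[symmetric] by simp
  have D: "1 \<le> D" unfolding D_def using u p a by (intro ge_one_powr_ge_zero) auto
  have Dp: "D ^ (p - 1) = u powr (real (d * (p + 1)) - a)"
    using u p by (simp add: D_def powr_powr flip: powr_realpow)
  have V: "V i \<in> sets M" for i
    by (cases i) (auto simp: V_def intro!: sets_valid_embedding)
  have E: "E \<in> sets M" unfolding E_def Ball_def by measurable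
  have pt: "ennreal (m ^ p) * indicator E \<omega> \<le> (\<integral>\<^sup>+i. of_nat (Suc (length (fst i)) ^ p) * indicator (V i) \<omega> \<partial>count_space UNIV)" for \<omega>
  proof (cases "\<omega> \<in> E")
    case True
    then obtain F where F: "F \<subseteq> origin_component \<beta> X R W \<omega>" "finite F" "m \<le> real (card F)"
      using finite_subset_of_large_set[of m "origin_component \<beta> X R W \<omega>"] m
      by (auto simp: E_def origin_component_size_def)
    define Y where "Y = {ys. set ys \<subseteq> F \<and> length ys = p}"
    let ?T = "\<lambda>i. {ys. set ys \<subseteq> set (0 # map Suc (snd i))}"
    have Y: "finite Y" "card Y = card F ^ p"
      unfolding Y_def using F(2) by (auto intro: finite_lists_length_eq card_lists_length_eq)
    have "of_nat (card Y) \<le> (\<integral>\<^sup>+i. of_nat (Suc (length (fst i)) ^ p) * indicator {i. \<omega> \<in> V i} i \<partial>count_space UNIV :: ennreal)"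
    proof (rule card_le_nn_integral_cover[OF Y(1), where T = ?T])
      fix ys assume "ys \<in> Y"
      then have ys: "set ys \<subseteq> F" "length ys = p" by (auto simp: Y_def)
      then have "(edge \<beta> X R W \<omega>)\<^sup>*\<^sup>* 0 y" if "y \<in> set ys" for y
        using that F(1) by (auto simp: origin_component_def)
      then obtain ps xs where *: "path_tree p ps" "tree_embedding (edge \<beta> X R W \<omega>) ps xs" "xs ! 0 = 0" "set ys \<subseteq> set xs"
        using path_tree_covers[of ys "edge \<beta> X R W \<omega>" 0] ys(2) by auto
      then have "distinct xs" "xs \<noteq> []" by (auto simp: tree_embedding_def)
      then obtain js where js: "xs = 0 # map Suc js" using distinct_from_0 *(3) by blast
      have "R (xs ! j) \<omega> \<le> u" if "j \<le> length ps" for j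
        using tree_embedding_reach[OF *(2) path_tree_parent[OF *(1)] that] *(3) True
        by (auto simp: E_def origin_component_def)
      then have "\<omega> \<in> V (ps, js)"
        using True *(1,2) by (auto simp: V_def valid_embedding_def js[symmetric] E_def)
      then show "\<exists>i. \<omega> \<in> V i \<and> ys \<in> ?T i"
        using *(4) js by (intro exI[of _ "(ps, js)"]) auto
    next
      fix i assume i: "\<omega> \<in> V i"
      let ?xs = "0 # map Suc (snd i)"
      have "tree_embedding (edge \<beta> X R W \<omega>) (fst i) ?xs"
        using i by (auto simp: V_def valid_embedding_def split: if_splits prod.splits)
      then have c: "card (set ?xs) = Suc (length (fst i))"
        using distinct_card[of ?xs] by (simp only: tree_embedding_def)
      have "Y \<inter> ?T i \<subseteq> {ys. set ys \<subseteq> set ?xs \<and> length ys = p}" by (auto simp: Y_def)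
      then have "card (Y \<inter> ?T i) \<le> card {ys. set ys \<subseteq> set ?xs \<and> length ys = p}"
        by (intro card_mono finite_lists_length_eq) auto
      also have "\<dots> = Suc (length (fst i)) ^ p"
        using card_lists_length_eq[of "set ?xs" p] c by simp
      finally show "card (Y \<inter> ?T i) \<le> Suc (length (fst i)) ^ p" .
    qed
    also have "\<dots> = (\<integral>\<^sup>+i. of_nat (Suc (length (fst i)) ^ p) * indicator (V i) \<omega> \<partial>count_space UNIV)"
      by (intro nn_integral_cong) (simp add: indicator_def)
    finally have Y_le: "of_nat (card Y) \<le> (\<integral>\<^sup>+i. of_nat (Suc (length (fst i)) ^ p) * indicator (V i) \<omega> \<partial>count_space UNIV :: ennreal)" .
    have "ennreal (m ^ p) \<le> of_nat (card Y)"
    proof -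
      have "m ^ p \<le> real (card Y)" using F(3) m Y(2) by (simp add: power_mono)
      then show ?thesis by (simp add: ennreal_of_nat_eq_real_of_nat ennreal_leI)
    qed
    then show ?thesis using order.trans[OF _ Y_le] True by simp
  qed simp
  \<comment> \<open>Each of the \<open>L + 1\<close> vertices contributes \<open>B\<close> times
    \<open>D\<close> to the power of its excess. The excesses sum to at most \<open>p - 1\<close>,
    and the surplus vertex accounts for the single factor \<open>B\<close> in front.\<close>
  have emb: "(\<integral>\<^sup>+js. emeasure M (valid_embedding \<beta> ps (\<lambda>_. {..u}) js) \<partial>count_space UNIV)
      \<le> ennreal ((K * B) ^ length ps * (B * D ^ (p - 1)))" if ps: "path_tree p ps" for ps
  proof -
    let ?e = "\<lambda>j. tree_degree ps j - 2"
    have sum: "(\<Sum>j\<le>length ps. ?e j) \<le> p - 1" by (rule path_tree_degree_excess[OF ps])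
    have deg: "tree_degree ps j \<le> p + 1" if "j \<le> length ps" for j
    proof -
      have "?e j \<le> (\<Sum>j\<le>length ps. ?e j)" using that by (intro member_le_sum) auto
      then show ?thesis using sum p by linarith
    qed
    have "(\<integral>\<^sup>+js. emeasure M (valid_embedding \<beta> ps (\<lambda>_. {..u}) js) \<partial>count_space UNIV)
        \<le> ennreal (K ^ length ps) * (\<Prod>j\<le>length ps. \<integral>\<^sup>+r. ennreal (r ^ (d * tree_degree ps j)) * indicator {..u} r \<partial>pareto a)"
      using expected_embeddings[of ps \<beta> "\<lambda>_. {..u}"] path_tree_parent[OF ps] \<beta> \<gamma>\<delta> by (simp add: K_def d_def a_def)
    also have "\<dots> \<le> ennreal (K ^ length ps) * (\<Prod>j\<le>length ps. ennreal (B * D ^ ?e j))"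
      unfolding B_def D_def d_def[symmetric]
      using pareto_truncated_moment[OF u d a(1) p(1) a(2)] deg
      by (intro mult_left_mono prod_mono_ennreal) auto
    also have "\<dots> = ennreal (K ^ length ps * (B ^ Suc (length ps) * D ^ (\<Sum>j\<le>length ps. ?e j)))"
      using K B D by (simp add: prod_ennreal ennreal_mult[symmetric] prod.distrib power_sum prod_nonneg)
    also have "\<dots> \<le> ennreal (K ^ length ps * (B ^ Suc (length ps) * D ^ (p - 1)))"
      using K B D sum by (intro ennreal_leI mult_left_mono power_increasing) auto
    also have "K ^ length ps * (B ^ Suc (length ps) * D ^ (p - 1)) = (K * B) ^ length ps * (B * D ^ (p - 1))"
      by (simp add: power_mult_distrib mult_ac)
    finally show ?thesis .
  qed
  have "ennreal (m ^ p) * emeasure M E = (\<integral>\<^sup>+\<omega>. ennreal (m ^ p) * indicator E \<omega> \<partial>M)"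
    using E by (simp add: nn_integral_cmult_indicator)
  also have "\<dots> \<le> (\<integral>\<^sup>+\<omega>. (\<integral>\<^sup>+i. of_nat (Suc (length (fst i)) ^ p) * indicator (V i) \<omega> \<partial>count_space UNIV) \<partial>M)"
    by (intro nn_integral_mono pt)
  also have "\<dots> = (\<integral>\<^sup>+i. (\<integral>\<^sup>+\<omega>. of_nat (Suc (length (fst i)) ^ p) * indicator (V i) \<omega> \<partial>M) \<partial>count_space UNIV)"
    using V by (intro nn_integral_count_space_nn_integral) auto
  also have "\<dots> = (\<integral>\<^sup>+i. of_nat (Suc (length (fst i)) ^ p) * emeasure M (V i) \<partial>count_space UNIV)"
    using V by (simp add: nn_integral_cmult_indicator)
  also have "\<dots> = (\<integral>\<^sup>+ps. (\<integral>\<^sup>+js. of_nat (Suc (length ps) ^ p) * emeasure M (V (ps, js)) \<partial>count_space UNIV) \<partial>count_space UNIV)"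
    by (subst nn_integral_fst_count_space[symmetric]) simp
  also have "\<dots> \<le> (\<integral>\<^sup>+ps. (of_nat (Suc (length ps) ^ p) * ennreal ((K * B) ^ length ps * (B * D ^ (p - 1))))
      * indicator {ps. path_tree p ps} ps \<partial>count_space UNIV)"
  proof (rule nn_integral_mono)
    fix ps :: "nat list"
    show "(\<integral>\<^sup>+js. of_nat (Suc (length ps) ^ p) * emeasure M (V (ps, js)) \<partial>count_space UNIV)
      \<le> (of_nat (Suc (length ps) ^ p) * ennreal ((K * B) ^ length ps * (B * D ^ (p - 1))))
      * indicator {ps. path_tree p ps} ps"
    proof (cases "path_tree p ps")
      case True
      then have "(\<integral>\<^sup>+js. of_nat (Suc (length ps) ^ p) * emeasure M (V (ps, js)) \<partial>count_space UNIV)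
          = of_nat (Suc (length ps) ^ p) * (\<integral>\<^sup>+js. emeasure M (valid_embedding \<beta> ps (\<lambda>_. {..u}) js) \<partial>count_space UNIV)"
        unfolding V_def by (subst nn_integral_cmult[symmetric]) auto
      also have "\<dots> \<le> of_nat (Suc (length ps) ^ p) * ennreal ((K * B) ^ length ps * (B * D ^ (p - 1)))"
        by (intro mult_left_mono emb True) simp
      finally show ?thesis using True by simp
    qed (simp add: V_def)
  qed
  also have "\<dots> \<le> (\<Sum>L. of_nat (Suc L ^ (2 * p)) * (of_nat (Suc L ^ p) * ennreal ((K * B) ^ L * (B * D ^ (p - 1)))))"
    by (rule nn_integral_path_tree)
  also have "\<dots> \<le> (\<Sum>L. ennreal (B * D ^ (p - 1) * (1 / 2) ^ L))"
  proof (rule suminf_le)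
    fix L :: nat
    \<comment> \<open>The exponent \<open>3 * p\<close> is \<open>2 * p\<close> for the shapes plus
      \<open>p\<close> for the tuples; \<open>L + 1 \<le> 2 ^ L\<close> turns the polynomial into
      \<open>(8 ^ p) ^ L\<close>.\<close>
    have "real (Suc L ^ (2 * p)) * real (Suc L ^ p) \<le> (8 ^ p) ^ L"
    proof -
      have "real (Suc L) \<le> 2 ^ L" using of_nat_mono[OF Suc_leI[OF less_exp[of L]]] by simp
      then have "real (Suc L) ^ (3 * p) \<le> (2 ^ L) ^ (3 * p)" by (intro power_mono) auto
      also have "\<dots> = ((2 ^ 3) ^ p) ^ L" by (simp only: power_mult[symmetric] mult_ac)
      finally show ?thesis by (simp flip: power_add add: mult.commute)
    qed
    then have "real (Suc L ^ (2 * p)) * real (Suc L ^ p) * ((K * B) ^ L * (B * D ^ (p - 1)))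
        \<le> (8 ^ p) ^ L * ((K * B) ^ L * (B * D ^ (p - 1)))"
      using K B D by (intro mult_right_mono) auto
    also have "\<dots> = B * D ^ (p - 1) * (8 ^ p * (K * B)) ^ L" by (simp add: power_mult_distrib)
    also have "\<dots> \<le> B * D ^ (p - 1) * (1 / 2) ^ L"
    proof -
      have "8 ^ p * (K * B) \<le> 1 / 2" using small by (simp only: K_def)
      then show ?thesis using K B D by (intro mult_left_mono power_mono) auto
    qed
    finally show "of_nat (Suc L ^ (2 * p)) * (of_nat (Suc L ^ p) * ennreal ((K * B) ^ L * (B * D ^ (p - 1))))
      \<le> ennreal (B * D ^ (p - 1) * (1 / 2) ^ L)"
      using K B D
      by (simp only: ennreal_of_nat_eq_real_of_nat ennreal_mult[symmetric] of_nat_0_le_iff mult_nonneg_nonneg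
          zero_le_power order.trans[OF zero_le_one] mult.assoc ennreal_leI)
  qed auto
  also have "\<dots> = ennreal (2 * (B * D ^ (p - 1)))"
    using B D by (intro suminf_ennreal_geometric_half) auto
  finally show ?thesis by (simp only: E_def Dp d_def)
qed

end

section \<open>Lower bound\<close>

lemma norm_diff_in_grid_cell:
  fixes x y :: "real ^ 'n"
  assumes "0 < h" "grid h x = k" "grid h y = k"
  shows "norm (x - y) \<le> real CARD('n) * h"
proof -
  have "\<bar>(x - y) $ i\<bar> \<le> h" for i
  proof -
    have "of_int (k $ i) * h \<le> x $ i" "x $ i < (of_int (k $ i) + 1) * h"
      "of_int (k $ i) * h \<le> y $ i" "y $ i < (of_int (k $ i) + 1) * h"
      using assms(2,3) unfolding grid_eq_iff[OF assms(1)] by blast+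
    then show ?thesis unfolding distrib_right vector_minus_component by linarith
  qed
  then have "(\<Sum>i\<in>UNIV. \<bar>(x - y) $ i\<bar>) \<le> (\<Sum>i\<in>(UNIV :: 'n set). h)" by (intro sum_mono)
  then show ?thesis using norm_le_l1_cart[of "x - y"] by simp
qed

text \<open>By Bernoulli's inequality, \<open>1 + k * q \<le> (1 + q) ^ k\<close>, and
  \<open>(1 - q) * (1 + q) \<le> 1\<close>.\<close>

lemma one_minus_power_le:
  fixes q :: real
  assumes "0 \<le> q" "q \<le> 1"
  shows "(1 - q) ^ k \<le> 1 / (1 + real k * q)"
proof -
  have "(1 - q) ^ k * (1 + real k * q) \<le> (1 - q) ^ k * (1 + q) ^ k"
    using Bernoulli_inequality[of q k] assms by (intro mult_left_mono) auto
  also have "\<dots> = (1 - q * q) ^ k" by (simp add: power_mult_distrib[symmetric] algebra_simps)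
  also have "\<dots> \<le> 1" using assms by (intro power_le_one) (auto simp: mult_le_one)
  finally show ?thesis using assms by (simp add: pos_le_divide_eq add_pos_nonneg)
qed

text \<open>A Chernoff bound: for \<open>j < k\<close> the factor \<open>2 ^ j\<close> of
  \<open>(6 * m) ^ j\<close> is replaced by \<open>2 ^ k\<close>, and the series for
  \<open>exp (3 * m)\<close> remains. The total is at most \<open>exp (k - 3 * m)\<close>, hence at
  most \<open>exp (- 1)\<close> since \<open>k \<le> 2 * m\<close> and
  \<open>1 \<le> m\<close>.\<close>

lemma (in poisson_process) prob_count_less:
  assumes A: "A \<in> sets borel" "bounded A" and m: "1 \<le> m" "measure lborel A = 6 * m" and k: "real k \<le> 2 * m"
  shows "prob {\<omega> \<in> space M. card {i. X i \<omega> \<in> A} < k} \<le> 1 / 2"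
proof -
  note [measurable] = measurable_count[OF A]
  let ?N = "\<lambda>\<omega>. card {i. X i \<omega> \<in> A}"
  have "{\<omega> \<in> space M. ?N \<omega> < k} = (\<Union>j<k. {\<omega> \<in> space M. ?N \<omega> = j})" by auto
  then have "prob {\<omega> \<in> space M. ?N \<omega> < k} \<le> (\<Sum>j<k. prob {\<omega> \<in> space M. ?N \<omega> = j})"
    by (simp only:) (intro measure_UNION_le, auto)
  also have "\<dots> = (\<Sum>j<k. (6 * m) ^ j / fact j * exp (- (6 * m)))"
    by (simp add: poisson_counts[OF A] m)
  also have "\<dots> \<le> (\<Sum>j<k. 2 ^ k * ((3 * m) ^ j /\<^sub>R fact j) * exp (- (6 * m)))"
  proof (intro sum_mono mult_right_mono)
    fix j assume "j \<in> {..<k}"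
    then have "(2 :: real) ^ j \<le> 2 ^ k" by (intro power_increasing) auto
    then have "2 ^ j * ((3 * m) ^ j / fact j) \<le> 2 ^ k * ((3 * m) ^ j / fact j)"
      using m by (intro mult_right_mono) auto
    moreover have "(6 * m) ^ j = 2 ^ j * (3 * m) ^ j" using power_mult_distrib[of 2 "3 * m" j] by simp
    moreover have eq: "(3 * m) ^ j /\<^sub>R fact j = (3 * m) ^ j / fact j"
      by (simp add: divide_inverse mult.commute)
    ultimately show "(6 * m) ^ j / fact j \<le> 2 ^ k * ((3 * m) ^ j /\<^sub>R fact j)"
      unfolding eq by (simp only: times_divide_eq_right)
  qed simp
  also have "\<dots> = 2 ^ k * (\<Sum>j<k. (3 * m) ^ j /\<^sub>R fact j) * exp (- (6 * m))"
    by (simp only: sum_distrib_left sum_distrib_right)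
  also have "\<dots> \<le> exp (real k) * exp (3 * m) * exp (- (6 * m))"
  proof (intro mult_right_mono mult_mono)
    have "(2 :: real) ^ k \<le> exp 1 ^ k" using exp_ge_add_one_self[of 1] by (intro power_mono) auto
    then show "2 ^ k \<le> exp (real k)" by (simp flip: exp_of_nat_mult)
    show "(\<Sum>j<k. (3 * m) ^ j /\<^sub>R fact j) \<le> exp (3 * m)"
      unfolding exp_def using m by (intro sum_le_suminf summable_exp_generic) auto
    show "0 \<le> (\<Sum>j<k. (3 * m) ^ j /\<^sub>R fact j)" using m by (intro sum_nonneg) auto
  qed auto
  also have "\<dots> = exp (real k - 3 * m)" by (simp flip: exp_add)
  also have "\<dots> \<le> exp (- 1)" using k m by simp
  also have "\<dots> \<le> 1 / 2" using exp_ge_add_one_self[of 1] by (simp add: exp_minus field_simps)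
  finally show ?thesis .
qed

context soft_boolean_model
begin

lemma prob_no_large_radius:
  assumes "finite J" "J \<noteq> {}"
  shows "prob {\<omega> \<in> space M. \<forall>i\<in>J. R (Suc i) \<omega> \<le> s} = (\<Prod>i\<in>J. prob {\<omega> \<in> space M. R (Suc i) \<omega> \<le> s})"
proof -
  let ?f = "\<lambda>i. Inl (Suc i) :: nat + nat set"
  have inj: "inj_on ?f J" by (auto simp: inj_on_def)
  have "prob (\<Inter>k\<in>?f ` J. case_sum R W k -` {..s} \<inter> space M) = (\<Prod>k\<in>?f ` J. prob (case_sum R W k -` {..s} \<inter> space M))"
    using assms by (intro indep_varsD[OF marks_independent]) auto
  moreover have "(\<Inter>k\<in>?f ` J. case_sum R W k -` {..s} \<inter> space M) = {\<omega> \<in> space M. \<forall>i\<in>J. R (Suc i) \<omega> \<le> s}"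
    using assms(2) by auto
  moreover have "case_sum R W (?f i) -` {..s} \<inter> space M = {\<omega> \<in> space M. R (Suc i) \<omega> \<le> s}" for i
    by auto
  ultimately show ?thesis by (simp only: prod.reindex[OF inj] o_def)
qed

lemma prob_large_radius_ge:
  assumes J: "finite J" "k \<le> card J" "0 < k" and s: "0 < s" and q: "0 \<le> q" "q \<le> min 1 (s powr - (real CARD('n) / \<gamma>))"
  shows "1 - (1 - q) ^ k \<le> prob {\<omega> \<in> space M. \<exists>i\<in>J. s < R (Suc i) \<omega>}"
proof -
  have ne: "J \<noteq> {}" using J by auto
  have one: "prob {\<omega> \<in> space M. R (Suc i) \<omega> \<le> s} \<le> 1 - q" for i
  proof -
    have "{\<omega> \<in> space M. R (Suc i) \<omega> \<le> s} = space M - {\<omega> \<in> space M. s < R (Suc i) \<omega>}" by auto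
    then have "prob {\<omega> \<in> space M. R (Suc i) \<omega> \<le> s} = 1 - prob {\<omega> \<in> space M. s < R (Suc i) \<omega>}"
      by (simp only:) (rule prob_compl, measurable)
    then show ?thesis using radius_tail[OF s, of "Suc i"] q by simp
  qed
  have "prob {\<omega> \<in> space M. \<forall>i\<in>J. R (Suc i) \<omega> \<le> s} \<le> (\<Prod>i\<in>J. 1 - q)"
    unfolding prob_no_large_radius[OF J(1) ne] by (intro prod_mono conjI one) auto
  also have "\<dots> \<le> (1 - q) ^ k" using q J(2) by (auto intro!: power_decreasing)
  finally have "1 - (1 - q) ^ k \<le> 1 - prob {\<omega> \<in> space M. \<forall>i\<in>J. R (Suc i) \<omega> \<le> s}" by simp
  also have "\<dots> = prob (space M - {\<omega> \<in> space M. \<forall>i\<in>J. R (Suc i) \<omega> \<le> s})"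
    using J(1) by (intro prob_compl[symmetric]) measurable
  also have "space M - {\<omega> \<in> space M. \<forall>i\<in>J. R (Suc i) \<omega> \<le> s} = {\<omega> \<in> space M. \<exists>i\<in>J. s < R (Suc i) \<omega>}"
    by (auto simp: not_le)
  finally show ?thesis .
qed

text \<open>Radii are attached to indices, so the number of points in the cell does not tell which
  radii matter. Fixing the whole index set \<open>J\<close> separates locations from marks.\<close>

lemma prob_cell_and_large_radius:
  fixes h s :: real and J :: "nat set"
  assumes J: "finite J"
  defines "A \<equiv> {\<omega> \<in> space M. {i. grid h (X i \<omega>) = 0} = J}"
    and "B \<equiv> {\<omega> \<in> space M. \<exists>i\<in>J. s < R (Suc i) \<omega>}"
  shows "prob (A \<inter> B) = prob A * prob B" and "A \<in> sets M" and "B \<in> sets M"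
proof -
  have A: "A \<in> sigma_sets (space M) (\<Union>i. {X i -` B \<inter> space M | B. B \<in> sets borel})"
  proof -
    let ?N = "sigma (space M) (\<Union>i. {X i -` B \<inter> space M | B. B \<in> sets borel})"
    have X [measurable]: "X i \<in> ?N \<rightarrow>\<^sub>M borel" for i by (rule measurable_generator) simp
    have "{\<omega> \<in> space ?N. \<forall>i. grid h (X i \<omega>) = 0 \<longleftrightarrow> i \<in> J} \<in> sets ?N" by measurable
    moreover have "A = {\<omega> \<in> space ?N. \<forall>i. grid h (X i \<omega>) = 0 \<longleftrightarrow> i \<in> J}"
      unfolding A_def space_measure_of_conv by auto
    ultimately have "A \<in> sets ?N" by simp
    then show ?thesis by (simp only: sets_generator)
  qed
  have B: "B \<in> sigma_sets (space M) (\<Union>k\<in>UNIV <+> pairs. {case_sum R W k -` B \<inter> space M | B. B \<in> sets borel})"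
  proof -
    let ?N = "sigma (space M) (\<Union>k\<in>UNIV <+> pairs. {case_sum R W k -` B \<inter> space M | B. B \<in> sets borel})"
    have "case_sum R W (Inl v) \<in> ?N \<rightarrow>\<^sub>M borel" for v by (rule measurable_generator) auto
    then have [measurable]: "R v \<in> ?N \<rightarrow>\<^sub>M borel" for v by simp
    have "{\<omega> \<in> space ?N. \<exists>i\<in>J. s < R (Suc i) \<omega>} \<in> sets ?N" using J by measurable
    moreover have "B = {\<omega> \<in> space ?N. \<exists>i\<in>J. s < R (Suc i) \<omega>}"
      unfolding B_def space_measure_of_conv ..
    ultimately have "B \<in> sets ?N" by simp
    then show ?thesis by (simp only: sets_generator)
  qed
  show "prob (A \<inter> B) = prob A * prob B"
    by (rule indep_setD[OF points_marks_independent A B])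
  show "A \<in> sets M" "B \<in> sets M"
    using A B indep_setD_ev1[OF points_marks_independent] indep_setD_ev2[OF points_marks_independent] by auto
qed

text \<open>The threshold is the bound \<open>d * h\<close> on distances within the cell, divided by
  \<open>\<beta> powr (1 / d)\<close>. As weights exceed 1, such a point is joined to all others in
  the cell, including the origin, which accounts for the \<open>+ 1\<close>.\<close>

lemma component_size_hub:
  assumes \<beta>: "0 < \<beta>" and h: "0 < h" and J: "finite J" "J = {i. grid h (X i \<omega>) = 0}"
    and i0: "i0 \<in> J" "real CARD('n) * h * \<beta> powr - (1 / real CARD('n)) < R (Suc i0) \<omega>"
    and W1: "\<And>e. e \<in> pairs \<Longrightarrow> 1 < W e \<omega>"
  shows "ennreal (real (card J + 1)) \<le> origin_component_size \<beta> X R W \<omega>"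
proof -
  have cell: "grid h (location X \<omega> u) = 0" if "u \<in> insert 0 (Suc ` J)" for u
    using that J(2) by auto
  have e: "edge \<beta> X R W \<omega> u v" if uv: "u \<in> insert 0 (Suc ` J)" "v \<in> insert 0 (Suc ` J)" "u \<noteq> v"
      and hub: "u = Suc i0 \<or> v = Suc i0" for u v
  proof -
    have w: "1 \<le> W {u, v} \<omega>" using W1[OF doubleton_in_pairs[OF uv(3)]] by simp
    have one: "\<beta> powr (1 / real CARD('n)) * \<beta> powr - (1 / real CARD('n)) = 1"
      using \<beta> by (simp add: powr_minus)
    have "\<beta> powr (1 / real CARD('n)) * (real CARD('n) * h * \<beta> powr - (1 / real CARD('n)))
        = real CARD('n) * h * (\<beta> powr (1 / real CARD('n)) * \<beta> powr - (1 / real CARD('n)))"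
      by (simp only: mult_ac)
    then have "norm (location X \<omega> u - location X \<omega> v)
        \<le> \<beta> powr (1 / real CARD('n)) * (real CARD('n) * h * \<beta> powr - (1 / real CARD('n)))"
      using norm_diff_in_grid_cell[OF h cell[OF uv(1)] cell[OF uv(2)]] by (simp only: one mult_1_right)
    also have "\<dots> \<le> \<beta> powr (1 / real CARD('n)) * max (R u \<omega>) (R v \<omega>)"
      using hub i0(2) by (intro mult_left_mono) auto
    also have "\<dots> \<le> \<beta> powr (1 / real CARD('n)) * W {u, v} \<omega> * max (R u \<omega>) (R v \<omega>)"
    proof (rule mult_right_mono)
      show "\<beta> powr (1 / real CARD('n)) \<le> \<beta> powr (1 / real CARD('n)) * W {u, v} \<omega>"
        using mult_left_mono[OF w, of "\<beta> powr (1 / real CARD('n))"] by simp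
      have "0 \<le> real CARD('n) * h * \<beta> powr - (1 / real CARD('n))" using h by simp
      then show "0 \<le> max (R u \<omega>) (R v \<omega>)" using hub i0(2) by auto
    qed
    finally show ?thesis using uv(3) by (simp add: edge_def)
  qed
  have hub: "(edge \<beta> X R W \<omega>)\<^sup>*\<^sup>* 0 (Suc i0)"
    using i0(1) by (intro r_into_rtranclp e) auto
  have "insert 0 (Suc ` J) \<subseteq> origin_component \<beta> X R W \<omega>"
  proof
    fix v assume v: "v \<in> insert 0 (Suc ` J)"
    show "v \<in> origin_component \<beta> X R W \<omega>"
    proof (cases "v = Suc i0")
      case False
      then have "edge \<beta> X R W \<omega> (Suc i0) v" using v i0(1) by (intro e) auto
      then show ?thesis using hub by (simp add: origin_component_def rtranclp.rtrancl_into_rtrancl)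
    qed (use hub in \<open>simp add: origin_component_def\<close>)
  qed
  then have "emeasure (count_space UNIV) (insert 0 (Suc ` J)) \<le> origin_component_size \<beta> X R W \<omega>"
    unfolding origin_component_size_def by (intro emeasure_mono) auto
  moreover have "emeasure (count_space UNIV) (insert 0 (Suc ` J)) = ennreal (real (card J + 1))"
  proof -
    have "card (insert 0 (Suc ` J)) = card J + 1"
      using J(1) by (subst card_insert_disjoint) (auto simp: card_image)
    then show ?thesis using J(1) by (simp add: ennreal_of_nat_eq_real_of_nat)
  qed
  ultimately show ?thesis by simp
qed

text \<open>In \<open>c / 4\<close>, one factor 1/2 is the probability of enough points in the cell;
  the other comes from \<open>1 - (1 - q) ^ k \<ge> y / 2\<close> with \<open>y = m * q\<close>. The
  minimum with 1 in \<open>c\<close> ensures \<open>q \<le> 1\<close> and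
  \<open>y \<le> 1\<close>.\<close>

lemma component_size_tail_ge:
  fixes m :: real
  assumes \<beta>: "0 < \<beta>" and \<gamma>: "0 < \<gamma>" "\<gamma> < 1" and m: "1 < m"
  defines "c \<equiv> min 1 ((real CARD('n) * \<beta> powr - (1 / real CARD('n))) powr - (real CARD('n) / \<gamma>) * 6 powr - (1 / \<gamma>))"
  shows "c / 4 * m powr (1 - 1 / \<gamma>) \<le> prob {\<omega> \<in> space M. ennreal m < origin_component_size \<beta> X R W \<omega>}"
proof -
  define d where "d = real CARD('n)"
  define h where "h = (6 * m) powr (1 / d)"
  define s where "s = d * h * \<beta> powr - (1 / d)"
  \<comment> \<open>\<open>m\<close> rounded up: \<open>k\<close> points and the origin are more
    than \<open>m\<close> vertices, and \<open>m > 1\<close> gives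
    \<open>k \<le> 2 * m\<close>.\<close>
  define k where "k = nat \<lceil>m\<rceil>"
  define q where "q = c * m powr - (1 / \<gamma>)"
  have d: "0 < d" by (simp add: d_def)
  have h: "0 < h" using m by (simp add: h_def)
  have hd: "h ^ CARD('n) = 6 * m"
    using m by (simp add: h_def d_def powr_powr flip: powr_realpow)
  have s: "0 < s" using d h \<beta> by (simp add: s_def)
  have k: "m \<le> real k" "real k \<le> 2 * m" "0 < k"
    using m unfolding k_def by linarith+
  have c: "0 < c" "c \<le> 1" using \<beta> by (auto simp: c_def)
  have m1: "m powr - (1 / \<gamma>) \<le> 1" using powr_mono[of "- (1 / \<gamma>)" 0 m] m \<gamma> by simp
  have sp: "s powr - (d / \<gamma>) = (d * \<beta> powr - (1 / d)) powr - (d / \<gamma>) * 6 powr - (1 / \<gamma>) * m powr - (1 / \<gamma>)"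
  proof -
    have "s powr - (d / \<gamma>) = (d * \<beta> powr - (1 / d)) powr - (d / \<gamma>) * h powr - (d / \<gamma>)"
      using d h \<beta> by (simp add: s_def mult_ac powr_mult)
    also have "h powr - (d / \<gamma>) = (6 * m) powr - (1 / \<gamma>)"
      using d by (simp add: h_def powr_powr)
    also have "\<dots> = 6 powr - (1 / \<gamma>) * m powr - (1 / \<gamma>)" using m by (simp add: powr_mult)
    finally show ?thesis by simp
  qed
  have q: "0 \<le> q" "q \<le> min 1 (s powr - (d / \<gamma>))"
  proof -
    show "0 \<le> q" using c by (simp add: q_def)
    have "q \<le> 1" unfolding q_def using c m1 by (simp add: mult_le_one)
    moreover have "c \<le> (d * \<beta> powr - (1 / d)) powr - (d / \<gamma>) * 6 powr - (1 / \<gamma>)"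
      by (simp add: c_def d_def)
    then have "q \<le> s powr - (d / \<gamma>)"
      unfolding sp q_def by (rule mult_right_mono) simp
    ultimately show "q \<le> min 1 (s powr - (d / \<gamma>))" by simp
  qed
  define \<J> where "\<J> = {J :: nat set. finite J \<and> k \<le> card J}"
  define A where "A J = {\<omega> \<in> space M. {i. grid h (X i \<omega>) = 0} = J}" for J
  define B where "B J = {\<omega> \<in> space M. \<exists>i\<in>J. s < R (Suc i) \<omega>}" for J
  have cJ: "countable \<J>"
    by (rule countable_subset[OF _ countable_Collect_finite]) (auto simp: \<J>_def)
  have AB: "prob (A J \<inter> B J) = prob (A J) * prob (B J)" "A J \<in> sets M" "B J \<in> sets M" if "J \<in> \<J>" for J
    using prob_cell_and_large_radius(1)[of J h s] prob_cell_and_large_radius(2)[of J h]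
      prob_cell_and_large_radius(3)[of J s] that by (auto simp: A_def B_def \<J>_def)
  have disj: "disjoint_family_on A \<J>" "disjoint_family_on (\<lambda>J. A J \<inter> B J) \<J>"
    by (auto simp: disjoint_family_on_def A_def)
  have half: "ennreal (1 / 2) \<le> (\<integral>\<^sup>+J. emeasure M (A J) \<partial>count_space \<J>)"
  proof -
    let ?C = "{x :: real ^ 'n. grid h x = 0}"
    note meas [measurable] = measurable_count[OF borel_grid_cell bounded_grid_cell[OF h], of 0]
    have "prob {\<omega> \<in> space M. card {i. X i \<omega> \<in> ?C} < k} \<le> 1 / 2"
      using m k by (intro prob_count_less[where m = m] bounded_grid_cell[OF h]) (auto simp: measure_grid_cell[OF h] hd)
    moreover have "{\<omega> \<in> space M. k \<le> card {i. X i \<omega> \<in> ?C}} = space M - {\<omega> \<in> space M. card {i. X i \<omega> \<in> ?C} < k}"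
      by auto
    then have "prob {\<omega> \<in> space M. k \<le> card {i. X i \<omega> \<in> ?C}} = 1 - prob {\<omega> \<in> space M. card {i. X i \<omega> \<in> ?C} < k}"
      by (simp only:) (rule prob_compl, measurable)
    ultimately have "1 / 2 \<le> prob {\<omega> \<in> space M. k \<le> card {i. X i \<omega> \<in> ?C}}" by simp
    also have "{\<omega> \<in> space M. k \<le> card {i. X i \<omega> \<in> ?C}} = (\<Union>J\<in>\<J>. A J)"
    proof -
      \<comment> \<open>An infinite \<open>S\<close> has \<open>card S = 0\<close>, so
        \<open>0 < k\<close> excludes it.\<close>
      have "k \<le> card S \<longleftrightarrow> S \<in> \<J>" for S
        unfolding \<J>_def using card_ge_0_finite[of S] k(3) by force
      moreover have "(\<Union>J\<in>\<J>. A J) = {\<omega> \<in> space M. {i. grid h (X i \<omega>) = 0} \<in> \<J>}"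
        unfolding A_def by blast
      ultimately show ?thesis by (simp only: mem_Collect_eq)
    qed
    finally have "ennreal (1 / 2) \<le> emeasure M (\<Union>J\<in>\<J>. A J)"
      by (simp only: emeasure_eq_measure ennreal_leI)
    also have "\<dots> = (\<integral>\<^sup>+J. emeasure M (A J) \<partial>count_space \<J>)"
      using AB cJ disj by (intro emeasure_UN_countable) auto
    finally show ?thesis .
  qed
  have "ennreal (1 - (1 - q) ^ k) * ennreal (1 / 2) \<le> ennreal (1 - (1 - q) ^ k) * (\<integral>\<^sup>+J. emeasure M (A J) \<partial>count_space \<J>)"
    by (intro mult_left_mono half) simp
  also have "\<dots> = (\<integral>\<^sup>+J. ennreal (1 - (1 - q) ^ k) * emeasure M (A J) \<partial>count_space \<J>)"
    by (rule nn_integral_cmult[symmetric]) simp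
  also have "\<dots> \<le> (\<integral>\<^sup>+J. emeasure M (A J \<inter> B J) \<partial>count_space \<J>)"
  proof (rule nn_integral_mono)
    fix J assume "J \<in> space (count_space \<J>)"
    then have J: "J \<in> \<J>" "finite J" "k \<le> card J" by (auto simp: \<J>_def)
    have "1 - (1 - q) ^ k \<le> prob (B J)"
      unfolding B_def using J k s q by (intro prob_large_radius_ge) (auto simp: d_def)
    then have "ennreal (1 - (1 - q) ^ k) * emeasure M (A J) \<le> ennreal (prob (B J)) * emeasure M (A J)"
      by (intro mult_right_mono ennreal_leI) auto
    also have "\<dots> = emeasure M (A J \<inter> B J)"
      by (simp add: emeasure_eq_measure AB(1)[OF J(1)] ennreal_mult' mult.commute)
    finally show "ennreal (1 - (1 - q) ^ k) * emeasure M (A J) \<le> emeasure M (A J \<inter> B J)" .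
  qed
  also have "\<dots> = emeasure M (\<Union>J\<in>\<J>. A J \<inter> B J)"
    using AB cJ disj by (intro emeasure_UN_countable[symmetric]) auto
  also have "\<dots> \<le> emeasure M {\<omega> \<in> space M. ennreal m < origin_component_size \<beta> X R W \<omega>}"
  proof (rule emeasure_mono_AE)
    show "AE \<omega> in M. \<omega> \<in> (\<Union>J\<in>\<J>. A J \<inter> B J) \<longrightarrow> \<omega> \<in> {\<omega> \<in> space M. ennreal m < origin_component_size \<beta> X R W \<omega>}"
      using AE_weight_gt_1
    proof (eventually_elim, intro impI)
      fix \<omega> assume W1: "\<forall>e\<in>pairs. 1 < W e \<omega>" and "\<omega> \<in> (\<Union>J\<in>\<J>. A J \<inter> B J)"
      then obtain J i0 where J: "J \<in> \<J>" "\<omega> \<in> space M" "J = {i. grid h (X i \<omega>) = 0}" "i0 \<in> J" "s < R (Suc i0) \<omega>"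
        by (auto simp: A_def B_def)
      have "ennreal m < ennreal (real (card J + 1))"
        using J(1) k(1) m by (intro ennreal_lessI) (auto simp: \<J>_def)
      also have "\<dots> \<le> origin_component_size \<beta> X R W \<omega>"
        using J W1 by (intro component_size_hub[OF \<beta> h _ J(3,4)]) (auto simp: \<J>_def s_def d_def)
      finally show "\<omega> \<in> {\<omega> \<in> space M. ennreal m < origin_component_size \<beta> X R W \<omega>}"
        using J(2) by simp
    qed
  qed measurable
  finally have "ennreal ((1 - (1 - q) ^ k) * (1 / 2)) \<le> emeasure M {\<omega> \<in> space M. ennreal m < origin_component_size \<beta> X R W \<omega>}"
    by (simp only: ennreal_mult''[of "1 / 2" "1 - (1 - q) ^ k", simplified] ennreal_mult'')
  then have le: "(1 - (1 - q) ^ k) * (1 / 2) \<le> prob {\<omega> \<in> space M. ennreal m < origin_component_size \<beta> X R W \<omega>}"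
    by (simp only: emeasure_eq_measure ennreal_le_iff[OF measure_nonneg])
  define y where "y = m * q"
  have y: "y = c * m powr (1 - 1 / \<gamma>)"
    using m by (simp add: y_def q_def powr_diff powr_minus divide_inverse)
  have y01: "0 \<le> y" "y \<le> 1"
  proof -
    have "m powr (1 - 1 / \<gamma>) \<le> 1" using powr_mono[of "1 - 1 / \<gamma>" 0 m] m \<gamma> by simp
    then show "y \<le> 1" using c by (simp add: y mult_le_one)
    show "0 \<le> y" using c by (simp add: y)
  qed
  have "(1 - q) ^ k \<le> 1 / (1 + real k * q)" using q by (intro one_minus_power_le) auto
  also have "\<dots> \<le> 1 / (1 + y)"
    using k(1) q(1) y01 unfolding y_def by (intro frac_le add_left_mono mult_right_mono) auto
  \<comment> \<open>Equivalent to \<open>0 \<le> y * (1 - y)\<close>.\<close>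
  also have "\<dots> \<le> 1 - y / 2"
  proof -
    have "1 \<le> (1 - y / 2) * (1 + y)" using y01 mult_left_mono[of y 1 y] by (simp add: algebra_simps)
    then show ?thesis using y01 by (simp add: pos_divide_le_eq)
  qed
  finally show ?thesis using le y by simp
qed

end

section \<open>Upper tail estimate, infinite expectation and choice of the constants\<close>

context soft_boolean_model
begin

lemma component_size_tail_le:
  fixes m :: real and p :: nat
  assumes \<beta>: "0 < \<beta>" and \<gamma>\<delta>: "0 < \<gamma>" "2 * \<gamma> < 1" "1 < \<delta>" and m: "1 < m"
    and p: "2 \<le> p" "1 / \<gamma> < real (p + 1)"
  defines "a \<equiv> real CARD('n) / \<gamma>"
  defines "B \<equiv> a / (a - real (2 * CARD('n))) + a / (real (CARD('n) * (p + 1)) - a)"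
  assumes small: "8 ^ p * (5 ^ CARD('n) * (\<delta> / (\<delta> - 1)) * \<beta> * B) \<le> 1 / 2"
    "5 ^ CARD('n) * (\<delta> / (\<delta> - 1)) * \<beta> * (1 / (1 - 2 * \<gamma>)) \<le> 1 / 2"
  shows "prob {\<omega> \<in> space M. ennreal m < origin_component_size \<beta> X R W \<omega>}
    \<le> (2 * (1 / (1 - \<gamma>)) + 2 * B) * m powr (1 - 1 / \<gamma>)"
proof -
  define d where "d = real CARD('n)"
  define u where "u = m powr (1 / d)"
  define L where "L = {\<omega> \<in> space M. \<exists>v\<in>origin_component \<beta> X R W \<omega>. u < R v \<omega>}"
  define E where "E = {\<omega> \<in> space M. ennreal m < origin_component_size \<beta> X R W \<omega>
      \<and> (\<forall>v\<in>origin_component \<beta> X R W \<omega>. R v \<omega> \<le> u)}"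
  have d: "0 < d" by (simp add: d_def)
  have u: "1 \<le> u" unfolding u_def using m d by (intro ge_one_powr_ge_zero) auto
  have sets: "L \<in> sets M" "E \<in> sets M" unfolding L_def E_def Ball_def Bex_def by measurable
  have u1: "u powr (d - d / \<gamma>) = m powr (1 - 1 / \<gamma>)"
    using d by (simp add: u_def powr_powr diff_divide_distrib)
  \<comment> \<open>With \<open>u ^ d = m\<close> the growth of the truncated moment is
    \<open>m ^ p\<close> times the target rate; dividing by \<open>m ^ p\<close> is Markov's
    inequality for the \<open>p\<close>-th moment.\<close>
  have u2: "u powr (real (CARD('n) * (p + 1)) - a) = m ^ p * m powr (1 - 1 / \<gamma>)"
  proof -
    have "(real (CARD('n) * (p + 1)) - a) / d = real p + (1 - 1 / \<gamma>)"
      unfolding a_def d_def[symmetric] of_nat_mult using d by (simp add: field_simps)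
    then have "u powr (real (CARD('n) * (p + 1)) - a) = m powr (real p + (1 - 1 / \<gamma>))"
      by (simp add: u_def powr_powr)
    then show ?thesis using m by (simp only: powr_add) (simp add: powr_realpow)
  qed
  have B: "0 \<le> B"
  proof -
    have "real (2 * CARD('n)) \<le> a" using \<gamma>\<delta> d by (simp add: a_def d_def field_simps)
    moreover have "a \<le> real (CARD('n) * (p + 1))"
      using mult_left_mono[OF less_imp_le[OF p(2)], of d] d by (simp add: a_def d_def distrib_left)
    moreover have "0 \<le> a" using \<gamma>\<delta> by (simp add: a_def)
    ultimately show ?thesis unfolding B_def by (intro add_nonneg_nonneg divide_nonneg_nonneg) simp_all
  qed
  have "ennreal (prob L) \<le> ennreal (2 * (1 / (1 - \<gamma>) * m powr (1 - 1 / \<gamma>)))"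
    using prob_large_radius_in_component[OF \<beta> \<gamma>\<delta> u small(2)] u1
    by (simp add: L_def[symmetric] emeasure_eq_measure d_def)
  then have pL: "prob L \<le> 2 * (1 / (1 - \<gamma>)) * m powr (1 - 1 / \<gamma>)"
    using \<gamma>\<delta> by (subst (asm) ennreal_le_iff) (auto simp: mult.assoc)
  have "ennreal (m ^ p) * emeasure M E \<le> ennreal (2 * (B * (m ^ p * m powr (1 - 1 / \<gamma>))))"
    using truncated_component_moment[OF \<beta> \<gamma>\<delta> u _ p, of m] small(1) m u2
    unfolding E_def B_def a_def by simp
  then have "ennreal (m ^ p * prob E) \<le> ennreal (2 * (B * (m ^ p * m powr (1 - 1 / \<gamma>))))"
    using m by (simp add: emeasure_eq_measure ennreal_mult)
  then have "m ^ p * prob E \<le> 2 * (B * (m ^ p * m powr (1 - 1 / \<gamma>)))"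
    using B m by (subst (asm) ennreal_le_iff) auto
  then have "m ^ p * prob E \<le> m ^ p * (2 * B * m powr (1 - 1 / \<gamma>))" by (simp only: mult_ac)
  then have pE: "prob E \<le> 2 * B * m powr (1 - 1 / \<gamma>)"
    using m by (simp only: mult_le_cancel_left_pos zero_less_power order.strict_trans[OF zero_less_one])
  have "{\<omega> \<in> space M. ennreal m < origin_component_size \<beta> X R W \<omega>} \<subseteq> L \<union> E"
    by (auto simp: L_def E_def not_less)
  then have "prob {\<omega> \<in> space M. ennreal m < origin_component_size \<beta> X R W \<omega>} \<le> prob (L \<union> E)"
    using sets by (intro finite_measure_mono) auto
  also have "\<dots> \<le> prob L + prob E" using sets by (rule measure_Un_le)
  finally show ?thesis using pL pE by (simp only: distrib_right)
qed

lemma expected_component_size_infinite: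
  assumes \<beta>: "0 < \<beta>" and \<gamma>: "1 / 2 < \<gamma>" "\<gamma> < 1"
  shows "(\<integral>\<^sup>+\<omega>. origin_component_size \<beta> X R W \<omega> \<partial>M) = \<infinity>"
proof -
  define c where "c = min 1 ((real CARD('n) * \<beta> powr - (1 / real CARD('n))) powr - (real CARD('n) / \<gamma>) * 6 powr - (1 / \<gamma>)) / 4"
  have c: "0 < c" using \<beta> by (simp add: c_def)
  have \<gamma>0: "0 < \<gamma>" "0 < 2 - 1 / \<gamma>" using \<gamma> by (auto simp: field_simps)
  have lower: "ennreal (c * m powr (2 - 1 / \<gamma>)) \<le> (\<integral>\<^sup>+\<omega>. origin_component_size \<beta> X R W \<omega> \<partial>M)" if m: "1 < m" for m
  proof -
    let ?E = "{\<omega> \<in> space M. ennreal m < origin_component_size \<beta> X R W \<omega>}"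
    have E: "?E \<in> sets M" by measurable
    have "c * m powr (1 - 1 / \<gamma>) \<le> prob ?E"
      using component_size_tail_ge[OF \<beta> \<gamma>0(1) \<gamma>(2) m] by (simp add: c_def)
    moreover have "m powr (2 - 1 / \<gamma>) = m * m powr (1 - 1 / \<gamma>)"
      using m powr_add[of m 1 "1 - 1 / \<gamma>"] by simp
    ultimately have "c * m powr (2 - 1 / \<gamma>) \<le> m * prob ?E"
      using m mult_left_mono[of "c * m powr (1 - 1 / \<gamma>)" "prob ?E" m] by (simp add: mult_ac)
    then have "ennreal (c * m powr (2 - 1 / \<gamma>)) \<le> ennreal m * emeasure M ?E"
      using m by (simp add: emeasure_eq_measure ennreal_mult[symmetric] ennreal_leI)
    also have "\<dots> = (\<integral>\<^sup>+\<omega>. ennreal m * indicator ?E \<omega> \<partial>M)"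
      using E by (simp add: nn_integral_cmult_indicator)
    also have "\<dots> \<le> (\<integral>\<^sup>+\<omega>. origin_component_size \<beta> X R W \<omega> \<partial>M)"
      by (intro nn_integral_mono) (auto simp: indicator_def intro: less_imp_le)
    finally show ?thesis .
  qed
  show ?thesis
  proof (rule ccontr)
    assume "\<not> ?thesis"
    then obtain I where I: "(\<integral>\<^sup>+\<omega>. origin_component_size \<beta> X R W \<omega> \<partial>M) = ennreal I" "0 \<le> I"
      by (cases "\<integral>\<^sup>+\<omega>. origin_component_size \<beta> X R W \<omega> \<partial>M") auto
    \<comment> \<open>Chosen so that \<open>c * m powr (2 - 1 / \<gamma>)\<close> equals
      \<open>c + I + 1\<close>, which exceeds \<open>I\<close>.\<close>
    define m where "m = (1 + (I + 1) / c) powr (1 / (2 - 1 / \<gamma>))"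
    have "1 < 1 + (I + 1) / c" using I c by simp
    then have "1 < m" unfolding m_def using \<gamma>0 by (intro gr_one_powr) auto
    then have "c * m powr (2 - 1 / \<gamma>) \<le> I"
      using lower[of m] I by (simp add: ennreal_le_iff)
    moreover have "m powr (2 - 1 / \<gamma>) = 1 + (I + 1) / c"
      using \<gamma>0 I c by (simp add: m_def powr_powr add_pos_nonneg)
    moreover have "c * (1 + (I + 1) / c) = c + (I + 1)" using c by (simp add: field_simps)
    ultimately show False using c by simp
  qed
qed

end

theorem theorem2p3:
  fixes \<gamma> \<delta> :: real
  assumes "1 < \<delta>" and "0 < \<gamma>" and "\<gamma> < 1"
  shows "(1 / \<gamma> - 1 > 1 \<longrightarrow>
      (\<exists>\<beta>'>0. \<forall>\<beta>. 0 < \<beta> \<and> \<beta> < \<beta>' \<longrightarrow>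
        (\<exists>c C. 0 < c \<and> 0 < C \<and>
          (\<forall>(M :: 'w measure) (X :: nat \<Rightarrow> 'w \<Rightarrow> real ^ 'n) R W.
            soft_boolean_model \<gamma> \<delta> M X R W \<longrightarrow>
            (\<forall>m::real. 1 < m \<longrightarrow>
              c * m powr (1 - 1 / \<gamma>)
                \<le> measure M {\<omega> \<in> space M. ennreal m < origin_component_size \<beta> X R W \<omega>} \<and>
              measure M {\<omega> \<in> space M. ennreal m < origin_component_size \<beta> X R W \<omega>}
                \<le> C * m powr (1 - 1 / \<gamma>))))))
    \<and> (1 / \<gamma> - 1 < 1 \<longrightarrow>
      (\<forall>\<beta>>0. \<forall>(M :: 'w measure) (X :: nat \<Rightarrow> 'w \<Rightarrow> real ^ 'n) R W.
        soft_boolean_model \<gamma> \<delta> M X R W \<longrightarrow>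
        (\<integral>\<^sup>+ \<omega>. origin_component_size \<beta> X R W \<omega> \<partial>M) = \<infinity>))"
proof (intro conjI impI allI)
  assume "1 / \<gamma> - 1 > 1"
  then have \<gamma>: "2 * \<gamma> < 1" using assms(2) by (simp add: field_simps)
  \<comment> \<open>Rounding \<open>1 / \<gamma>\<close> up keeps
    \<open>1 / \<gamma> < p + 1\<close> strict even when \<open>1 / \<gamma>\<close> is an
    integer.\<close>
  define p where "p = nat \<lceil>1 / \<gamma>\<rceil>"
  have "2 < 1 / \<gamma>" using \<open>1 / \<gamma> - 1 > 1\<close> by simp
  then have p: "2 \<le> p" "1 / \<gamma> < real (p + 1)" unfolding p_def by linarith+
  define a where "a = real CARD('n) / \<gamma>"
  define B where "B = a / (a - real (2 * CARD('n))) + a / (real (CARD('n) * (p + 1)) - a)"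
  define K where "K = 5 ^ CARD('n) * (\<delta> / (\<delta> - 1))"
  define B' where "B' = 1 / (1 - 2 * \<gamma>)"
  have K: "0 < K" using assms by (simp add: K_def)
  have B': "0 < B'" using \<gamma> by (simp add: B'_def)
  have B: "0 \<le> B"
  proof -
    have d: "0 < real CARD('n)" by simp
    have "real (2 * CARD('n)) \<le> a" using \<gamma> assms(2) d by (simp add: a_def field_simps)
    moreover have "a \<le> real (CARD('n) * (p + 1))"
      using mult_left_mono[OF less_imp_le[OF p(2)], of "real CARD('n)"] by (simp add: a_def distrib_left)
    moreover have "0 \<le> a" using assms(2) by (simp add: a_def)
    ultimately show ?thesis unfolding B_def by (intro add_nonneg_nonneg divide_nonneg_nonneg) simp_all
  qed
  \<comment> \<open>One condition for both geometric series: \<open>B\<close> is the vertex factor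
    of the truncated trees and \<open>B'\<close> that of the paths, and their sum dominates each.
    The factor \<open>8 ^ p\<close> pays for shapes and tuples.\<close>
  define \<beta>' where "\<beta>' = 1 / (2 * (8 ^ p * (K * (B + B'))))"
  have pos: "0 < 8 ^ p * (K * (B + B'))" using K B B' by (intro mult_pos_pos add_nonneg_pos) auto
  show "\<exists>\<beta>'>0. \<forall>\<beta>. 0 < \<beta> \<and> \<beta> < \<beta>' \<longrightarrow>
        (\<exists>c C. 0 < c \<and> 0 < C \<and>
          (\<forall>(M :: 'w measure) (X :: nat \<Rightarrow> 'w \<Rightarrow> real ^ 'n) R W.
            soft_boolean_model \<gamma> \<delta> M X R W \<longrightarrow>
            (\<forall>m::real. 1 < m \<longrightarrow>
              c * m powr (1 - 1 / \<gamma>)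
                \<le> measure M {\<omega> \<in> space M. ennreal m < origin_component_size \<beta> X R W \<omega>} \<and>
              measure M {\<omega> \<in> space M. ennreal m < origin_component_size \<beta> X R W \<omega>}
                \<le> C * m powr (1 - 1 / \<gamma>))))"
  proof (rule exI[of _ \<beta>'], intro conjI allI impI)
    show "0 < \<beta>'" unfolding \<beta>'_def using pos by simp
    fix \<beta> assume \<beta>: "0 < \<beta> \<and> \<beta> < \<beta>'"
    \<comment> \<open>\<open>c\<close> and \<open>C\<close> are fixed before the model: they are
      built from the parameters and the dimension only.\<close>
    define c where "c = min 1 ((real CARD('n) * \<beta> powr - (1 / real CARD('n))) powr - (real CARD('n) / \<gamma>) * 6 powr - (1 / \<gamma>)) / 4"
    define C where "C = 2 * (1 / (1 - \<gamma>)) + 2 * B"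
    have small: "8 ^ p * (K * (B + B')) * \<beta> \<le> 1 / 2"
      using \<beta> pos by (simp add: \<beta>'_def field_simps)
    have "8 ^ p * (K * \<beta> * B) \<le> 8 ^ p * (K * (B + B')) * \<beta>"
      using K B' \<beta> by (simp add: mult_ac mult_left_mono)
    from this small have small1: "8 ^ p * (K * \<beta> * B) \<le> 1 / 2" by (rule order.trans)
    have "1 * (K * \<beta> * B') \<le> 8 ^ p * (K * \<beta> * (B + B'))"
      using K B B' \<beta> by (intro mult_mono mult_left_mono) auto
    then have small2: "K * \<beta> * B' \<le> 1 / 2" using small by (simp add: mult_ac)
    show "\<exists>c C. 0 < c \<and> 0 < C \<and>
          (\<forall>(M :: 'w measure) (X :: nat \<Rightarrow> 'w \<Rightarrow> real ^ 'n) R W.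
            soft_boolean_model \<gamma> \<delta> M X R W \<longrightarrow>
            (\<forall>m::real. 1 < m \<longrightarrow>
              c * m powr (1 - 1 / \<gamma>)
                \<le> measure M {\<omega> \<in> space M. ennreal m < origin_component_size \<beta> X R W \<omega>} \<and>
              measure M {\<omega> \<in> space M. ennreal m < origin_component_size \<beta> X R W \<omega>}
                \<le> C * m powr (1 - 1 / \<gamma>)))"
    proof (rule exI[of _ c], rule exI[of _ C], intro conjI allI impI)
      show "0 < c" using \<beta> by (simp add: c_def)
      show "0 < C" unfolding C_def using assms B by (intro add_pos_nonneg) auto
      fix M :: "'w measure" and X :: "nat \<Rightarrow> 'w \<Rightarrow> real ^ 'n" and R W and m :: real
      assume model: "soft_boolean_model \<gamma> \<delta> M X R W" and m: "1 < m"
      interpret soft_boolean_model \<gamma> \<delta> M X R W by (rule model)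
      show "c * m powr (1 - 1 / \<gamma>) \<le> prob {\<omega> \<in> space M. ennreal m < origin_component_size \<beta> X R W \<omega>}"
        using component_size_tail_ge[of \<beta> m] \<beta> assms m by (simp add: c_def)
      show "prob {\<omega> \<in> space M. ennreal m < origin_component_size \<beta> X R W \<omega>} \<le> C * m powr (1 - 1 / \<gamma>)"
        unfolding C_def B_def a_def
        by (rule component_size_tail_le[OF conjunct1[OF \<beta>] assms(2) \<gamma> assms(1) m p
              small1[unfolded K_def B_def a_def] small2[unfolded K_def B'_def]])
    qed
  qed
next
  fix \<beta> :: real and M :: "'w measure" and X :: "nat \<Rightarrow> 'w \<Rightarrow> real ^ 'n" and R W
  assume "1 / \<gamma> - 1 < 1" and \<beta>: "0 < \<beta>" and model: "soft_boolean_model \<gamma> \<delta> M X R W"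
  interpret soft_boolean_model \<gamma> \<delta> M X R W by (rule model)
  have "1 / 2 < \<gamma>" using \<open>1 / \<gamma> - 1 < 1\<close> assms(2) by (simp add: field_simps)
  then show "(\<integral>\<^sup>+ \<omega>. origin_component_size \<beta> X R W \<omega> \<partial>M) = \<infinity>"
    using \<beta> assms(3) by (intro expected_component_size_infinite)
qed

end
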